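(* Let $X_1,\dots,X_k\in\mathfrak g$. Let $$\Gamma_{X_1,\dots,X_k}=\Big\{(\varphi,d\pi(X_1)\varphi,\dots,d\pi(X_k)\varphi)\in \mathrm C_0(M)\times\dots\times \mathrm C_0(M):\ \varphi\in\bigcap_{i=1}^k\mathcal D(d\pi(X_i))\Big\}$$ be the graph of the generators $d\pi(X_1),\dots,d\pi(X_k)$, and let $$\Gamma_{X_1,\dots,X_k|\mathcal P}=\big\{(\varphi,d\pi(X_1)\varphi,\dots,d\pi(X_k)\varphi):\ \varphi\in\mathcal P\big\}$$ be its restriction to $\mathcal P$. Then, with respect to the strong (norm) product topology on $\mathrm C_0(M)\times\dots\times \mathrm C_0(M)$, $$\Gamma_{X_1,\dots,X_k}=\overline{\Gamma_{X_1,\dots,X_k|\mathcal P}}.$$ In particular, if $a_1,\dots,a_d$ is a basis of $\mathfrak g$, then $\Gamma_{a_1,\dots,a_d}=\overline{\Gamma_{a_1,\dots,a_d|\mathcal P}}$.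
   Context: $G\subset \mathrm{GL}(n,\mathbb R)$ is a real linear algebraic group (a closed subgroup of $\mathrm{GL}(n,\mathbb R)$) with Lie algebra $\mathfrak g\subset M_n(\mathbb R)$, and $M\subset\mathbb R^n$ is a smooth real affine algebraic variety on which $G$ acts regularly; the action of $G$ on $M\subset \mathbb R^n$ is by matrices, i.e. $(g,m)\mapsto gm$ is matrix multiplication. $\mathrm C_0(M)$ is the Banach space of continuous complex valued functions on $M$ vanishing at infinity, with the supremum norm. The left regular representation $\pi$ of $G$ on $\mathrm C_0(M)$ is $(\pi(g)\varphi)(m)=\varphi(g^{-1}m)$; it is a (strongly continuous) Banach representation. For $X\in\mathfrak g$, $d\pi(X)\varphi=\frac{d}{dh}\pi(e^{hX})\varphi|_{h=0}$ is the generator of the one-parameter group $h\mapsto\pi(e^{hX})$, with domain $\mathcal D(d\pi(X))$ the set of all $\varphi\in \mathrm C_0(M)$ for which the limit exists in $\mathrm C_0(M)$. $\mathbb C[M]$ is the ring of all functions on $M$ obtained by restricting polynomials (with complex coefficients) on $\mathbb R^n$ to $M$, $r^2(m)=m_1^2+\dots+m_n^2$, and $\mathcal P=\mathbb C[M]\cdot e^{-r^2}\subset \mathrm C_0(M)$. One has $\mathcal P\subset\mathcal D(d\pi(X))$ for all $X\in\mathfrak g$. *)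

theory Defs
  imports "HOL-Analysis.Analysis"
begin

subsection \<open>Real algebraic sets and linear algebraic groups\<close>

definition algebraic_set :: "'a::euclidean_space set \<Rightarrow> bool" where
  "algebraic_set V \<longleftrightarrow>
     (\<exists>P. (\<forall>p\<in>P. real_polynomial_function p) \<and> V = {x. \<forall>p\<in>P. p x = 0})"

definition vanishing_ideal :: "'a::euclidean_space set \<Rightarrow> ('a \<Rightarrow> real) set" where
  "vanishing_ideal V = {p. real_polynomial_function p \<and> (\<forall>x\<in>V. p x = 0)}"

text \<open>
  Smoothness over the reals at a point \<open>x\<close> of \<open>V\<close>: on a principal Zariski-open
  neighbourhood \<open>{h \<noteq> 0}\<close> of \<open>x\<close>, the coordinate ring of \<open>V\<close> has a presentation
  \<open>\<real>[x\<^sub>1,\<dots>,x\<^sub>n]\<^sub>h / (f\<^sub>0,\<dots>,f\<^sub>c\<^sub>-\<^sub>1)\<close> in which the gradients of the \<open>f\<^sub>i\<close> at \<open>x\<close> are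
  linearly independent. The exponent \<open>N\<close> clears the denominators of the localisation
  at \<open>h\<close>. The codimension \<open>c\<close> may depend on \<open>x\<close>.
\<close>
definition smooth_at :: "'a::euclidean_space set \<Rightarrow> 'a \<Rightarrow> bool" where
  "smooth_at V x \<longleftrightarrow>
     (\<exists>(c::nat) f D h.
        (\<forall>i<c. f i \<in> vanishing_ideal V \<and> GDERIV (f i) x :> D i) \<and>
        inj_on D {..<c} \<and> independent (D ` {..<c}) \<and>
        real_polynomial_function h \<and> h x \<noteq> 0 \<and>
        (\<forall>p\<in>vanishing_ideal V. \<exists>(N::nat) q.
           (\<forall>i<c. real_polynomial_function (q i)) \<and>
           (\<forall>y. h y ^ N * p y = (\<Sum>i<c. q i y * f i y))))"

definition smooth_affine_variety :: "'a::euclidean_space set \<Rightarrow> bool" where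
  "smooth_affine_variety V \<longleftrightarrow> algebraic_set V \<and> (\<forall>x\<in>V. smooth_at V x)"

definition linear_algebraic_group :: "(real^'n^'n) set \<Rightarrow> bool" where
  "linear_algebraic_group G \<longleftrightarrow>
     (\<exists>Z. algebraic_set Z \<and> G = Z \<inter> {A. invertible A}) \<and>
     mat 1 \<in> G \<and> (\<forall>A\<in>G. \<forall>B\<in>G. A ** B \<in> G) \<and> (\<forall>A\<in>G. matrix_inv A \<in> G)"

text \<open>
  The class-based \<^const>\<open>exp\<close> is not available for \<^typ>\<open>real^'n^'n\<close>, whose multiplication
  \<open>*\<close> is moreover componentwise.
\<close>
definition matrix_exp :: "real^'n^'n \<Rightarrow> real^'n^'n" where
  "matrix_exp A = (\<Sum>k. (((**) A) ^^ k) (mat 1) /\<^sub>R fact k)"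

definition lie_algebra :: "(real^'n^'n) set \<Rightarrow> (real^'n^'n) set" where
  "lie_algebra G = {X. \<forall>t::real. matrix_exp (t *\<^sub>R X) \<in> G}"


subsection \<open>The left regular representation and its generators\<close>

text \<open>
  A function on \<open>M\<close> is represented by its extensional extension to the whole type (value
  \<^term>\<open>undefined\<close> outside \<open>M\<close>). The metric inherited from \<^const>\<open>cfunspace\<close> is the
  supremum metric over \<open>M\<close>.
\<close>
definition c0_space :: "'a::euclidean_space set \<Rightarrow> ('a \<Rightarrow> complex) metric" where
  "c0_space M = submetric (cfunspace (top_of_set M) euclidean_metric)
     {\<phi>. \<forall>\<epsilon>>0. \<exists>K. compact K \<and> K \<subseteq> M \<and> (\<forall>m\<in>M - K. norm (\<phi> m) < \<epsilon>)}"

definition left_regular ::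
    "(real^'n) set \<Rightarrow> real^'n^'n \<Rightarrow> (real^'n \<Rightarrow> complex) \<Rightarrow> (real^'n \<Rightarrow> complex)" where
  "left_regular M g \<phi> = (\<lambda>m\<in>M. \<phi> (matrix_inv g *v m))"

definition has_generator_value ::
    "(real^'n) set \<Rightarrow> real^'n^'n \<Rightarrow> (real^'n \<Rightarrow> complex) \<Rightarrow> (real^'n \<Rightarrow> complex) \<Rightarrow> bool" where
  "has_generator_value M X \<phi> \<psi> \<longleftrightarrow>
     limitin (mtopology_of (c0_space M))
       (\<lambda>h::real. \<lambda>m\<in>M. (left_regular M (matrix_exp (h *\<^sub>R X)) \<phi> m - \<phi> m) /\<^sub>R h) \<psi> (at 0)"

definition generator_domain ::
    "(real^'n) set \<Rightarrow> real^'n^'n \<Rightarrow> (real^'n \<Rightarrow> complex) set" where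
  "generator_domain M X = {\<phi> \<in> mspace (c0_space M). \<exists>\<psi>. has_generator_value M X \<phi> \<psi>}"

definition generator ::
    "(real^'n) set \<Rightarrow> real^'n^'n \<Rightarrow> (real^'n \<Rightarrow> complex) \<Rightarrow> (real^'n \<Rightarrow> complex)" where
  "generator M X \<phi> = (THE \<psi>. has_generator_value M X \<phi> \<psi>)"

text \<open>\<^term>\<open>polynomial_function p\<close> with complex values means that the real and imaginary parts
  of \<open>p\<close> are real polynomials, i.e. \<open>p\<close> is a polynomial with complex coefficients.\<close>
definition gaussian_polynomials :: "(real^'n) set \<Rightarrow> (real^'n \<Rightarrow> complex) set" where
  "gaussian_polynomials M =
     {\<lambda>m\<in>M. p m * complex_of_real (exp (- (\<Sum>j\<in>UNIV. (m $ j)\<^sup>2))) |p. polynomial_function p}"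

text \<open>
  A tuple \<open>(\<phi>, \<psi>\<^sub>1, \<dots>, \<psi>\<^sub>k)\<close> is encoded as a pair of \<open>\<phi>\<close> and the extensional family
  \<open>(\<psi>\<^sub>i)\<close> indexed by \<open>{1..k}\<close>.
\<close>
definition graph_space ::
    "(real^'n) set \<Rightarrow> nat \<Rightarrow> ((real^'n \<Rightarrow> complex) \<times> (nat \<Rightarrow> real^'n \<Rightarrow> complex)) topology" where
  "graph_space M k = prod_topology (mtopology_of (c0_space M))
     (product_topology (\<lambda>_. mtopology_of (c0_space M)) {1..k})"

definition generators_graph_on ::
    "(real^'n \<Rightarrow> complex) set \<Rightarrow> (real^'n) set \<Rightarrow> nat \<Rightarrow> (nat \<Rightarrow> real^'n^'n) \<Rightarrow>
     ((real^'n \<Rightarrow> complex) \<times> (nat \<Rightarrow> real^'n \<Rightarrow> complex)) set" where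
  "generators_graph_on S M k X = {(\<phi>, \<lambda>i\<in>{1..k}. generator M (X i) \<phi>) |\<phi>. \<phi> \<in> S}"

definition generators_graph ::
    "(real^'n) set \<Rightarrow> nat \<Rightarrow> (nat \<Rightarrow> real^'n^'n) \<Rightarrow>
     ((real^'n \<Rightarrow> complex) \<times> (nat \<Rightarrow> real^'n \<Rightarrow> complex)) set" where
  "generators_graph M k X =
     generators_graph_on {\<phi> \<in> mspace (c0_space M). \<forall>i\<in>{1..k}. \<phi> \<in> generator_domain M (X i)} M k X"

end

theory Submission
  imports Defs
begin

text \<open>
  That the graph is closed follows from the mean value inequality along \<open>e\<^bsup>tX\<^esup>\<close>. For the density,
  average over the group: in product coordinates \<open>U x = e\<^bsup>x\<^sub>1a\<^sub>1\<^esup> \<dots> e\<^bsup>x\<^sub>Na\<^sub>N\<^esup>\<close>, where the \<open>a\<^sub>j\<close> span the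
  Lie algebra, let \<open>T\<^sub>\<epsilon> \<phi>\<close> be the integral of \<open>\<kappa>\<^sub>\<epsilon>(y) \<phi>(U(\<epsilon>y) z)\<close> over a bump \<open>\<kappa>\<^sub>\<epsilon>\<close>. Both
  \<open>T\<^sub>\<epsilon> d\<pi>(X)\<close> and \<open>d\<pi>(X) T\<^sub>\<epsilon>\<close> are derivatives along vector fields in the coordinates, hence by
  partial integration again averages and bounded operators for fixed \<open>\<epsilon>\<close>. The field of the
  commutator vanishes at \<open>0\<close>, so its kernel stays bounded as \<open>\<epsilon> \<rightarrow> 0\<close>; as the kernel has integral
  \<open>0\<close>, the commutator tends strongly to \<open>0\<close> (Friedrichs). So \<open>(T\<^sub>\<epsilon> f, d\<pi>(X) T\<^sub>\<epsilon> f)\<close>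
  is close to \<open>(\<phi>, d\<pi>(X) \<phi>)\<close> for small \<open>\<epsilon>\<close> as soon as \<open>f\<close> is uniformly close enough to \<open>\<phi>\<close>, and
  \<open>f\<close> may be a Gaussian polynomial by the Stone-Weierstrass theorem. Finally \<open>T\<^sub>\<epsilon> f\<close> is an average
  of functions \<open>p(Az) e\<^bsup>-|Az|\<^sup>2\<^esup>\<close> with \<open>A\<close> near the identity; a Taylor polynomial of
  \<open>e\<^bsup>|z|\<^sup>2-|Az|\<^sup>2\<^esup>\<close> turns it into a Gaussian polynomial, up to an error that is small together with
  its derivatives.
\<close>


section \<open>The matrix exponential\<close>

text \<open>The obstacle is that Gaussian polynomials are stable under d\<pi>(X) but not under the
  group: a non-orthogonal g turns e^(-|z|^2) into another quadratic exponential, so the criterion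
  that a dense invariant subspace of the domain is a core does not apply. Averaging gives control of
  the derivatives but leaves the space. The Taylor step leads back into it, and its error stays
  below the Gaussian only for matrices close to the identity; this is one more reason for small
  \<epsilon>. Lebesgue measure in the coordinates takes the place of a Haar measure, since partial
  integration needs a divergence but no invariance. There are n^2 coordinates whatever the dimension
  of the group; they need not be injective, as only the solvability of dU(x) c = D(x) U(x) Y(x) near
  0 is used. The kernel of T d\<pi>(X) may grow like 1/\<epsilon>. Hence \<epsilon> is fixed first,
  and the distance of f from \<phi> and the Taylor degree are chosen afterwards. Since \<pi>(e^(hX))
  F is F(e^(-hX) z), the generator of a differentiable F is z \<mapsto> -F'(z)(X z); all minus signs
  stem from this.\<close>

lemma bounded_bilinear_matrix_mult:
  "bounded_bilinear ((**) :: real^'n^'m \<Rightarrow> real^'p^'n \<Rightarrow> real^'p^'m)"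
  unfolding bilinear_conv_bounded_bilinear[symmetric] bilinear_def
proof (intro conjI allI linearI)
  fix x y :: "real^'n^'m" and z w :: "real^'p^'n" and r :: real
  show "x ** (z + w) = x ** z + x ** w" "(x + y) ** z = x ** z + y ** z"
    by (simp_all add: matrix_matrix_mult_def vec_eq_iff sum.distrib distrib_left distrib_right)
  show "x ** (r *\<^sub>R z) = r *\<^sub>R (x ** z)" "(r *\<^sub>R x) ** z = r *\<^sub>R (x ** z)"
    by (simp_all add: matrix_matrix_mult_def vec_eq_iff sum_distrib_left mult_ac)
qed

interpretation matmul: bounded_bilinear
  "(**) :: real^'n^'m \<Rightarrow> real^'p^'n \<Rightarrow> real^'p^'m"
  by (rule bounded_bilinear_matrix_mult)

lemma bounded_bilinear_matrix_vector_mult: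
  "bounded_bilinear ((*v) :: real^'n^'m \<Rightarrow> real^'n \<Rightarrow> real^'m)"
  unfolding bilinear_conv_bounded_bilinear[symmetric] bilinear_def
proof (intro conjI allI linearI)
  fix x y :: "real^'n^'m" and z w :: "real^'n" and r :: real
  show "x *v (z + w) = x *v z + x *v w" "(x + y) *v z = x *v z + y *v z"
    by (simp_all add: matrix_vector_mult_def vec_eq_iff sum.distrib distrib_left distrib_right)
  show "x *v (r *\<^sub>R z) = r *\<^sub>R (x *v z)" "(r *\<^sub>R x) *v z = r *\<^sub>R (x *v z)"
    by (simp_all add: matrix_vector_mult_def vec_eq_iff sum_distrib_left mult_ac)
qed

interpretation matvec: bounded_bilinear "(*v) :: real^'n^'m \<Rightarrow> real^'n \<Rightarrow> real^'m"
  by (rule bounded_bilinear_matrix_vector_mult)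

abbreviation mpow :: "real^'n^'n \<Rightarrow> nat \<Rightarrow> real^'n^'n" where
  "mpow A k \<equiv> (((**) A) ^^ k) (mat 1)"

lemma mpow_scaleR: "mpow (t *\<^sub>R A) k = t ^ k *\<^sub>R mpow A k"
  by (induction k) (simp_all add: matmul.scaleR_left matmul.scaleR_right mult.commute)

text \<open>The Euclidean norm of matrices is submultiplicative only up to a factor
  \<open>K\<close>, so the comparison series is the scalar exponential series at |t| |A| K.\<close>

lemma summable_mpow_norm:
  fixes A :: "real^'n^'n"
  shows "summable (\<lambda>k. norm (t ^ k *\<^sub>R mpow A k /\<^sub>R fact k))"
proof -
  obtain K where K: "K > 0" "\<And>B C. norm ((B::real^'n^'n) ** (C::real^'n^'n)) \<le> norm B * norm C * K"
    using matmul.pos_bounded by metis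
  have b: "norm (mpow A k) \<le> (norm A * K) ^ k * norm (mat 1 :: real^'n^'n)" for k
  proof (induction k)
    case (Suc k)
    have "norm (mpow A (Suc k)) \<le> norm A * norm (mpow A k) * K"
      using K(2)[of A "mpow A k"] by simp
    also have "\<dots> \<le> norm A * ((norm A * K) ^ k * norm (mat 1 :: real^'n^'n)) * K"
      using Suc K(1) by (intro mult_right_mono mult_left_mono) auto
    finally show ?case by (simp add: algebra_simps)
  qed simp
  have "summable (\<lambda>k. (inverse (fact k) * (\<bar>t\<bar> * (norm A * K)) ^ k) * norm (mat 1 :: real^'n^'n))"
    by (intro summable_mult2 summable_exp)
  then show ?thesis
  proof (rule summable_comparison_test'[where N=0])
    fix k :: nat
    have "\<bar>t\<bar> ^ k * norm (mpow A k) \<le> \<bar>t\<bar> ^ k * ((norm A * K) ^ k * norm (mat 1 :: real^'n^'n))"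
      by (intro mult_left_mono b) auto
    then show "norm (norm (t ^ k *\<^sub>R mpow A k /\<^sub>R fact k))
        \<le> (inverse (fact k) * (\<bar>t\<bar> * (norm A * K)) ^ k) * norm (mat 1 :: real^'n^'n)"
      by (simp add: power_abs power_mult_distrib divide_simps mult_ac)
  qed
qed

lemma sums_matrix_exp: "(\<lambda>k. t ^ k *\<^sub>R mpow A k /\<^sub>R fact k) sums matrix_exp (t *\<^sub>R A)"
  unfolding matrix_exp_def mpow_scaleR
  by (rule summable_sums[OF summable_norm_cancel[OF summable_mpow_norm]])

lemma matrix_exp_0 [simp]: "matrix_exp 0 = mat 1"
proof -
  have "(\<lambda>k. 0 ^ k *\<^sub>R mpow 0 k /\<^sub>R fact k) sums (\<Sum>k\<in>{0}. 0 ^ k *\<^sub>R mpow (0::real^'n^'n) k /\<^sub>R fact k)"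
    by (rule sums_finite) (auto simp: power_0_left)
  then show ?thesis
    using sums_matrix_exp[of 0 "0::real^'n^'n"] sums_unique2 by fastforce
qed

text \<open>Each coordinate is an everywhere convergent scalar power series in t and may be
  differentiated termwise; the differentiated coefficients are those of the original series
  multiplied by A from the left.\<close>

lemma matrix_exp_has_vector_derivative:
  "((\<lambda>t. matrix_exp (t *\<^sub>R A)) has_vector_derivative A ** matrix_exp (t *\<^sub>R A)) (at t within S)"
proof -
  let ?f = "\<lambda>t. matrix_exp (t *\<^sub>R A)"
  have "((\<lambda>t. ?f t \<bullet> b) has_real_derivative (A ** ?f t) \<bullet> b) (at t)" for b
  proof -
    define c where "c k = (mpow A k \<bullet> b) / fact k" for k
    have s: "(\<lambda>k. c k * s ^ k) sums (?f s \<bullet> b)" for s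
      using bounded_linear.sums[OF bounded_linear_inner_left[of b] sums_matrix_exp[of s A]]
      by (simp add: c_def field_simps)
    have "(\<lambda>k. diffs c k * t ^ k) = (\<lambda>k. (A ** (t ^ k *\<^sub>R mpow A k /\<^sub>R fact k)) \<bullet> b)"
      by (auto simp: c_def diffs_def matmul.scaleR_right field_simps fun_eq_iff simp del: of_nat_Suc)
    moreover have "\<dots> sums ((A ** ?f t) \<bullet> b)"
      by (intro bounded_linear.sums[OF bounded_linear_inner_left] sums_matrix_exp
         bounded_linear.sums[OF matmul.bounded_linear_right])
    ultimately have d: "(\<Sum>k. diffs c k * t ^ k) = (A ** ?f t) \<bullet> b"
      by (simp add: sums_iff)
    have "((\<lambda>x. \<Sum>k. c k * x ^ k) has_field_derivative (\<Sum>k. diffs c k * t ^ k)) (at t)"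
      by (rule termdiffs_strong_converges_everywhere) (use s in \<open>auto simp: sums_iff\<close>)
    then show ?thesis
      using s d by (simp add: sums_iff)
  qed
  then have "((\<lambda>t. ?f t \<bullet> b) has_derivative (\<lambda>x. (x *\<^sub>R (A ** ?f t)) \<bullet> b)) (at t within S)" for b
    unfolding has_field_derivative_def inner_scaleR_left
    by (subst mult.commute) (rule has_derivative_at_withinI)
  then show ?thesis
    unfolding has_vector_derivative_def has_derivative_componentwise_within[of ?f] by blast
qed

lemma matrix_exp_commute: "A ** matrix_exp (t *\<^sub>R A) = matrix_exp (t *\<^sub>R A) ** A"
proof -
  have "A ** mpow A k = mpow A k ** A" for k
  proof (induction k)
    case (Suc k)
    then show ?case by (simp add: matrix_mul_assoc)
  qed simp
  then have "A ** (t ^ k *\<^sub>R mpow A k /\<^sub>R fact k) = (t ^ k *\<^sub>R mpow A k /\<^sub>R fact k) ** A" for k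
    by (simp add: matmul.scaleR_left matmul.scaleR_right)
  then show ?thesis
    using bounded_linear.sums[OF matmul.bounded_linear_right sums_matrix_exp[of t A], of A]
      bounded_linear.sums[OF matmul.bounded_linear_left sums_matrix_exp[of t A], of A]
    by (simp add: sums_iff)
qed

text \<open>The curve r \<mapsto> exp((s+t-r)A) exp(rA) has derivative zero because A commutes with
  its exponentials; its values at r = 0 and r = t are the two sides.\<close>

lemma matrix_exp_add: "matrix_exp ((s + t) *\<^sub>R A) = matrix_exp (s *\<^sub>R A) ** matrix_exp (t *\<^sub>R A)"
proof -
  let ?g = "\<lambda>r. matrix_exp ((s + t - r) *\<^sub>R A) ** matrix_exp (r *\<^sub>R A)"
  have d: "((\<lambda>r. matrix_exp ((s + t - r) *\<^sub>R A)) has_vector_derivative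
      - (A ** matrix_exp ((s + t - r) *\<^sub>R A))) (at r within UNIV)" for r
  proof -
    have "((\<lambda>r. s + t - r) has_vector_derivative -1) (at r within UNIV)"
      by (auto intro!: derivative_eq_intros)
    from vector_diff_chain_within[OF this matrix_exp_has_vector_derivative[of A "s + t - r"]]
    show ?thesis by (simp add: o_def)
  qed
  have "(?g has_vector_derivative 0) (at r within UNIV)" for r
  proof -
    have "matrix_exp ((s + t - r) *\<^sub>R A) ** (A ** matrix_exp (r *\<^sub>R A)) +
        - (A ** matrix_exp ((s + t - r) *\<^sub>R A)) ** matrix_exp (r *\<^sub>R A) = 0"
      using matrix_exp_commute[of A "s + t - r"] by (simp add: matmul.minus_left matrix_mul_assoc)
    then show ?thesis
      using matmul.has_vector_derivative[OF d[of r] matrix_exp_has_vector_derivative[of A r UNIV]] by simp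
  qed
  then have "?g 0 = ?g t"
    by (metis (no_types, lifting) UNIV_I convex_UNIV has_vector_derivative_zero_constant)
  then show ?thesis by simp
qed

lemma matrix_exp_minus: "matrix_exp (- (t *\<^sub>R A)) ** matrix_exp (t *\<^sub>R A) = mat 1"
  "matrix_exp (t *\<^sub>R A) ** matrix_exp (- (t *\<^sub>R A)) = mat 1"
proof -
  have "matrix_exp ((- t + t) *\<^sub>R A) = mat 1" "matrix_exp ((t + - t) *\<^sub>R A) = mat 1"
    by simp_all
  then show "matrix_exp (- (t *\<^sub>R A)) ** matrix_exp (t *\<^sub>R A) = mat 1"
    "matrix_exp (t *\<^sub>R A) ** matrix_exp (- (t *\<^sub>R A)) = mat 1"
    unfolding matrix_exp_add by simp_all
qed

lemma matrix_inv_eqI: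
  fixes A B :: "real^'n^'n"
  assumes "A ** B = mat 1"
  shows "matrix_inv A = B"
proof -
  have "B ** A = mat 1" using assms matrix_left_right_inverse by blast
  with assms have "\<exists>C. A ** C = mat 1 \<and> C ** A = mat 1" by blast
  then have "A ** matrix_inv A = mat 1"
    unfolding matrix_inv_def by (rule someI2_ex) simp
  then have "(B ** A) ** matrix_inv A = B"
    by (simp add: matrix_mul_assoc[symmetric])
  then show ?thesis
    by (simp add: \<open>B ** A = mat 1\<close>)
qed

lemma matrix_inv_matrix_exp: "matrix_inv (matrix_exp (t *\<^sub>R A)) = matrix_exp ((- t) *\<^sub>R A)"
  by (rule matrix_inv_eqI) (simp add: matrix_exp_minus)

lemma continuous_on_matrix_exp [continuous_intros]:
  assumes "continuous_on S f" shows "continuous_on S (\<lambda>x. matrix_exp (f x *\<^sub>R A))"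
proof -
  have "continuous_on UNIV (\<lambda>t. matrix_exp (t *\<^sub>R A))"
    by (intro continuous_at_imp_continuous_on ballI has_vector_derivative_continuous
        [OF matrix_exp_has_vector_derivative])
  then show ?thesis
    using continuous_on_compose2[OF _ assms] by blast
qed

text \<open>Conjugation passes through every term of the series. This makes the Lie algebra stable
  under conjugation by the group, which is what moves a field from one side of \<open>U x\<close> to
  the other.\<close>

lemma conj_matrix_exp:
  fixes g :: "real^'n^'n"
  assumes "g ** h = mat 1"
  shows "matrix_exp (t *\<^sub>R (g ** A ** h)) = g ** matrix_exp (t *\<^sub>R A) ** h"
proof -
  have hg: "h ** g = mat 1" using assms matrix_left_right_inverse by blast
  have "mpow (g ** A ** h) k = g ** mpow A k ** h" for k
  proof (induction k)
    case (Suc k)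
    have "g ** A ** h ** (g ** mpow A k ** h) = g ** A ** (h ** g) ** mpow A k ** h"
      by (simp add: matrix_mul_assoc)
    with Suc show ?case by (simp add: hg matrix_mul_assoc)
  qed (simp add: assms)
  then have "(\<lambda>k. t ^ k *\<^sub>R mpow (g ** A ** h) k /\<^sub>R fact k) =
    (\<lambda>k. g ** (t ^ k *\<^sub>R mpow A k /\<^sub>R fact k) ** h)"
    by (simp add: matmul.scaleR_left matmul.scaleR_right)
  moreover have "\<dots> sums (g ** matrix_exp (t *\<^sub>R A) ** h)"
    by (intro bounded_linear.sums[OF matmul.bounded_linear_left]
        bounded_linear.sums[OF matmul.bounded_linear_right] sums_matrix_exp)
  ultimately show ?thesis
    using sums_matrix_exp[of t "g ** A ** h"] by (auto intro: sums_unique2)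
qed

section \<open>Continuously differentiable functions\<close>

text \<open>Continuity of the derivative is asked only for each fixed direction, which avoids a
  topology on linear maps. As the domain is Euclidean, joint continuity follows by expanding the
  direction in the basis (\<open>C1_deriv_continuous_joint\<close>).\<close>

definition C1_deriv ::
  "('a::euclidean_space \<Rightarrow> 'b::real_normed_vector) \<Rightarrow> ('a \<Rightarrow> 'a \<Rightarrow> 'b) \<Rightarrow> bool" where
  "C1_deriv f f' \<longleftrightarrow>
     (\<forall>x. (f has_derivative f' x) (at x)) \<and> (\<forall>v. continuous_on UNIV (\<lambda>x. f' x v))"

definition C1 :: "('a::euclidean_space \<Rightarrow> 'b::real_normed_vector) \<Rightarrow> bool" where
  "C1 f \<longleftrightarrow> (\<exists>f'. C1_deriv f f')"

lemma C1_derivD: "C1_deriv f f' \<Longrightarrow> (f has_derivative f' x) (at x within S)"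
  unfolding C1_deriv_def by (simp add: has_derivative_at_withinI)

lemma C1_derivD2: "C1_deriv f f' \<Longrightarrow> continuous_on S (\<lambda>x. f' x v)"
  unfolding C1_deriv_def by (meson continuous_on_subset subset_UNIV)

lemma C1_deriv_linear: "C1_deriv f f' \<Longrightarrow> linear (f' x)"
  by (rule has_derivative_linear[OF C1_derivD])

lemma C1_deriv_continuous: "C1_deriv f f' \<Longrightarrow> continuous_on S f"
  by (rule has_derivative_continuous_on[OF C1_derivD])

lemma C1_continuous: "C1 f \<Longrightarrow> continuous_on S f"
  unfolding C1_def by (elim exE) (rule C1_deriv_continuous)

lemma C1_deriv_basis_sum:
  assumes "C1_deriv f f'"
  shows "f' x v = (\<Sum>b\<in>Basis. (v \<bullet> b) *\<^sub>R f' x b)"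
proof -
  interpret linear "f' x" using C1_deriv_linear[OF assms] .
  have "f' x (\<Sum>b\<in>Basis. (v \<bullet> b) *\<^sub>R b) = (\<Sum>b\<in>Basis. (v \<bullet> b) *\<^sub>R f' x b)"
    by (simp add: sum scale)
  then show ?thesis by (simp add: euclidean_representation)
qed

lemma C1_deriv_continuous_joint:
  assumes "C1_deriv f f'" "continuous_on S a" "continuous_on S b"
  shows "continuous_on S (\<lambda>s. f' (a s) (b s))"
proof -
  have "continuous_on S (\<lambda>s. f' (a s) v)" for v
    by (rule continuous_on_compose2[of UNIV "\<lambda>x. f' x v" S a])
      (simp_all add: assms(2) C1_derivD2[OF assms(1)])
  then have "continuous_on S (\<lambda>s. \<Sum>e\<in>Basis. (b s \<bullet> e) *\<^sub>R f' (a s) e)"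
    by (intro continuous_on_sum continuous_on_scaleR continuous_on_inner continuous_on_const assms(3))
  also have "(\<lambda>s. \<Sum>e\<in>Basis. (b s \<bullet> e) *\<^sub>R f' (a s) e) = (\<lambda>s. f' (a s) (b s))"
    by (rule ext) (rule C1_deriv_basis_sum[OF assms(1), symmetric])
  finally show ?thesis .
qed

lemma C1_derivI:
  assumes "\<And>x. (f has_derivative f' x) (at x)" "\<And>v. continuous_on UNIV (\<lambda>x. f' x v)"
  shows "C1_deriv f f'"
  using assms unfolding C1_deriv_def by blast

lemma C1_deriv_const: "C1_deriv (\<lambda>x. c) (\<lambda>x v. 0)"
  by (intro C1_derivI) auto

lemma C1_deriv_bounded_linear: "bounded_linear f \<Longrightarrow> C1_deriv f (\<lambda>x v. f v)"
  by (rule C1_derivI) (simp_all add: bounded_linear_imp_has_derivative)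

lemma C1_deriv_add:
  "C1_deriv f f' \<Longrightarrow> C1_deriv g g' \<Longrightarrow> C1_deriv (\<lambda>x. f x + g x) (\<lambda>x v. f' x v + g' x v)"
  by (rule C1_derivI) (rule has_derivative_add continuous_on_add, erule C1_derivD C1_derivD2,
      erule C1_derivD C1_derivD2)+

lemma C1_deriv_compose:
  assumes "C1_deriv g g'" "C1_deriv f f'"
  shows "C1_deriv (\<lambda>x. g (f x)) (\<lambda>x v. g' (f x) (f' x v))"
proof (rule C1_derivI)
  show "((\<lambda>x. g (f x)) has_derivative (\<lambda>v. g' (f x) (f' x v))) (at x)" for x
    by (rule has_derivative_compose[OF C1_derivD[OF assms(2)] C1_derivD[OF assms(1)]])
  show "continuous_on UNIV (\<lambda>x. g' (f x) (f' x v))" for v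
    by (intro C1_deriv_continuous_joint[OF assms(1)] C1_deriv_continuous[OF assms(2)]
        C1_derivD2[OF assms(2)])
qed

lemma C1_deriv_bilinear:
  assumes "bounded_bilinear B" "C1_deriv f f'" "C1_deriv g g'"
  shows "C1_deriv (\<lambda>x. B (f x) (g x)) (\<lambda>x v. B (f x) (g' x v) + B (f' x v) (g x))"
proof (rule C1_derivI)
  interpret bounded_bilinear B by fact
  show "((\<lambda>x. B (f x) (g x)) has_derivative (\<lambda>v. B (f x) (g' x v) + B (f' x v) (g x))) (at x)" for x
    by (rule FDERIV[OF C1_derivD[OF assms(2)] C1_derivD[OF assms(3)]])
  show "continuous_on UNIV (\<lambda>x. B (f x) (g' x v) + B (f' x v) (g x))" for v
    by (rule continuous_on_add[OF continuous_on continuous_on])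
      (rule C1_derivD2[OF assms(2)] C1_derivD2[OF assms(3)]
         C1_deriv_continuous[OF assms(2)] C1_deriv_continuous[OF assms(3)])+
qed

lemma C1_const: "C1 (\<lambda>x. c)"
  unfolding C1_def by (rule exI) (rule C1_deriv_const)

lemma C1_bounded_linear: "bounded_linear f \<Longrightarrow> C1 f"
  unfolding C1_def by (rule exI) (rule C1_deriv_bounded_linear)

lemma C1_add: "C1 f \<Longrightarrow> C1 g \<Longrightarrow> C1 (\<lambda>x. f x + g x)"
  unfolding C1_def by (elim exE) (rule exI, rule C1_deriv_add)

lemma C1_compose: "C1 g \<Longrightarrow> C1 f \<Longrightarrow> C1 (\<lambda>x. g (f x))"
  unfolding C1_def by (elim exE) (rule exI, rule C1_deriv_compose)

lemma C1_bilinear: "bounded_bilinear B \<Longrightarrow> C1 f \<Longrightarrow> C1 g \<Longrightarrow> C1 (\<lambda>x. B (f x) (g x))"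
  unfolding C1_def by (elim exE) (rule exI, rule C1_deriv_bilinear)

lemma C1_diff:
  assumes "C1 f" "C1 g" shows "C1 (\<lambda>x. f x - g x)"
proof -
  have "C1 (\<lambda>x. f x + (- 1) *\<^sub>R g x)"
    by (intro C1_add assms(1) C1_bilinear[OF bounded_bilinear_scaleR C1_const assms(2)])
  then show ?thesis by simp
qed

lemma C1_mult: "C1 f \<Longrightarrow> C1 g \<Longrightarrow> C1 (\<lambda>x. f x * g x :: real)"
  by (rule C1_bilinear[OF bounded_bilinear_mult])

lemma C1_matrix_mult: "C1 f \<Longrightarrow> C1 g \<Longrightarrow> C1 (\<lambda>x. f x ** g x :: real^'n^'n)"
  by (rule C1_bilinear[OF bounded_bilinear_matrix_mult])

lemma C1_sum: "(\<And>i. i \<in> I \<Longrightarrow> C1 (f i)) \<Longrightarrow> C1 (\<lambda>x. \<Sum>i\<in>I. f i x)"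
  by (induction I rule: infinite_finite_induct) (simp_all add: C1_const C1_add)

lemma C1_prod: "(\<And>i. i \<in> I \<Longrightarrow> C1 (f i)) \<Longrightarrow> C1 (\<lambda>x. \<Prod>i\<in>I. f i x :: real)"
  by (induction I rule: infinite_finite_induct) (simp_all add: C1_const C1_mult)

lemma C1_det:
  assumes "\<And>i j. C1 (\<lambda>x. M x $ i $ j)"
  shows "C1 (\<lambda>x. det (M x :: real^'n^'n))"
  unfolding det_def by (intro C1_sum C1_mult C1_prod C1_const assms)

lemma C1_linear_compose: "linear (h :: 'b::euclidean_space \<Rightarrow> 'c::real_normed_vector) \<Longrightarrow> C1 f \<Longrightarrow> C1 (\<lambda>x. h (f x))"
  by (rule C1_compose[OF C1_bounded_linear]) (simp_all add: linear_conv_bounded_linear)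

lemma C1_vec_lambda:
  assumes "\<And>k. C1 (\<lambda>x. f x k :: real)"
  shows "C1 (\<lambda>x. \<chi> k. f x k)"
proof -
  have "(\<lambda>x. \<chi> k. f x k) = (\<lambda>x. \<Sum>k\<in>UNIV. f x k *\<^sub>R axis k 1)"
    by (simp add: fun_eq_iff vec_eq_iff axis_def if_distrib cong: if_cong)
  then show ?thesis
    by (simp only:) (intro C1_sum C1_bilinear[OF bounded_bilinear_scaleR] assms C1_const)
qed

section \<open>Integration by parts\<close>

text \<open>Kernels are supported in the unit ball. The side length leaves room for translates of
  that ball by vectors of norm at most 1, and a box rather than a ball is the shape for which
  Leibniz' rule and shifts of integrals are stated.\<close>

definition big_box :: "'a::euclidean_space set" where
  "big_box = cbox (- 2 *\<^sub>R One) (2 *\<^sub>R One)"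

lemma big_box_superset: "cball 0 2 \<subseteq> (big_box :: 'a::euclidean_space set)"
proof
  fix x :: 'a assume "x \<in> cball 0 2"
  then have "\<bar>x \<bullet> b\<bar> \<le> 2" if "b \<in> Basis" for b
    using Basis_le_norm[OF that, of x] by simp
  then show "x \<in> big_box"
    unfolding big_box_def mem_box by (fastforce simp: abs_le_iff)
qed

lemma continuous_integrable_big_box:
  fixes f :: "'a::euclidean_space \<Rightarrow> 'b::banach"
  shows "continuous_on UNIV f \<Longrightarrow> f integrable_on big_box"
  unfolding big_box_def by (rule integrable_continuous) (rule continuous_on_subset, auto)

text \<open>Translation invariance: the integral of H(y + tv) is constant for small t, because the
  translated support stays in the box. Its derivative at t = 0, taken under the integral sign, is
  the integral in question.\<close>

lemma integral_derivative_zero: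
  fixes H :: "'a::euclidean_space \<Rightarrow> 'b::banach"
  assumes H: "C1_deriv H H'" and supp: "\<And>x. norm x > 1 \<Longrightarrow> H x = 0"
  shows "integral big_box (\<lambda>x. H' x v) = 0"
proof -
  define J where "J t = integral big_box (\<lambda>y. H (y + t *\<^sub>R v))" for t
  have cont: "continuous_on UNIV H" using H by (rule C1_deriv_continuous)
  have J': "(J has_vector_derivative integral big_box (\<lambda>y. H' (y + 0 *\<^sub>R v) v)) (at 0)"
    unfolding J_def big_box_def
  proof (rule leibniz_rule_vector_derivative[where U = UNIV])
    fix t y
    have "((\<lambda>t. y + t *\<^sub>R v) has_derivative (\<lambda>s. s *\<^sub>R v)) (at t)"
      by (auto intro!: derivative_eq_intros)
    from has_derivative_compose[OF this C1_derivD[OF H]]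
    show "((\<lambda>t. H (y + t *\<^sub>R v)) has_vector_derivative H' (y + t *\<^sub>R v) v) (at t within UNIV)"
      unfolding has_vector_derivative_def
      by (simp add: linear_scale[OF C1_deriv_linear[OF H]])
  next
    show "(\<lambda>y. H (y + t *\<^sub>R v)) integrable_on cbox (- 2 *\<^sub>R One) (2 *\<^sub>R One)" for t
      by (intro integrable_continuous continuous_on_compose2[OF cont] continuous_intros) auto
    show "continuous_on (UNIV \<times> cbox (- 2 *\<^sub>R One) (2 *\<^sub>R One)) (\<lambda>(t, y). H' (y + t *\<^sub>R v) v)"
      unfolding case_prod_unfold by (intro C1_deriv_continuous_joint[OF H] continuous_intros)
  qed auto
  have J0: "J t = J 0" if t: "norm (t *\<^sub>R v) \<le> 1" for t
  proof -
    have sub: "x \<in> cbox (- 2 *\<^sub>R One + c) (2 *\<^sub>R One + c)" if "norm x \<le> 1" "norm c \<le> 1" for x c :: 'a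
    proof -
      have "x - c \<in> big_box"
        using big_box_superset norm_triangle_ineq4[of x c] that by fastforce
      then show ?thesis
        unfolding big_box_def mem_box by (simp add: algebra_simps)
    qed
    have restr: "(H has_integral I) (cbox (- 2 *\<^sub>R One + c) (2 *\<^sub>R One + c)) \<longleftrightarrow>
        (H has_integral I) UNIV" if c: "norm c \<le> 1" for c I
    proof -
      have "(\<lambda>x. if x \<in> cbox (- 2 *\<^sub>R One + c) (2 *\<^sub>R One + c) then H x else 0) = H"
      proof
        fix x
        show "(if x \<in> cbox (- 2 *\<^sub>R One + c) (2 *\<^sub>R One + c) then H x else 0) = H x"
        proof (cases "norm x \<le> 1")
          case True
          show ?thesis by (rule if_P[OF sub[OF True c]])
        next
          case False
          then show ?thesis by (simp only: supp not_le if_cancel)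
        qed
      qed
      then show ?thesis
        using has_integral_restrict_UNIV[of "cbox (- 2 *\<^sub>R One + c) (2 *\<^sub>R One + c)" H I] by simp
    qed
    have "(H has_integral J 0) (cbox (- 2 *\<^sub>R One + 0) (2 *\<^sub>R One + 0))"
      using integrable_integral[OF continuous_integrable_big_box[OF cont]]
      by (simp add: J_def big_box_def)
    then have "(H has_integral J 0) (cbox (- 2 *\<^sub>R One + t *\<^sub>R v) (2 *\<^sub>R One + t *\<^sub>R v))"
      using restr[of 0] restr[OF t] by simp
    then have "(H \<circ> (+) (t *\<^sub>R v) has_integral J 0) (cbox (- 2 *\<^sub>R One) (2 *\<^sub>R One))"
      by (simp only: has_integral_shift_cbox_iff)
    then show ?thesis
      by (simp add: J_def big_box_def o_def add.commute integral_unique)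
  qed
  have "(J has_vector_derivative 0) (at 0)"
  proof (rule has_vector_derivative_transform_within_open)
    show "((\<lambda>_. J 0) has_vector_derivative 0) (at 0)" by (rule has_vector_derivative_const)
    show "open {t. norm (t *\<^sub>R v) < 1}" by (intro open_Collect_less continuous_intros)
    show "0 \<in> {t. norm (t *\<^sub>R v) < 1}" by simp
    show "J 0 = J t" if "t \<in> {t. norm (t *\<^sub>R v) < 1}" for t
      by (rule J0[symmetric]) (use that in simp)
  qed
  from vector_derivative_unique_at[OF J' this] show ?thesis by simp
qed

definition divergence :: "('a::euclidean_space \<Rightarrow> 'a \<Rightarrow> 'a) \<Rightarrow> 'a \<Rightarrow> real" where
  "divergence w' x = (\<Sum>b\<in>Basis. w' x b \<bullet> b)"

lemma continuous_on_divergence: "C1_deriv w w' \<Longrightarrow> continuous_on S (divergence w')"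
  unfolding divergence_def
  by (intro continuous_on_sum continuous_on_inner continuous_on_const) (rule C1_derivD2)

text \<open>Apply \<open>integral_derivative_zero\<close> to (w \<bullet> b) G in the direction b
  and sum over the basis. Only w has compact support, so G may be any continuously differentiable
  function.\<close>

lemma divergence_integral_zero:
  fixes G :: "'a::euclidean_space \<Rightarrow> 'b::banach"
  assumes w: "C1_deriv w w'" and supp: "\<And>x. norm x > 1 \<Longrightarrow> w x = 0" and G: "C1_deriv G G'"
  shows "integral big_box (\<lambda>x. G' x (w x)) = - integral big_box (\<lambda>x. divergence w' x *\<^sub>R G x)"
proof -
  define H where "H b x = (w x \<bullet> b) *\<^sub>R G x" for b x
  define H' where "H' b x v = (w x \<bullet> b) *\<^sub>R G' x v + (w' x v \<bullet> b) *\<^sub>R G x" for b x v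
  have H: "C1_deriv (H b) (H' b)" for b
  proof -
    have "C1_deriv (\<lambda>x. w x \<bullet> b) (\<lambda>x v. w' x v \<bullet> b)"
      using C1_deriv_compose[OF C1_deriv_bounded_linear[OF bounded_linear_inner_left] w] .
    from C1_deriv_bilinear[OF bounded_bilinear_scaleR this G]
    show ?thesis unfolding H_def H'_def .
  qed
  have "integral big_box (\<lambda>x. \<Sum>b\<in>Basis. H' b x b) = (\<Sum>b\<in>Basis. integral big_box (\<lambda>x. H' b x b))"
    by (intro integral_sum continuous_integrable_big_box C1_derivD2[OF H]) simp
  also have "\<dots> = 0"
    by (intro sum.neutral ballI integral_derivative_zero[OF H]) (simp add: H_def supp)
  also have "(\<lambda>x. \<Sum>b\<in>Basis. H' b x b) = (\<lambda>x. G' x (w x) + divergence w' x *\<^sub>R G x)"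
  proof
    fix x
    show "(\<Sum>b\<in>Basis. H' b x b) = G' x (w x) + divergence w' x *\<^sub>R G x"
      unfolding C1_deriv_basis_sum[OF G, of x "w x"]
      by (simp add: H'_def divergence_def sum.distrib scaleR_sum_left)
  qed
  finally have "integral big_box (\<lambda>x. G' x (w x) + divergence w' x *\<^sub>R G x) = 0" .
  moreover have "(\<lambda>x. G' x (w x)) integrable_on big_box"
    by (intro continuous_integrable_big_box C1_deriv_continuous_joint[OF G] continuous_on_id
        C1_deriv_continuous[OF w])
  moreover have "(\<lambda>x. divergence w' x *\<^sub>R G x) integrable_on big_box"
    by (intro continuous_integrable_big_box continuous_on_scaleR continuous_on_divergence[OF w]
        C1_deriv_continuous[OF G])
  ultimately show ?thesis
    by (simp add: integral_add eq_neg_iff_add_eq_0)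
qed

lemma norm_integral_big_box_le:
  fixes f :: "'a::euclidean_space \<Rightarrow> 'b::euclidean_space"
  assumes "continuous_on UNIV f" "\<And>x. norm (f x) \<le> B"
  shows "norm (integral big_box f) \<le> B * measure lborel (big_box :: 'a set)"
proof -
  have "B \<ge> 0" using assms(2) norm_ge_zero order_trans by blast
  moreover have "(f has_integral integral big_box f) big_box"
    using assms(1) continuous_integrable_big_box by blast
  ultimately show ?thesis
    unfolding big_box_def by (rule has_integral_bound) (rule assms(2))
qed

section \<open>A bump function\<close>

text \<open>The square makes the truncated paraboloid continuously differentiable across the unit
  sphere. A single derivative is all that partial integration asks for, so no infinitely
  differentiable bump is built.\<close>

definition bump :: "'a::euclidean_space \<Rightarrow> real" where
  "bump x = (max 0 (1 - x \<bullet> x))\<^sup>2"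

definition bump' :: "'a::euclidean_space \<Rightarrow> 'a \<Rightarrow> real" where
  "bump' x v = - 4 * max 0 (1 - x \<bullet> x) * (x \<bullet> v)"

lemma DERIV_max_square: "((\<lambda>t::real. (max 0 t)\<^sup>2) has_real_derivative 2 * max 0 t) (at t)"
proof (cases t "0::real" rule: linorder_cases)
  case less
  have "((\<lambda>t::real. 0) has_real_derivative 2 * max 0 t) (at t)"
    using less by (auto intro!: derivative_eq_intros)
  then show ?thesis
    by (rule has_field_derivative_transform_within_open[where S="{..<0}"]) (use less in auto)
next
  case equal
  have "((\<lambda>h::real. (max 0 h)\<^sup>2 / h) \<longlongrightarrow> 0) (at 0)"
  proof (rule Lim_null_comparison[where g="\<lambda>h. \<bar>h\<bar>"])
    have "norm ((max 0 h)\<^sup>2 / h) \<le> \<bar>h\<bar>" for h :: real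
      by (cases "h > 0") (auto simp: max_def power2_eq_square)
    then show "\<forall>\<^sub>F h in at 0. norm ((max 0 h)\<^sup>2 / h :: real) \<le> \<bar>h\<bar>" by simp
    show "((\<lambda>h::real. \<bar>h\<bar>) \<longlongrightarrow> 0) (at 0)" by (auto intro!: tendsto_eq_intros)
  qed
  then show ?thesis
    using equal by (simp add: has_field_derivative_iff)
next
  case greater
  have "((\<lambda>t::real. t\<^sup>2) has_real_derivative 2 * max 0 t) (at t)"
    using greater by (auto intro!: derivative_eq_intros)
  then show ?thesis
    by (rule has_field_derivative_transform_within_open[where S="{0<..}"]) (use greater in auto)
qed

lemma C1_deriv_bump: "C1_deriv bump bump'"
proof (rule C1_derivI)
  fix x :: 'a
  have "((\<lambda>x. 1 - x \<bullet> x) has_derivative (\<lambda>v. - 2 * (x \<bullet> v))) (at x)"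
    by (auto intro!: derivative_eq_intros simp: inner_commute)
  from has_derivative_compose[OF this DERIV_max_square[unfolded has_field_derivative_def]]
  show "(bump has_derivative bump' x) (at x)"
    unfolding bump_def[abs_def] bump'_def[abs_def] by (simp add: algebra_simps)
  show "continuous_on UNIV (\<lambda>x. bump' x v)" for v :: 'a
    unfolding bump'_def by (intro continuous_intros)
qed

lemma bump_nonneg: "bump x \<ge> 0" and bump_le_1: "bump x \<le> 1"
proof -
  show "bump x \<ge> 0" by (simp add: bump_def)
  have "(max 0 (1 - x \<bullet> x))\<^sup>2 \<le> 1\<^sup>2"
    by (rule power_mono) auto
  then show "bump x \<le> 1" by (simp add: bump_def)
qed

lemma bump_eq_0: "norm x > 1 \<Longrightarrow> bump x = 0"
proof -
  assume "norm x > 1"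
  then have "x \<bullet> x > 1" by (simp add: dot_square_norm)
  then show ?thesis by (simp add: bump_def)
qed

lemma bump'_bound: "\<bar>bump' x v\<bar> \<le> 4 * norm v"
proof (cases "x \<bullet> x < 1")
  case True
  then have "norm x \<le> 1"
    by (metis abs_norm_cancel abs_square_le_1 dot_square_norm less_imp_le)
  then have "\<bar>x \<bullet> v\<bar> \<le> norm v"
    using Cauchy_Schwarz_ineq2[of x v] mult_right_mono[of "norm x" 1 "norm v"] by simp
  moreover have "\<bar>max 0 (1 - x \<bullet> x)\<bar> \<le> 1" by auto
  ultimately have "\<bar>max 0 (1 - x \<bullet> x)\<bar> * \<bar>x \<bullet> v\<bar> \<le> 1 * norm v"
    by (intro mult_mono) auto
  then show ?thesis by (simp add: bump'_def abs_mult)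
qed (simp add: bump'_def)

lemma integral_bump_pos: "integral big_box bump > 0"
proof -
  have cont: "continuous_on S (bump :: 'a \<Rightarrow> real)" for S
    using C1_deriv_continuous[OF C1_deriv_bump] .
  have "integral big_box (bump :: 'a \<Rightarrow> real) \<noteq> 0"
  proof
    assume "integral big_box (bump :: 'a \<Rightarrow> real) = 0"
    then have "((bump :: 'a \<Rightarrow> real) has_integral 0) (cbox (- 2 *\<^sub>R One) (2 *\<^sub>R One))"
      using integrable_integral[OF continuous_integrable_big_box[OF cont]] by (metis big_box_def)
    then have "bump (0::'a) = 0"
    proof (rule has_integral_0_cbox_imp_0[OF cont bump_nonneg])
      show "(0::'a) \<in> cbox (- 2 *\<^sub>R One) (2 *\<^sub>R One)"
        using big_box_superset[where 'a='a] by (auto simp: big_box_def)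
      show "box (- 2 *\<^sub>R One) (2 *\<^sub>R One::'a) \<noteq> {}" by (simp add: box_ne_empty)
    qed
    then show False by (simp add: bump_def)
  qed
  moreover have "integral big_box (bump :: 'a \<Rightarrow> real) \<ge> 0"
    by (intro integral_nonneg continuous_integrable_big_box cont) (auto simp: bump_nonneg)
  ultimately show ?thesis by simp
qed

section \<open>Product coordinates on the group\<close>

primrec exp_prod :: "('m \<Rightarrow> real^'n^'n) \<Rightarrow> 'm list \<Rightarrow> real^'m \<Rightarrow> real^'n^'n" where
  "exp_prod a [] x = mat 1"
| "exp_prod a (j # js) x = matrix_exp (x $ j *\<^sub>R a j) ** exp_prod a js x"

primrec exp_prod_inv :: "('m \<Rightarrow> real^'n^'n) \<Rightarrow> 'm list \<Rightarrow> real^'m \<Rightarrow> real^'n^'n" where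
  "exp_prod_inv a [] x = mat 1"
| "exp_prod_inv a (j # js) x = exp_prod_inv a js x ** matrix_exp ((- x $ j) *\<^sub>R a j)"

text \<open>The left logarithmic derivative U(x)^(-1) dU(x) h of the product of exponentials. In
  this recursive form it is visibly a combination of conjugates of the \<open>a j\<close>; the
  factor exp(x_j a_j) cancels since it commutes with \<open>a j\<close>.\<close>

primrec exp_prod_logd ::
  "('m \<Rightarrow> real^'n^'n) \<Rightarrow> 'm list \<Rightarrow> real^'m \<Rightarrow> real^'m \<Rightarrow> real^'n^'n" where
  "exp_prod_logd a [] x h = 0"
| "exp_prod_logd a (j # js) x h =
     exp_prod_logd a js x h + h $ j *\<^sub>R (exp_prod_inv a js x ** a j ** exp_prod a js x)"

lemma exp_prod_inverse: "exp_prod a js x ** exp_prod_inv a js x = mat 1"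
proof (induction js)
  case (Cons j js)
  have "exp_prod a (j # js) x ** exp_prod_inv a (j # js) x =
      matrix_exp (x $ j *\<^sub>R a j) ** (exp_prod a js x ** exp_prod_inv a js x)
        ** matrix_exp (- (x $ j *\<^sub>R a j))"
    by (simp add: matrix_mul_assoc)
  then show ?case by (simp add: Cons matrix_exp_minus)
qed simp

lemma exp_prod_inverse': "exp_prod_inv a js x ** exp_prod a js x = mat 1"
  using exp_prod_inverse matrix_left_right_inverse by blast

lemma C1_deriv_matrix_exp:
  "C1_deriv (\<lambda>x::real^'m. matrix_exp (x $ j *\<^sub>R A)) (\<lambda>x h. h $ j *\<^sub>R (A ** matrix_exp (x $ j *\<^sub>R A)))"
proof (rule C1_derivI)
  fix x :: "real^'m"
  have "((\<lambda>x. x $ j) has_derivative (\<lambda>h. h $ j)) (at x)"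
    by (rule bounded_linear_imp_has_derivative) (rule bounded_linear_vec_nth)
  from has_derivative_compose[OF this
      matrix_exp_has_vector_derivative[unfolded has_vector_derivative_def]]
  show "((\<lambda>x. matrix_exp (x $ j *\<^sub>R A)) has_derivative
      (\<lambda>h. h $ j *\<^sub>R (A ** matrix_exp (x $ j *\<^sub>R A)))) (at x)" .
next
  show "continuous_on UNIV (\<lambda>x::real^'m. v $ j *\<^sub>R (A ** matrix_exp (x $ j *\<^sub>R A)))" for v :: "real^'m"
    by (intro continuous_on_scaleR continuous_on_const matmul.continuous_on
        continuous_on_matrix_exp continuous_on_component continuous_on_id)
qed

lemma C1_matrix_exp: "C1 (\<lambda>x::real^'m. matrix_exp (x $ j *\<^sub>R A))"
  unfolding C1_def by (rule exI) (rule C1_deriv_matrix_exp)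

lemma C1_deriv_exp_prod:
  "C1_deriv (exp_prod a js) (\<lambda>x h. exp_prod a js x ** exp_prod_logd a js x h)"
proof (induction js)
  case Nil
  show ?case using C1_deriv_const[of "mat 1"] by simp
next
  case (Cons j js)
  have eq: "matrix_exp (x $ j *\<^sub>R a j) ** (exp_prod a js x ** exp_prod_logd a js x h) +
      (h $ j *\<^sub>R (a j ** matrix_exp (x $ j *\<^sub>R a j))) ** exp_prod a js x =
      exp_prod a (j # js) x ** exp_prod_logd a (j # js) x h" for x h
  proof -
    have "exp_prod a (j # js) x ** (exp_prod_inv a js x ** a j ** exp_prod a js x) =
        matrix_exp (x $ j *\<^sub>R a j) ** (exp_prod a js x ** exp_prod_inv a js x) ** a j ** exp_prod a js x"
      by (simp add: matrix_mul_assoc)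
    also have "\<dots> = a j ** matrix_exp (x $ j *\<^sub>R a j) ** exp_prod a js x"
      by (simp add: exp_prod_inverse matrix_exp_commute)
    finally have "exp_prod a (j # js) x ** (exp_prod_inv a js x ** a j ** exp_prod a js x) =
      a j ** matrix_exp (x $ j *\<^sub>R a j) ** exp_prod a js x" .
    then show ?thesis
      by (simp add: matmul.add_right matmul.scaleR_right matmul.scaleR_left matrix_mul_assoc)
  qed
  show ?case
    using C1_deriv_bilinear[OF bounded_bilinear_matrix_mult C1_deriv_matrix_exp Cons, of j "a j"]
    unfolding eq exp_prod.simps(2)[symmetric] .
qed

lemma C1_exp_prod: "C1 (exp_prod a js)"
  unfolding C1_def by (rule exI) (rule C1_deriv_exp_prod)

lemma C1_exp_prod_inv:
  fixes a :: "'m::finite \<Rightarrow> real^'n^'n"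
  shows "C1 (exp_prod_inv a js)"
proof (induction js)
  case (Cons j js)
  have "C1 (\<lambda>x::real^'m. matrix_exp ((- x) $ j *\<^sub>R a j))"
    by (rule C1_compose[OF C1_matrix_exp C1_bounded_linear]) (rule bounded_linear_minus[OF bounded_linear_ident])
  from C1_matrix_mult[OF Cons this] show ?case by simp
qed (simp add: C1_const)

lemma C1_exp_prod_logd: "C1 (\<lambda>x. exp_prod_logd a js x h)"
proof (induction js)
  case (Cons j js)
  show ?case
    unfolding exp_prod_logd.simps
    by (intro C1_add Cons C1_bilinear[OF bounded_bilinear_scaleR C1_const] C1_matrix_mult
        C1_exp_prod C1_exp_prod_inv C1_const)
qed (simp add: C1_const)

lemma linear_exp_prod_logd: "linear (exp_prod_logd a js x)"
  by (induction js) (auto intro!: linearI simp: linear_add linear_scale algebra_simps)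

lemma exp_prod_0: "exp_prod a js 0 = mat 1"
  by (induction js) auto

lemma exp_prod_inv_0: "exp_prod_inv a js 0 = mat 1"
  by (induction js) auto

lemma exp_prod_logd_0: "distinct js \<Longrightarrow> exp_prod_logd a js 0 h = (\<Sum>j\<in>set js. h $ j *\<^sub>R a j)"
  by (induction js) (auto simp: exp_prod_0 exp_prod_inv_0 add.commute)

text \<open>
  A logarithmic derivative \<open>A x\<close> that is onto \<open>W\<close> at \<open>x = 0\<close> has a right inverse nearby. By
  Cramer's rule it becomes globally \<open>C\<^sup>1\<close> after multiplication with the determinant \<open>D\<close>.
\<close>

lemma right_inverse_field:
  fixes A :: "real^'m \<Rightarrow> real^'m \<Rightarrow> 'a::euclidean_space"
  assumes lin: "\<And>x. linear (A x)" and C1_A: "\<And>h. C1 (\<lambda>x. A x h)"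
    and W: "\<And>x h. A x h \<in> range (A 0)"
  obtains D :: "real^'m \<Rightarrow> real" and \<delta> where "C1 D" "D 0 = 1" "\<delta> > 0"
    "\<And>Y. C1 Y \<Longrightarrow> (\<And>x. Y x \<in> range (A 0)) \<Longrightarrow>
       \<exists>c. C1 c \<and> (Y 0 = 0 \<longrightarrow> c 0 = 0) \<and> (\<forall>x. norm x < \<delta> \<longrightarrow> A x (c x) = D x *\<^sub>R Y x)"
proof -
  obtain f where f: "linear f" "\<And>v. v \<in> range (A 0) \<Longrightarrow> A 0 (f v) = v"
    using linear_exists_right_inverse_on[OF lin[of 0] subspace_UNIV] by blast
  \<comment> \<open>\<open>f\<close> is a linear right inverse of \<open>A 0\<close> on its range,
    hence \<open>A 0 (k x c) = A x c\<close>. It therefore suffices to solve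
    \<open>k x c = D x *\<^sub>R f (Y x)\<close>, a square system that is the identity at x =
    0.\<close>
  define k where "k x c = c + f (A x c - A 0 c)" for x c
  define K where "K x = matrix (k x)" for x
  have lin_k: "linear (k x)" for x
    unfolding k_def
    by (intro linear_compose_add linear_compose_sub linear_compose[OF _ f(1), unfolded o_def] lin)
      (simp add: linear_id[unfolded id_def])
  have K: "K x *v c = k x c" for x c
    unfolding K_def by (rule matrix_works) (simp add: lin_k linear_matrix_vector_mul_eq)
  have lin_nth: "linear (\<lambda>x. x $ i :: real)" for i :: 'm
    by (simp add: linear_iff)
  have C1_K: "C1 (\<lambda>x. K x $ i $ j)" for i j
    unfolding K_def matrix_def k_def
    by simp (intro C1_add C1_const C1_linear_compose[OF lin_nth] C1_linear_compose[OF f(1)] C1_diff C1_A)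
  define D where "D x = det (K x)" for x
  have C1_D: "C1 D" unfolding D_def by (intro C1_det C1_K)
  have k0: "k 0 c = c" for c by (simp add: k_def linear_0[OF f(1)])
  have "K 0 = mat 1" by (simp add: matrix_eq K k0)
  then have D0: "D 0 = 1" by (simp add: D_def)
  have "continuous_on UNIV D" by (rule C1_continuous[OF C1_D])
  then have "isCont D 0" by (simp add: continuous_on_eq_continuous_at)
  then obtain \<delta> where \<delta>: "\<delta> > 0" "\<And>x. norm x < \<delta> \<Longrightarrow> D x \<noteq> 0"
    using continuous_at_avoid[of 0 D 0] D0 by (auto simp: dist_norm)
  show ?thesis
  proof (rule that[OF C1_D D0 \<delta>(1)])
    fix Y :: "real^'m \<Rightarrow> 'a" assume Y: "C1 Y" "\<And>x. Y x \<in> range (A 0)"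
    \<comment> \<open>The numerators of Cramer's rule, not divided by \<open>det (K x)\<close>:
      polynomials in the entries of \<open>K x\<close> and \<open>f (Y x)\<close>, hence defined and
      C^1 also where \<open>K x\<close> is singular.\<close>
    define c where "c x = (\<chi> k. det (\<chi> i j. if j = k then f (Y x) $ i else K x $ i $ j))" for x
    have C1_c: "C1 c"
      unfolding c_def
    proof (intro C1_vec_lambda C1_det)
      fix k i j
      show "C1 (\<lambda>x. (\<chi> i j. if j = k then f (Y x) $ i else K x $ i $ j) $ i $ j)"
        using C1_linear_compose[OF lin_nth[of i] C1_linear_compose[OF f(1) Y(1)]] C1_K[of i j]
        by (cases "j = k") simp_all
    qed
    have kc: "k x (c x) = D x *\<^sub>R f (Y x)" if "norm x < \<delta>" for x
    proof -
      have nz: "det (K x) \<noteq> 0" using \<delta>(2)[OF that] by (simp add: D_def)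
      have "K x *v (\<chi> k. det (\<chi> i j. if j = k then f (Y x) $ i else K x $ i $ j) / det (K x)) = f (Y x)"
        unfolding cramer[OF nz] ..
      also have "(\<chi> k. det (\<chi> i j. if j = k then f (Y x) $ i else K x $ i $ j) / det (K x)) = c x /\<^sub>R D x"
        by (simp add: vec_eq_iff c_def D_def divide_inverse mult.commute)
      finally have "f (Y x) = k x (c x) /\<^sub>R D x"
        by (simp add: matvec.scaleR_right K)
      then show ?thesis
        using \<delta>(2)[OF that] by simp
    qed
    have "A x (c x) = D x *\<^sub>R Y x" if "norm x < \<delta>" for x
    proof -
      have "A x (c x) - A 0 (c x) \<in> range (A 0)"
        by (intro subspace_diff linear_subspace_image lin subspace_UNIV W rangeI)
      then have "A 0 (k x (c x)) = A x (c x)"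
        by (simp add: k_def linear_add[OF lin] f(2))
      moreover have "A 0 (D x *\<^sub>R f (Y x)) = D x *\<^sub>R Y x"
        by (simp add: linear_scale[OF lin] f(2)[OF Y(2)])
      ultimately show ?thesis using kc[OF that] by simp
    qed
    moreover have "c 0 = 0" if "Y 0 = 0"
      using kc[of 0] \<delta>(1) that by (simp add: k0 linear_0[OF f(1)])
    ultimately show "\<exists>c. C1 c \<and> (Y 0 = 0 \<longrightarrow> c 0 = 0) \<and>
        (\<forall>x. norm x < \<delta> \<longrightarrow> A x (c x) = D x *\<^sub>R Y x)"
      by (intro exI[of _ c] conjI allI impI C1_c)
  qed
qed

section \<open>Matrix groups\<close>

lemma linear_algebraic_group_mult:
  "linear_algebraic_group G \<Longrightarrow> A \<in> G \<Longrightarrow> B \<in> G \<Longrightarrow> A ** B \<in> G"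
  unfolding linear_algebraic_group_def by blast

lemma matrix_exp_in_group: "X \<in> lie_algebra G \<Longrightarrow> matrix_exp (t *\<^sub>R X) \<in> G"
  unfolding lie_algebra_def by blast

lemma linear_algebraic_group_mat_1: "linear_algebraic_group G \<Longrightarrow> mat 1 \<in> G"
  unfolding linear_algebraic_group_def by blast

lemma lie_algebra_conj:
  assumes "linear_algebraic_group G" "X \<in> lie_algebra G" "g \<in> G" "h \<in> G" "g ** h = mat 1"
  shows "g ** X ** h \<in> lie_algebra G"
  unfolding lie_algebra_def
  by (simp add: conj_matrix_exp[OF assms(5)] linear_algebraic_group_mult[OF assms(1)]
      matrix_exp_in_group[OF assms(2)] assms(3,4))

lemma zero_in_lie_algebra: "linear_algebraic_group G \<Longrightarrow> 0 \<in> lie_algebra G"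
  by (simp add: lie_algebra_def linear_algebraic_group_mat_1)

text \<open>The index type is fixed in advance while the dimension of the span is unknown, so
  surplus indices repeat a basis element. The family lies in S itself and not merely in its span,
  because its members are to be exponentiated into the group.\<close>

lemma ex_spanning_family:
  fixes S :: "'a::euclidean_space set"
  assumes "S \<noteq> {}" "DIM('a) \<le> CARD('m::finite)"
  obtains a :: "'m::finite \<Rightarrow> 'a" where "range a \<subseteq> S" "span (range a) = span S"
proof -
  obtain B where B: "B \<subseteq> S" "independent B" "S \<subseteq> span B"
    using maximal_independent_subset by blast
  have span_B: "span B = span S"
    by (rule span_eq[THEN iffD2]) (use B in \<open>auto intro: span_base\<close>)
  show ?thesis
  proof (cases "B = {}")
    case True
    then have "S = {0}" using B(3) assms(1) by auto
    then show ?thesis using that[of "\<lambda>_. 0"] by simp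
  next
    case False
    have "finite B" "card B \<le> CARD('m)"
      using independent_bound[OF B(2)] assms(2) by auto
    then obtain g where "g ` B \<subseteq> (UNIV :: 'm set)" "inj_on g B"
      using card_le_inj[of B "UNIV :: 'm set"] by auto
    then have "range (inv_into B g \<circ> (\<lambda>j. if j \<in> g ` B then j else g (SOME b. b \<in> B))) = B"
      (is "range ?a = B")
    proof -
      assume g: "inj_on g B"
      have "(SOME b. b \<in> B) \<in> B" using False some_in_eq by blast
      then have "?a j \<in> B" for j using g by auto
      moreover have "b \<in> range ?a" if "b \<in> B" for b
        using that g by (intro image_eqI[of _ _ "g b"]) auto
      ultimately show ?thesis by blast
    qed
    then show ?thesis using that[of ?a] B(1) span_B by simp
  qed
qed

text \<open>U is the product of the exponentials of a family in the Lie algebra that spans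
  \<open>span (lie_algebra G)\<close>. Working with the span means that closure of
  \<open>lie_algebra G\<close> under addition need not be known, and surjectivity of the
  differential onto it at 0 is the only nondegeneracy required.\<close>

lemma group_chart:
  fixes G :: "(real^'n^'n) set"
  assumes G: "linear_algebraic_group G"
  obtains U V :: "real^('n \<times> 'n) \<Rightarrow> real^'n^'n" and U' D and \<delta> :: real where
    "\<And>x. U x \<in> G" "\<And>x. V x ** U x = mat 1" "U 0 = mat 1"
    "\<And>x X. X \<in> lie_algebra G \<Longrightarrow> V x ** X ** U x \<in> lie_algebra G"
    "C1_deriv U U'" "C1 V" "C1 D" "D 0 = 1" "\<delta> > 0"
    "\<And>Y. C1 Y \<Longrightarrow> (\<And>x. Y x \<in> span (lie_algebra G)) \<Longrightarrow>
       \<exists>c. C1 c \<and> (Y 0 = 0 \<longrightarrow> c 0 = 0) \<and> (\<forall>x. norm x < \<delta> \<longrightarrow> U' x (c x) = D x *\<^sub>R (U x ** Y x))"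
proof -
  obtain a :: "'n \<times> 'n \<Rightarrow> real^'n^'n"
    where a: "range a \<subseteq> lie_algebra G" "span (range a) = span (lie_algebra G)"
    using ex_spanning_family[of "lie_algebra G", where 'm="'n \<times> 'n"] zero_in_lie_algebra[OF G]
    by (auto simp: mult.commute)
  obtain js :: "('n \<times> 'n) list" where js: "set js = UNIV" "distinct js"
    using finite_distinct_list[OF finite_class.finite_UNIV] by blast
  let ?U = "exp_prod a js" and ?V = "exp_prod_inv a js" and ?A = "exp_prod_logd a js"
  have UV: "exp_prod a ks x \<in> G \<and> exp_prod_inv a ks x \<in> G" for ks x
    by (induction ks) (use a(1) in \<open>auto simp del: scaleR_minus_left intro!: linear_algebraic_group_mat_1[OF G]
      linear_algebraic_group_mult[OF G] matrix_exp_in_group\<close>)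
  have conj: "exp_prod_inv a ks x ** X ** exp_prod a ks x \<in> lie_algebra G"
    if "X \<in> lie_algebra G" for ks x X
    by (rule lie_algebra_conj[OF G that]) (simp_all add: UV exp_prod_inverse')
  have "exp_prod_logd a ks x h \<in> span (lie_algebra G)" for ks x h
  proof (induction ks)
    case (Cons k ks)
    have "exp_prod_inv a ks x ** a k ** exp_prod a ks x \<in> lie_algebra G"
      using a(1) by (intro conj) auto
    then show ?case
      using Cons by (auto intro: span_add span_scale span_base)
  qed (simp add: span_zero)
  moreover have range: "range (?A 0) = span (lie_algebra G)"
  proof -
    have "span (range a) \<subseteq> range (?A 0)"
    proof (rule span_minimal)
      show "subspace (range (?A 0))"
        by (intro linear_subspace_image linear_exp_prod_logd subspace_UNIV)
      have "a i = ?A 0 (axis i 1)" for i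
        using js by (simp add: exp_prod_logd_0 axis_def if_distrib[of "\<lambda>r. r *\<^sub>R _"] cong: if_cong)
      then show "range a \<subseteq> range (?A 0)" by blast
    qed
    with calculation a(2) show ?thesis by blast
  qed
  ultimately have W: "?A x h \<in> range (?A 0)" for x h by simp
  obtain D \<delta> where D: "C1 D" "D 0 = 1" "\<delta> > 0"
    "\<And>Y. C1 Y \<Longrightarrow> (\<And>x. Y x \<in> range (?A 0)) \<Longrightarrow>
       \<exists>c. C1 c \<and> (Y 0 = 0 \<longrightarrow> c 0 = 0) \<and> (\<forall>x. norm x < \<delta> \<longrightarrow> ?A x (c x) = D x *\<^sub>R Y x)"
    by (rule right_inverse_field[OF linear_exp_prod_logd C1_exp_prod_logd W]) blast
  show ?thesis
  proof (rule that[of ?U ?V "\<lambda>x h. ?U x ** ?A x h" D \<delta>])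
    fix Y :: "real^('n \<times> 'n) \<Rightarrow> real^'n^'n" assume "C1 Y" "\<And>x. Y x \<in> span (lie_algebra G)"
    then obtain c where "C1 c" "Y 0 = 0 \<longrightarrow> c 0 = 0" "\<And>x. norm x < \<delta> \<Longrightarrow> ?A x (c x) = D x *\<^sub>R Y x"
      using D(4)[of Y] range by metis
    then show "\<exists>c. C1 c \<and> (Y 0 = 0 \<longrightarrow> c 0 = 0) \<and>
        (\<forall>x. norm x < \<delta> \<longrightarrow> ?U x ** ?A x (c x) = D x *\<^sub>R (?U x ** Y x))"
      by (intro exI[of _ c]) (simp add: matmul.scaleR_right)
  qed (use UV conj D exp_prod_inverse' exp_prod_0 C1_deriv_exp_prod C1_exp_prod_inv in \<open>simp_all\<close>)
qed

section \<open>The space of continuous functions vanishing at infinity\<close>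

text \<open>For closed M this is membership in \<open>c0_space M\<close> without extensionality, so
  that functions given on the whole space can be used unrestricted. Smallness off a compact subset
  becomes decay in the norm, as closed bounded parts of M are compact.\<close>

definition c0 :: "'a::euclidean_space set \<Rightarrow> ('a \<Rightarrow> complex) \<Rightarrow> bool" where
  "c0 M \<phi> \<longleftrightarrow> continuous_on M \<phi> \<and> (\<forall>\<epsilon>>0. \<exists>R. \<forall>m\<in>M. norm m > R \<longrightarrow> norm (\<phi> m) < \<epsilon>)"

lemma c0_cong: "(\<And>m. m \<in> M \<Longrightarrow> \<phi> m = \<psi> m) \<Longrightarrow> c0 M \<phi> \<longleftrightarrow> c0 M \<psi>"
  unfolding c0_def by (simp cong: continuous_on_cong)

lemma c0_restrict [simp]: "c0 M (restrict \<phi> M) \<longleftrightarrow> c0 M \<phi>"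
  by (rule c0_cong) simp

lemma c0_bounded:
  assumes "closed M" "c0 M \<phi>"
  obtains B where "B > 0" "\<And>m. m \<in> M \<Longrightarrow> norm (\<phi> m) \<le> B"
proof -
  obtain R where R: "\<And>m. m \<in> M \<Longrightarrow> norm m > R \<Longrightarrow> norm (\<phi> m) < 1"
    using assms(2) zero_less_one unfolding c0_def by blast
  have "compact (M \<inter> cball 0 R)"
    using assms(1) by (simp add: closed_Int_compact)
  moreover have "continuous_on (M \<inter> cball 0 R) \<phi>"
    using assms(2) continuous_on_subset unfolding c0_def by blast
  ultimately have "bounded (\<phi> ` (M \<inter> cball 0 R))"
    using compact_continuous_image compact_imp_bounded by blast
  then obtain C where C: "\<And>m. m \<in> M \<inter> cball 0 R \<Longrightarrow> norm (\<phi> m) \<le> C"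
    unfolding bounded_iff by blast
  show ?thesis
  proof (rule that[of "max 1 C"])
    fix m assume "m \<in> M"
    then show "norm (\<phi> m) \<le> max 1 C"
      using R[of m] C[of m] by (cases "norm m > R") (auto simp: max_def)
  qed simp
qed

lemma c0_add: "c0 M \<phi> \<Longrightarrow> c0 M \<psi> \<Longrightarrow> c0 M (\<lambda>m. \<phi> m + \<psi> m)"
  unfolding c0_def
proof (intro conjI allI impI, goal_cases)
  case (2 \<epsilon>)
  then have "\<epsilon> / 2 > 0" by simp
  with 2 obtain R S where "\<forall>m\<in>M. norm m > R \<longrightarrow> norm (\<phi> m) < \<epsilon> / 2"
    "\<forall>m\<in>M. norm m > S \<longrightarrow> norm (\<psi> m) < \<epsilon> / 2"
    by meson
  then show ?case
    by (intro exI[of _ "max R S"]) (smt (verit) field_sum_of_halves max.bounded_iff norm_triangle_ineq)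
qed (auto intro: continuous_on_add)

lemma c0_scaleR: "c0 M \<phi> \<Longrightarrow> c0 M (\<lambda>m. r *\<^sub>R \<phi> m)"
  unfolding c0_def
proof (intro conjI allI impI, goal_cases)
  case (2 \<epsilon>)
  then have "\<epsilon> / (\<bar>r\<bar> + 1) > 0" by simp
  with 2 obtain R where R: "\<forall>m\<in>M. norm m > R \<longrightarrow> norm (\<phi> m) < \<epsilon> / (\<bar>r\<bar> + 1)"
    by meson
  have "norm (r *\<^sub>R \<phi> m) < \<epsilon>" if "m \<in> M" "norm m > R" for m
  proof -
    have "norm (r *\<^sub>R \<phi> m) \<le> (\<bar>r\<bar> + 1) * norm (\<phi> m)"
      by (simp add: mult_right_mono)
    also have "\<dots> < \<epsilon>"
      using R that by (simp add: pos_less_divide_eq mult.commute)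
    finally show ?thesis .
  qed
  then show ?case by blast
qed (auto intro: continuous_intros)

lemma c0_diff: "c0 M \<phi> \<Longrightarrow> c0 M \<psi> \<Longrightarrow> c0 M (\<lambda>m. \<phi> m - \<psi> m)"
  using c0_add[of M \<phi> "\<lambda>m. - 1 *\<^sub>R \<psi> m"] c0_scaleR[of M \<psi> "- 1"] by simp

lemma matrix_vector_norm_bound:
  obtains K where "K > 0" "\<And>(A::real^'n^'n) x. norm (A *v x) \<le> K * norm A * norm x"
proof -
  obtain K where "K > 0" "\<And>(A::real^'n^'n) (x::real^'n). norm (A *v x) \<le> norm A * norm x * K"
    using matvec.pos_bounded by blast
  then show ?thesis using that[of K] by (simp add: mult_ac)
qed

text \<open>With the inverse h one has |m| \<le> K |h| |g m|, so g m leaves every ball when m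
  does.\<close>

lemma c0_matrix_compose:
  fixes g h :: "real^'n^'n"
  assumes "c0 M \<phi>" "\<And>m. m \<in> M \<Longrightarrow> g *v m \<in> M" "h ** g = mat 1"
  shows "c0 M (\<lambda>m. \<phi> (g *v m))"
  unfolding c0_def
proof (intro conjI allI impI)
  show "continuous_on M (\<lambda>m. \<phi> (g *v m))"
    by (rule continuous_on_compose2[of M \<phi>])
      (use assms in \<open>auto simp: c0_def intro: matvec.continuous_on continuous_on_const continuous_on_id\<close>)
  fix \<epsilon> :: real assume "\<epsilon> > 0"
  then obtain R where R: "\<And>m. m \<in> M \<Longrightarrow> norm m > R \<Longrightarrow> norm (\<phi> m) < \<epsilon>"
    using assms(1) unfolding c0_def by meson
  obtain K where K: "K > 0" "\<And>(A::real^'n^'n) x. norm (A *v x) \<le> K * norm A * norm x"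
    by (rule matrix_vector_norm_bound) blast
  have "norm (\<phi> (g *v m)) < \<epsilon>" if "m \<in> M" "norm m > K * norm h * max 0 R" for m
  proof (rule R)
    have "norm m = norm (h *v (g *v m))" by (simp add: matrix_vector_mul_assoc assms(3))
    also have "\<dots> \<le> K * norm h * norm (g *v m)" by (rule K(2))
    finally have "K * norm h * max 0 R < K * norm h * norm (g *v m)" using that by simp
    then show "norm (g *v m) > R"
      using K(1) by (simp add: mult_less_cancel_left split: if_splits)
  qed (use assms that in auto)
  then show "\<exists>R. \<forall>m\<in>M. norm m > R \<longrightarrow> norm (\<phi> (g *v m)) < \<epsilon>" by blast
qed

lemma mspace_c0_space:
  assumes "closed M"
  shows "\<phi> \<in> mspace (c0_space M) \<longleftrightarrow> \<phi> \<in> extensional M \<and> c0 M \<phi>"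
proof -
  have "(\<forall>\<epsilon>>0. \<exists>K. compact K \<and> K \<subseteq> M \<and> (\<forall>m\<in>M - K. norm (\<phi> m) < \<epsilon>)) \<longleftrightarrow>
      (\<forall>\<epsilon>>0. \<exists>R. \<forall>m\<in>M. norm m > R \<longrightarrow> norm (\<phi> m) < \<epsilon>)"
  proof (intro iff_allI imp_cong refl iffI)
    fix \<epsilon> :: real assume "\<exists>K. compact K \<and> K \<subseteq> M \<and> (\<forall>m\<in>M - K. norm (\<phi> m) < \<epsilon>)"
    then obtain K where K: "compact K" "\<And>m. m \<in> M - K \<Longrightarrow> norm (\<phi> m) < \<epsilon>" by blast
    then obtain R where "\<And>m. m \<in> K \<Longrightarrow> norm m \<le> R"
      using compact_imp_bounded bounded_iff by metis
    then have "m \<in> M - K" if "m \<in> M" "norm m > R" for m using that by force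
    with K show "\<exists>R. \<forall>m\<in>M. norm m > R \<longrightarrow> norm (\<phi> m) < \<epsilon>" by blast
  next
    fix \<epsilon> :: real assume "\<exists>R. \<forall>m\<in>M. norm m > R \<longrightarrow> norm (\<phi> m) < \<epsilon>"
    then obtain R where R: "\<And>m. m \<in> M \<Longrightarrow> norm m > R \<Longrightarrow> norm (\<phi> m) < \<epsilon>" by blast
    have "compact (M \<inter> cball 0 R)" using assms by (simp add: closed_Int_compact)
    then show "\<exists>K. compact K \<and> K \<subseteq> M \<and> (\<forall>m\<in>M - K. norm (\<phi> m) < \<epsilon>)"
      using R by (intro exI[of _ "M \<inter> cball 0 R"]) (auto simp: not_le[symmetric])
  qed
  moreover have "bounded (\<phi> ` M)" if "c0 M \<phi>"
    using c0_bounded[OF assms that] unfolding bounded_iff by (metis imageE)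
  ultimately show ?thesis
    by (auto simp: c0_space_def c0_def)
qed

lemma mdist_c0_space_le:
  "0 \<le> B \<Longrightarrow> (\<And>m. m \<in> M \<Longrightarrow> norm (\<phi> m - \<psi> m) \<le> B) \<Longrightarrow> mdist (c0_space M) \<phi> \<psi> \<le> B"
  unfolding c0_space_def mdist_submetric by (rule mdist_cfunspace_le) (auto simp: dist_norm)

lemma mdist_c0_spaceD:
  assumes "\<phi> \<in> mspace (c0_space M)" "\<psi> \<in> mspace (c0_space M)"
    "mdist (c0_space M) \<phi> \<psi> \<le> B" "m \<in> M"
  shows "norm (\<phi> m - \<psi> m) \<le> B"
proof -
  have "\<phi> \<in> mspace (cfunspace (top_of_set M) euclidean_metric)"
    "\<psi> \<in> mspace (cfunspace (top_of_set M) euclidean_metric)"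
    using assms unfolding c0_space_def mspace_submetric by blast+
  from mdist_cfunspace_imp_mdist_le[OF this, of B m] assms(3,4)
  show ?thesis unfolding c0_space_def by (simp add: dist_norm)
qed

text \<open>Uniformity in m comes from two regimes. If |m| \<ge> 3R, a displacement of at most |m|/2
  keeps both points outside the ball of radius R, where \<phi> is below \<epsilon>/2. If |m| < 3R,
  both points lie in the compact set of radius 5R, on which \<phi> is uniformly continuous.\<close>

lemma strong_continuity:
  fixes M :: "(real^'n) set"
  assumes "closed M" "c0 M \<phi>" "\<epsilon> > 0"
  obtains \<delta> where "\<delta> > 0" "\<And>g m. norm (g - mat 1) < \<delta> \<Longrightarrow> m \<in> M \<Longrightarrow> g *v m \<in> M \<Longrightarrow>
    norm (\<phi> (g *v m) - \<phi> m) < \<epsilon>"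
proof -
  obtain K where K: "K > 0" "\<And>(A::real^'n^'n) x. norm (A *v x) \<le> K * norm A * norm x"
    by (rule matrix_vector_norm_bound) blast
  obtain R0 where R0: "\<And>m. m \<in> M \<Longrightarrow> norm m > R0 \<Longrightarrow> norm (\<phi> m) < \<epsilon> / 2"
    using assms(2,3) unfolding c0_def by (meson half_gt_zero)
  define R where "R = max 1 R0"
  have R: "R \<ge> 1" "\<And>m. m \<in> M \<Longrightarrow> norm m > R \<Longrightarrow> norm (\<phi> m) < \<epsilon> / 2"
    using R0 by (auto simp: R_def)
  let ?C = "M \<inter> cball 0 (5 * R)"
  have "compact ?C" using assms(1) by (simp add: closed_Int_compact)
  moreover have "continuous_on ?C \<phi>"
    using assms(2) continuous_on_subset unfolding c0_def by blast
  ultimately have "uniformly_continuous_on ?C \<phi>" by (rule compact_uniformly_continuous[rotated])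
  then obtain d where d: "d > 0" "\<And>x y. x \<in> ?C \<Longrightarrow> y \<in> ?C \<Longrightarrow> dist y x < d \<Longrightarrow> dist (\<phi> y) (\<phi> x) < \<epsilon>"
    unfolding uniformly_continuous_on_def using assms(3) by meson
  define \<delta> where "\<delta> = min (1 / 2) (d / (3 * R)) / K"
  show ?thesis
  proof (rule that[of \<delta>])
    show "\<delta> > 0" using d(1) R(1) K(1) by (simp add: \<delta>_def)
    fix g :: "real^'n^'n" and m
    assume g: "norm (g - mat 1) < \<delta>" and m: "m \<in> M" "g *v m \<in> M"
    have Kg: "K * norm (g - mat 1) < min (1 / 2) (d / (3 * R))"
      using g K(1) by (simp add: \<delta>_def pos_less_divide_eq mult.commute)
    have diff: "norm (g *v m - m) \<le> min (1 / 2) (d / (3 * R)) * norm m"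
    proof -
      have "g *v m - m = (g - mat 1) *v m" by (simp add: matvec.diff_left)
      then have "norm (g *v m - m) \<le> K * norm (g - mat 1) * norm m" using K(2) by simp
      also have "\<dots> \<le> min (1 / 2) (d / (3 * R)) * norm m" using Kg by (intro mult_right_mono) auto
      finally show ?thesis .
    qed
    have half: "norm (g *v m - m) \<le> norm m / 2"
    proof -
      have "min (1 / 2) (d / (3 * R)) * norm m \<le> 1 / 2 * norm m" by (intro mult_right_mono) auto
      then show ?thesis using diff by linarith
    qed
    show "norm (\<phi> (g *v m) - \<phi> m) < \<epsilon>"
    proof (cases "norm m < 3 * R")
      case False
      then have "norm m > R" using R(1) by simp
      moreover have "norm (g *v m) > R"
        using half norm_triangle_ineq2[of m "m - g *v m"] False R(1) by (simp add: norm_minus_commute)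
      ultimately have "norm (\<phi> m) < \<epsilon> / 2" "norm (\<phi> (g *v m)) < \<epsilon> / 2"
        using R(2) m by auto
      then show ?thesis using norm_triangle_ineq4[of "\<phi> (g *v m)" "\<phi> m"] by simp
    next
      case True
      have "norm (g *v m) \<le> norm m + norm (g *v m - m)" using norm_triangle_ineq[of m "g *v m - m"] by simp
      then have "m \<in> ?C" "g *v m \<in> ?C" using m half True R(1) by auto
      moreover have "norm (g *v m - m) < d"
      proof -
        have "min (1 / 2) (d / (3 * R)) * norm m \<le> d / (3 * R) * norm m"
          by (intro mult_right_mono) auto
        also have "\<dots> < d / (3 * R) * (3 * R)"
          using True d(1) R(1) by (intro mult_strict_left_mono) auto
        finally show ?thesis using diff R(1) by simp
      qed
      ultimately show ?thesis using d(2)[of m "g *v m"] by (simp add: dist_norm)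
    qed
  qed
qed

section \<open>Generators\<close>

lemma left_regular_matrix_exp:
  "m \<in> M \<Longrightarrow> left_regular M (matrix_exp (h *\<^sub>R X)) \<phi> m = \<phi> (matrix_exp ((- h) *\<^sub>R X) *v m)"
  unfolding left_regular_def matrix_inv_matrix_exp by simp

text \<open>Trades the limit in the supremum metric for an estimate that is pointwise but uniform on
  M. The metric limit can be unfolded only because every difference quotient lies in
  \<open>c0_space M\<close>, which uses the invariance of M.\<close>

lemma has_generator_value_iff:
  fixes M :: "(real^'n) set"
  assumes M: "closed M" "\<And>t m. m \<in> M \<Longrightarrow> matrix_exp (t *\<^sub>R X) *v m \<in> M"
    and \<phi>: "\<phi> \<in> mspace (c0_space M)"
  shows "has_generator_value M X \<phi> \<psi> \<longleftrightarrow> \<psi> \<in> mspace (c0_space M) \<and>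
    (\<forall>\<epsilon>>0. \<exists>\<delta>>0. \<forall>h. 0 < \<bar>h\<bar> \<and> \<bar>h\<bar> < \<delta> \<longrightarrow>
       (\<forall>m\<in>M. norm ((\<phi> (matrix_exp ((- h) *\<^sub>R X) *v m) - \<phi> m) /\<^sub>R h - \<psi> m) \<le> \<epsilon>))"
proof -
  interpret c: Metric_space "mspace (c0_space M)" "mdist (c0_space M)" by blast
  define q where "q h = (\<lambda>m\<in>M. (left_regular M (matrix_exp (h *\<^sub>R X)) \<phi> m - \<phi> m) /\<^sub>R h)" for h
  have q: "q h m = (\<phi> (matrix_exp ((- h) *\<^sub>R X) *v m) - \<phi> m) /\<^sub>R h" if "m \<in> M" for h m
    using that by (simp add: q_def left_regular_matrix_exp)
  have q_in: "q h \<in> mspace (c0_space M)" for h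
  proof -
    have c0: "c0 M \<phi>" using \<phi> M(1) by (simp add: mspace_c0_space)
    have "matrix_exp (h *\<^sub>R X) ** matrix_exp ((- h) *\<^sub>R X) = mat 1"
      by (simp add: matrix_exp_minus)
    then have "c0 M (\<lambda>m. (1 / h) *\<^sub>R (\<phi> (matrix_exp ((- h) *\<^sub>R X) *v m) - \<phi> m))"
      by (intro c0_scaleR c0_diff c0 c0_matrix_compose[OF c0 M(2)])
    then have "c0 M (q h)"
      by (subst c0_cong[where \<psi>="\<lambda>m. (1 / h) *\<^sub>R (\<phi> (matrix_exp ((- h) *\<^sub>R X) *v m) - \<phi> m)"])
        (simp_all add: q divide_inverse)
    then show ?thesis
      using M(1) by (simp add: mspace_c0_space q_def)
  qed
  have "has_generator_value M X \<phi> \<psi> \<longleftrightarrow> limitin c.mtopology q \<psi> (at 0)"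
    unfolding has_generator_value_def mtopology_of_def q_def ..
  also have "\<dots> \<longleftrightarrow> \<psi> \<in> mspace (c0_space M) \<and>
      (\<forall>\<epsilon>>0. \<exists>\<delta>>0. \<forall>h. 0 < \<bar>h\<bar> \<and> \<bar>h\<bar> < \<delta> \<longrightarrow> mdist (c0_space M) (q h) \<psi> < \<epsilon>)"
    by (simp add: c.limitin_metric q_in eventually_at dist_real_def)
  also have "\<dots> \<longleftrightarrow> \<psi> \<in> mspace (c0_space M) \<and>
    (\<forall>\<epsilon>>0. \<exists>\<delta>>0. \<forall>h. 0 < \<bar>h\<bar> \<and> \<bar>h\<bar> < \<delta> \<longrightarrow> (\<forall>m\<in>M. norm (q h m - \<psi> m) \<le> \<epsilon>))"
  proof (intro conj_cong refl iffI allI impI)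
    fix \<epsilon> :: real
    assume "\<psi> \<in> mspace (c0_space M)" "\<epsilon> > 0"
      and lim: "\<forall>\<epsilon>>0. \<exists>\<delta>>0. \<forall>h. 0 < \<bar>h\<bar> \<and> \<bar>h\<bar> < \<delta> \<longrightarrow> mdist (c0_space M) (q h) \<psi> < \<epsilon>"
    obtain \<delta> where \<delta>: "\<delta> > 0" "\<forall>h. 0 < \<bar>h\<bar> \<and> \<bar>h\<bar> < \<delta> \<longrightarrow> mdist (c0_space M) (q h) \<psi> < \<epsilon>"
      using lim[rule_format, OF \<open>\<epsilon> > 0\<close>] by blast
    show "\<exists>\<delta>>0. \<forall>h. 0 < \<bar>h\<bar> \<and> \<bar>h\<bar> < \<delta> \<longrightarrow> (\<forall>m\<in>M. norm (q h m - \<psi> m) \<le> \<epsilon>)"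
    proof (intro exI[of _ \<delta>] conjI \<delta>(1) allI impI ballI)
      fix h m assume "0 < \<bar>h\<bar> \<and> \<bar>h\<bar> < \<delta>" "m \<in> M"
      with \<delta>(2) have "mdist (c0_space M) (q h) \<psi> \<le> \<epsilon>" by (simp add: less_imp_le)
      then show "norm (q h m - \<psi> m) \<le> \<epsilon>"
        by (rule mdist_c0_spaceD[OF q_in \<open>\<psi> \<in> mspace (c0_space M)\<close> _ \<open>m \<in> M\<close>])
    qed
  next
    fix \<epsilon> :: real
    assume "\<epsilon> > 0" and lim: "\<forall>\<epsilon>>0. \<exists>\<delta>>0. \<forall>h. 0 < \<bar>h\<bar> \<and> \<bar>h\<bar> < \<delta> \<longrightarrow> (\<forall>m\<in>M. norm (q h m - \<psi> m) \<le> \<epsilon>)"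
    obtain \<delta> where "\<delta> > 0" "\<forall>h. 0 < \<bar>h\<bar> \<and> \<bar>h\<bar> < \<delta> \<longrightarrow> (\<forall>m\<in>M. norm (q h m - \<psi> m) \<le> \<epsilon> / 2)"
      using lim[rule_format, of "\<epsilon> / 2"] \<open>\<epsilon> > 0\<close> by (auto simp del: divide_const_simps)
    moreover have "mdist (c0_space M) (q h) \<psi> < \<epsilon>" if "\<forall>m\<in>M. norm (q h m - \<psi> m) \<le> \<epsilon> / 2" for h
      using mdist_c0_space_le[of "\<epsilon> / 2" M "q h" \<psi>] that \<open>\<epsilon> > 0\<close> by simp
    ultimately show "\<exists>\<delta>>0. \<forall>h. 0 < \<bar>h\<bar> \<and> \<bar>h\<bar> < \<delta> \<longrightarrow> mdist (c0_space M) (q h) \<psi> < \<epsilon>"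
      by blast
  qed
  finally show ?thesis by (simp add: q cong: ball_cong)
qed

lemma generator_eqI:
  assumes "has_generator_value M X \<phi> \<psi>"
  shows "generator M X \<phi> = \<psi>"
  unfolding generator_def
proof (rule the_equality[of _ \<psi>])
  interpret c: Metric_space "mspace (c0_space M)" "mdist (c0_space M)" by blast
  fix \<psi>' assume "has_generator_value M X \<phi> \<psi>'"
  with assms show "\<psi>' = \<psi>"
    unfolding has_generator_value_def mtopology_of_def
    using c.limitin_metric_unique trivial_limit_at by blast
qed fact

text \<open>Only finitely many factors occur, so products of balls of one common radius form a
  neighbourhood base and a single \<epsilon> serves all coordinates.\<close>

lemma closure_of_graph:
  assumes S: "\<And>f. f \<in> S \<Longrightarrow> f \<in> mspace (c0_space M)"
    "\<And>f i. f \<in> S \<Longrightarrow> i \<in> {1..k} \<Longrightarrow> generator M (X i) f \<in> mspace (c0_space M)"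
  shows "(\<phi>, \<Psi>) \<in> graph_space M k closure_of generators_graph_on S M k X \<longleftrightarrow>
    \<phi> \<in> mspace (c0_space M) \<and> \<Psi> \<in> (\<Pi>\<^sub>E i\<in>{1..k}. mspace (c0_space M)) \<and>
    (\<forall>\<epsilon>>0. \<exists>f\<in>S. mdist (c0_space M) \<phi> f < \<epsilon> \<and>
       (\<forall>i\<in>{1..k}. mdist (c0_space M) (\<Psi> i) (generator M (X i) f) < \<epsilon>))"
    (is "?l \<longleftrightarrow> ?r")
proof -
  let ?C = "c0_space M"
  interpret c: Metric_space "mspace ?C" "mdist ?C" by blast
  have top: "mtopology_of ?C = c.mtopology" by (simp add: mtopology_of_def)
  have topspace: "topspace (graph_space M k) = mspace ?C \<times> (\<Pi>\<^sub>E i\<in>{1..k}. mspace ?C)"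
    by (simp add: graph_space_def)
  show ?thesis
  proof
    assume l: ?l
    then have in_top: "\<phi> \<in> mspace ?C" "\<Psi> \<in> (\<Pi>\<^sub>E i\<in>{1..k}. mspace ?C)"
      unfolding in_closure_of topspace by auto
    show ?r
    proof (intro conjI in_top allI impI)
      fix \<epsilon> :: real assume "\<epsilon> > 0"
      let ?T = "c.mball \<phi> \<epsilon> \<times> (\<Pi>\<^sub>E i\<in>{1..k}. c.mball (\<Psi> i) \<epsilon>)"
      have "openin (graph_space M k) ?T"
        unfolding graph_space_def top openin_prod_Times_iff
        by (simp add: openin_PiE)
      moreover have "(\<phi>, \<Psi>) \<in> ?T"
        using in_top \<open>\<epsilon> > 0\<close> by (auto simp: PiE_iff)
      moreover have "\<exists>y. y \<in> generators_graph_on S M k X \<and> y \<in> T"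
        if "openin (graph_space M k) T" "(\<phi>, \<Psi>) \<in> T" for T
        using l that unfolding in_closure_of by simp
      ultimately obtain y where "y \<in> generators_graph_on S M k X" "y \<in> ?T"
        by meson
      then show "\<exists>f\<in>S. mdist ?C \<phi> f < \<epsilon> \<and>
          (\<forall>i\<in>{1..k}. mdist ?C (\<Psi> i) (generator M (X i) f) < \<epsilon>)"
        unfolding generators_graph_on_def by (auto simp: PiE_iff)
    qed
  next
    assume r: ?r
    show ?l
      unfolding in_closure_of topspace
    proof (intro conjI allI impI)
      show "(\<phi>, \<Psi>) \<in> mspace ?C \<times> (\<Pi>\<^sub>E i\<in>{1..k}. mspace ?C)" using r by blast
      fix T assume T: "(\<phi>, \<Psi>) \<in> T \<and> openin (graph_space M k) T"
      then obtain U V where UV: "openin c.mtopology U" "\<phi> \<in> U" "\<Psi> \<in> V" "U \<times> V \<subseteq> T"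
        "openin (product_topology (\<lambda>_. c.mtopology) {1..k}) V"
        unfolding graph_space_def top openin_prod_topology_alt by meson
      obtain W where W: "\<And>i. i \<in> {1..k} \<Longrightarrow> openin c.mtopology (W i)" "\<Psi> \<in> Pi\<^sub>E {1..k} W"
        "Pi\<^sub>E {1..k} W \<subseteq> V"
        using bspec[OF UV(5)[unfolded openin_product_topology_alt] UV(3)] by blast
      obtain e0 where e0: "e0 > 0" "c.mball \<phi> e0 \<subseteq> U"
        using UV(1,2) unfolding c.openin_mtopology by blast
      have "\<exists>e>0. c.mball (\<Psi> i) e \<subseteq> W i" if "i \<in> {1..k}" for i
        using W(1)[OF that] PiE_mem[OF W(2) that] unfolding c.openin_mtopology by blast
      then obtain e where e: "\<And>i. i \<in> {1..k} \<Longrightarrow> e i > 0" "\<And>i. i \<in> {1..k} \<Longrightarrow> c.mball (\<Psi> i) (e i) \<subseteq> W i"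
        by metis
      \<comment> \<open>Inserting \<open>e0\<close> also keeps the minimum meaningful for k = 0,
        when there is no generator coordinate.\<close>
      define \<epsilon> where "\<epsilon> = Min (insert e0 (e ` {1..k}))"
      have \<epsilon>: "\<epsilon> > 0" using e(1) e0(1) unfolding \<epsilon>_def by (subst Min_gr_iff) auto
      have \<epsilon>_le: "\<epsilon> \<le> e0" "i \<in> {1..k} \<Longrightarrow> \<epsilon> \<le> e i" for i
        unfolding \<epsilon>_def by (intro Min_le; simp)+
      obtain f where f: "f \<in> S" "mdist ?C \<phi> f < \<epsilon>"
        "\<And>i. i \<in> {1..k} \<Longrightarrow> mdist ?C (\<Psi> i) (generator M (X i) f) < \<epsilon>"
        using r \<epsilon> by blast
      have "f \<in> U"
        using e0(2) f(1,2) \<epsilon>_le(1) r S(1) by (auto simp: subset_iff)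
      moreover have "generator M (X i) f \<in> W i" if i: "i \<in> {1..k}" for i
      proof -
        have "generator M (X i) f \<in> c.mball (\<Psi> i) (e i)"
          using f(1) f(3)[OF i] \<epsilon>_le(2)[OF i] r S(2)[OF f(1) i] i by (auto simp: PiE_iff)
        then show ?thesis using e(2)[OF i] by blast
      qed
      ultimately have "(f, \<lambda>i\<in>{1..k}. generator M (X i) f) \<in> T"
        using UV(4) W(3) by (auto simp: PiE_iff subset_iff)
      then show "\<exists>y. y \<in> generators_graph_on S M k X \<and> y \<in> T"
        using f(1) unfolding generators_graph_on_def by blast
    qed
  qed
qed

section \<open>Gaussian polynomials\<close>

lemma real_polynomial_function_derivative:
  assumes "real_polynomial_function (p :: 'a::euclidean_space \<Rightarrow> real)"
  shows "\<exists>p'. (\<forall>z. (p has_derivative p' z) (at z)) \<and> (\<forall>v. real_polynomial_function (\<lambda>z. p' z v))"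
  using assms
proof (induction p rule: real_polynomial_function.induct)
  case (linear f)
  then show ?case
    by (intro exI[of _ "\<lambda>z. f"]) (simp add: bounded_linear_imp_has_derivative real_polynomial_function.intros(2))
next
  case (const c)
  show ?case by (intro exI[of _ "\<lambda>z v. 0"]) (simp add: real_polynomial_function.intros(2))
next
  case (add f g)
  then obtain f' g' where "\<And>z. (f has_derivative f' z) (at z)" "\<And>v. real_polynomial_function (\<lambda>z. f' z v)"
    "\<And>z. (g has_derivative g' z) (at z)" "\<And>v. real_polynomial_function (\<lambda>z. g' z v)"
    by blast
  then show ?case
    by (intro exI[of _ "\<lambda>z v. f' z v + g' z v"]) (simp add: has_derivative_add real_polynomial_function.intros(3))
next
  case (mult f g)
  then obtain f' g' where "\<And>z. (f has_derivative f' z) (at z)" "\<And>v. real_polynomial_function (\<lambda>z. f' z v)"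
    "\<And>z. (g has_derivative g' z) (at z)" "\<And>v. real_polynomial_function (\<lambda>z. g' z v)"
    by blast
  then show ?case
    using mult.hyps
    by (intro exI[of _ "\<lambda>z v. f z * g' z v + f' z v * g z"])
      (simp add: has_derivative_mult real_polynomial_function.intros(3) real_polynomial_function.intros(4))
qed

lemma polynomial_function_derivative:
  fixes p :: "'a::euclidean_space \<Rightarrow> 'b::euclidean_space"
  assumes "polynomial_function p"
  obtains p' where "C1_deriv p p'" "\<And>v. polynomial_function (\<lambda>z. p' z v)"
proof -
  have "\<forall>b\<in>Basis. \<exists>q. (\<forall>z. ((\<lambda>z. p z \<bullet> b) has_derivative q z) (at z)) \<and>
      (\<forall>v. real_polynomial_function (\<lambda>z. q z v))"
    using real_polynomial_function_derivative assms unfolding polynomial_function_iff_Basis_inner by blast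
  then obtain q where q: "\<And>b z. b \<in> Basis \<Longrightarrow> ((\<lambda>z. p z \<bullet> b) has_derivative q b z) (at z)"
    "\<And>b v. b \<in> Basis \<Longrightarrow> real_polynomial_function (\<lambda>z. q b z v)"
    by metis
  define p' where "p' z v = (\<Sum>b\<in>Basis. q b z v *\<^sub>R b)" for z v
  have pol: "polynomial_function (\<lambda>z. p' z v)" for v
    unfolding p'_def
    by (intro polynomial_function_sum finite_Basis polynomial_function_mult polynomial_function_const)
      (simp add: q(2) real_polynomial_function_eq[symmetric])
  have "(p has_derivative p' z) (at z)" for z
  proof -
    have "((\<lambda>z. \<Sum>b\<in>Basis. (p z \<bullet> b) *\<^sub>R b) has_derivative p' z) (at z)"
      unfolding p'_def
      by (intro has_derivative_sum has_derivative_scaleR_left q(1))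
    then show ?thesis by (simp add: euclidean_representation)
  qed
  then have "C1_deriv p p'"
    by (intro C1_derivI continuous_on_polymonial_function pol)
  with pol show ?thesis using that by blast
qed

lemma polynomial_function_matrix: "polynomial_function (\<lambda>z. A *v z :: real^'n)"
  by (intro polynomial_function_bounded_linear matvec.bounded_linear_right)

lemma polynomial_function_inner_self:
  "real_polynomial_function (\<lambda>z::'a::euclidean_space. f z \<bullet> g z)"
  if "polynomial_function f" "polynomial_function (g :: _ \<Rightarrow> 'b::euclidean_space)"
proof -
  have "(\<lambda>z. f z \<bullet> g z) = (\<lambda>z. \<Sum>b\<in>Basis. (f z \<bullet> b) * (g z \<bullet> b))"
    by (rule ext) (rule euclidean_inner)
  moreover have "real_polynomial_function \<dots>"
    using that unfolding polynomial_function_iff_Basis_inner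
    by (intro real_polynomial_function_sum finite_Basis real_polynomial_function.intros(4)) auto
  ultimately show ?thesis by simp
qed

text \<open>The rate s is arbitrary in the induction because a product of two polynomials spends s/2
  on each factor. A linear function is absorbed by |z| \<le> 1 + |z|^2.\<close>

lemma real_polynomial_function_gauss_bound:
  assumes "real_polynomial_function (p :: 'a::euclidean_space \<Rightarrow> real)" "s > 0"
  shows "\<exists>C\<ge>0. \<forall>z. \<bar>p z\<bar> \<le> C * exp (s * (z \<bullet> z))"
  using assms
proof (induction p arbitrary: s rule: real_polynomial_function.induct)
  case (linear f)
  obtain K where K: "K > 0" "\<And>z. norm (f z) \<le> norm z * K"
    using bounded_linear.pos_bounded[OF linear(1)] by blast
  have "\<bar>f z\<bar> \<le> K * (1 + 1 / s) * exp (s * (z \<bullet> z))" for z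
  proof -
    have "norm z \<le> 1 + z \<bullet> z"
      using sum_squares_ge_zero[of "norm z - 1" 0]
      by (simp add: dot_square_norm power2_eq_square algebra_simps) (smt (verit) norm_ge_zero mult_nonneg_nonneg)
    also have "\<dots> = 1 + (1 / s) * (s * (z \<bullet> z))" using linear(2) by simp
    also have "\<dots> \<le> exp (s * (z \<bullet> z)) + (1 / s) * exp (s * (z \<bullet> z))"
      using linear(2) exp_ge_add_one_self[of "s * (z \<bullet> z)"]
      by (intro add_mono mult_left_mono) (auto intro: order_trans[OF _ exp_ge_add_one_self])
    finally have "norm z \<le> (1 + 1 / s) * exp (s * (z \<bullet> z))" by (simp add: algebra_simps)
    then have "norm z * K \<le> (1 + 1 / s) * exp (s * (z \<bullet> z)) * K"
      using K(1) by (intro mult_right_mono) auto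
    with K(2)[of z] show ?thesis by (simp add: mult_ac)
  qed
  moreover have "K * (1 + 1 / s) \<ge> 0" using K(1) linear(2) by simp
  ultimately show ?case by blast
next
  case (const c)
  have "\<bar>c\<bar> \<le> \<bar>c\<bar> * exp (s * (z \<bullet> z))" for z :: 'a
    using const mult_left_mono[of 1 "exp (s * (z \<bullet> z))" "\<bar>c\<bar>"] by simp
  then show ?case by (intro exI[of _ "\<bar>c\<bar>"]) auto
next
  case (add f g)
  obtain C where C: "C \<ge> 0" "\<And>z. \<bar>f z\<bar> \<le> C * exp (s * (z \<bullet> z))" using add by blast
  obtain D where D: "D \<ge> 0" "\<And>z. \<bar>g z\<bar> \<le> D * exp (s * (z \<bullet> z))" using add by blast
  have "\<bar>f z + g z\<bar> \<le> (C + D) * exp (s * (z \<bullet> z))" for z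
    using C(2)[of z] D(2)[of z] by (simp add: distrib_right)
  then show ?case using C(1) D(1) by (intro exI[of _ "C + D"]) auto
next
  case (mult f g)
  have s: "s / 2 > 0" using mult by simp
  obtain C where C: "C \<ge> 0" "\<And>z. \<bar>f z\<bar> \<le> C * exp (s / 2 * (z \<bullet> z))" using mult.IH(1)[OF s] by blast
  obtain D where D: "D \<ge> 0" "\<And>z. \<bar>g z\<bar> \<le> D * exp (s / 2 * (z \<bullet> z))" using mult.IH(2)[OF s] by blast
  have "\<bar>f z * g z\<bar> \<le> (C * D) * exp (s * (z \<bullet> z))" for z
  proof -
    have "\<bar>f z * g z\<bar> \<le> (C * exp (s / 2 * (z \<bullet> z))) * (D * exp (s / 2 * (z \<bullet> z)))"
      unfolding abs_mult by (intro mult_mono C D) (auto simp: C)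
    also have "\<dots> = (C * D) * (exp (s / 2 * (z \<bullet> z)) * exp (s / 2 * (z \<bullet> z)))" by simp
    also have "exp (s / 2 * (z \<bullet> z)) * exp (s / 2 * (z \<bullet> z)) = exp (s * (z \<bullet> z))"
      by (simp flip: exp_add)
    finally show ?thesis .
  qed
  then show ?case using C(1) D(1) by (intro exI[of _ "C * D"]) auto
qed

lemma polynomial_function_gauss_bound:
  fixes p :: "'a::euclidean_space \<Rightarrow> 'b::euclidean_space"
  assumes "polynomial_function p" "s > 0"
  obtains C where "C \<ge> 0" "\<And>z. norm (p z) \<le> C * exp (s * (z \<bullet> z))"
proof -
  have "\<forall>b\<in>Basis. \<exists>C\<ge>0. \<forall>z. \<bar>p z \<bullet> b\<bar> \<le> C * exp (s * (z \<bullet> z))"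
    using real_polynomial_function_gauss_bound[OF _ assms(2)] assms(1)
    unfolding polynomial_function_iff_Basis_inner by blast
  then obtain C where C: "\<And>b. b \<in> Basis \<Longrightarrow> C b \<ge> 0"
    "\<And>b z. b \<in> Basis \<Longrightarrow> \<bar>p z \<bullet> b\<bar> \<le> C b * exp (s * (z \<bullet> z))"
    by metis
  have "norm (p z) \<le> (\<Sum>b\<in>Basis. C b) * exp (s * (z \<bullet> z))" for z
  proof -
    have "norm (p z) \<le> (\<Sum>b\<in>Basis. \<bar>p z \<bullet> b\<bar>)" by (rule norm_le_l1)
    also have "\<dots> \<le> (\<Sum>b\<in>Basis. C b * exp (s * (z \<bullet> z)))" by (intro sum_mono C)
    finally show ?thesis by (simp add: sum_distrib_right)
  qed
  with that[of "\<Sum>b\<in>Basis. C b"] show ?thesis by (simp add: sum_nonneg C(1))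
qed

text \<open>The width is a parameter because the Stone-Weierstrass argument produces products, hence
  Gaussians with exponents 2, 3 and so on; the space of the theorem is a = 1.\<close>

definition gauss :: "real \<Rightarrow> (real^'n \<Rightarrow> complex) \<Rightarrow> real^'n \<Rightarrow> complex" where
  "gauss a p z = exp (- a * (z \<bullet> z)) *\<^sub>R p z"

lemma gaussian_polynomials_eq:
  fixes M :: "(real^'n) set"
  shows "gaussian_polynomials M = {restrict (gauss 1 p) M |p. polynomial_function p}"
proof -
  have "(\<Sum>j\<in>UNIV. (m $ j)\<^sup>2) = m \<bullet> m" for m :: "real^'n"
    by (simp add: inner_vec_def power2_eq_square)
  then show ?thesis
    unfolding gaussian_polynomials_def gauss_def by (simp add: scaleR_conv_of_real mult.commute)
qed

lemma C1_deriv_gauss: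
  fixes p :: "real^'n \<Rightarrow> complex"
  assumes "C1_deriv p p'"
  shows "C1_deriv (gauss a p) (\<lambda>z v. exp (- a * (z \<bullet> z)) *\<^sub>R (p' z v - (2 * a * (z \<bullet> v)) *\<^sub>R p z))"
proof -
  have "C1_deriv (\<lambda>z::real^'n. exp (- a * (z \<bullet> z))) (\<lambda>z v. exp (- a * (z \<bullet> z)) * (- a * (2 * (z \<bullet> v))) :: real)"
  proof (rule C1_derivI)
    show "((\<lambda>z. exp (- a * (z \<bullet> z))) has_derivative (\<lambda>v. exp (- a * (x \<bullet> x)) * (- a * (2 * (x \<bullet> v))))) (at x)"
      for x :: "real^'n"
      by (auto intro!: derivative_eq_intros simp: inner_commute)
    show "continuous_on UNIV (\<lambda>z. exp (- a * (z \<bullet> z)) * (- a * (2 * (z \<bullet> v))))" for v :: "real^'n"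
      by (intro continuous_intros)
  qed
  from C1_deriv_bilinear[OF bounded_bilinear_scaleR this assms]
  show ?thesis
    unfolding gauss_def[abs_def] by (simp add: algebra_simps)
qed

lemma norm_gauss_le:
  assumes "norm (p z) \<le> C * exp (s * (z \<bullet> z))"
  shows "norm (gauss a p z) \<le> C * exp ((s - a) * (z \<bullet> z))"
proof -
  have "norm (gauss a p z) \<le> exp (- a * (z \<bullet> z)) * (C * exp (s * (z \<bullet> z)))"
    unfolding gauss_def using assms by simp
  also have "\<dots> = C * exp ((s - a) * (z \<bullet> z))"
    by (simp add: mult_exp_exp algebra_simps)
  finally show ?thesis .
qed

lemma c0_gauss:
  assumes "polynomial_function p" "a > 0"
  shows "c0 M (gauss a p)"
  unfolding c0_def
proof (intro conjI allI impI)
  show "continuous_on M (gauss a p)"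
    unfolding gauss_def[abs_def] by (intro continuous_intros continuous_on_polymonial_function assms(1))
  fix \<epsilon> :: real assume \<epsilon>: "\<epsilon> > 0"
  obtain C where C: "C \<ge> 0" "\<And>z. norm (p z) \<le> C * exp (a / 2 * (z \<bullet> z))"
    using polynomial_function_gauss_bound[OF assms(1), of "a / 2"] assms(2) by auto
  \<comment> \<open>Half of the exponent absorbs the polynomial, the other half decays by e^t \<ge>
    t. The summand 1 gives R \<ge> 1, so that |z| > R implies |z|^2 \<ge> R.\<close>
  define R where "R = 1 + (C + 1) / (\<epsilon> * (a / 2))"
  have "norm (gauss a p z) < \<epsilon>" if "norm z > R" for z
  proof -
    have pos: "\<epsilon> * (a / 2) > 0" using \<epsilon> assms(2) by simp
    have R1: "R \<ge> 1" using C(1) pos by (simp add: R_def)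
    have zz: "z \<bullet> z \<ge> R"
    proof -
      have "R * 1 \<le> norm z * norm z" using that R1 by (intro mult_mono) auto
      then show ?thesis by (simp add: dot_square_norm power2_eq_square)
    qed
    have "(C + 1) / (\<epsilon> * (a / 2)) < z \<bullet> z" using zz by (simp add: R_def)
    then have "C + 1 < \<epsilon> * (a / 2) * (z \<bullet> z)" using pos by (simp add: pos_divide_less_eq mult.commute)
    also have "\<dots> \<le> \<epsilon> * exp (a / 2 * (z \<bullet> z))"
    proof -
      have "a / 2 * (z \<bullet> z) \<le> exp (a / 2 * (z \<bullet> z))"
        using exp_ge_add_one_self[of "a / 2 * (z \<bullet> z)"] by linarith
      from mult_left_mono[OF this, of \<epsilon>] show ?thesis using \<epsilon> by (simp add: mult.assoc)
    qed
    finally have "C < \<epsilon> * exp (a / 2 * (z \<bullet> z))" by simp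
    then have "C * exp (- (a / 2 * (z \<bullet> z))) < \<epsilon>"
      by (simp add: exp_minus divide_simps)
    then show ?thesis using norm_gauss_le[where p=p and a=a, OF C(2)[of z]] by (simp add: algebra_simps)
  qed
  then show "\<exists>R. \<forall>m\<in>M. norm m > R \<longrightarrow> norm (gauss a p m) < \<epsilon>" by blast
qed

text \<open>The derivative of a Gaussian along a linear field is a polynomial multiple of the same
  Gaussian. So the generators, unlike the group, preserve Gaussian polynomials of a given
  width.\<close>

lemma gauss_vector_field:
  fixes X :: "real^'n^'n"
  assumes "polynomial_function p"
  obtains F' q where "C1_deriv (gauss a p) F'" "polynomial_function q"
    "\<And>z. - F' z (X *v z) = gauss a q z"
proof -
  obtain p' where p': "C1_deriv p p'" "\<And>v. polynomial_function (\<lambda>z. p' z v)"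
    using polynomial_function_derivative[OF assms] by blast
  define q where "q z = (2 * a * (z \<bullet> (X *v z))) *\<^sub>R p z - (\<Sum>b\<in>Basis. ((X *v z) \<bullet> b) *\<^sub>R p' z b)" for z
  have "polynomial_function q"
    unfolding q_def
    by (intro polynomial_function_diff polynomial_function_mult polynomial_function_sum finite_Basis assms p'
        polynomial_function_inner polynomial_function_matrix)
      (intro real_polynomial_function_eq[THEN arg_cong, THEN iffD1, of "\<lambda>x. x"] real_polynomial_function.intros(4)
        real_polynomial_function.intros(2) polynomial_function_inner_self polynomial_function_id polynomial_function_matrix)
  moreover have "- (exp (- a * (z \<bullet> z)) *\<^sub>R (p' z (X *v z) - (2 * a * (z \<bullet> (X *v z))) *\<^sub>R p z)) = gauss a q z" for z
    unfolding gauss_def q_def C1_deriv_basis_sum[OF p'(1), of z "X *v z"] by (simp add: algebra_simps)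
  ultimately show ?thesis using that C1_deriv_gauss[OF p'(1)] by blast
qed

section \<open>Mean value pairs and closedness of the generators\<close>

text \<open>
  For a pair \<open>(\<phi>, d\<pi>(X) \<phi>)\<close> this is the mean value inequality along the one-parameter group. It
  implies that \<open>\<psi>\<close> is the generator value, and unlike the definition it passes to uniform limits.
\<close>

definition mean_value_pair ::
  "(real^'n) set \<Rightarrow> real^'n^'n \<Rightarrow> (real^'n \<Rightarrow> complex) \<Rightarrow> (real^'n \<Rightarrow> complex) \<Rightarrow> bool" where
  "mean_value_pair M X \<phi> \<psi> \<longleftrightarrow> (\<forall>h B. \<forall>m\<in>M.
     (\<forall>t. \<bar>t\<bar> \<le> \<bar>h\<bar> \<longrightarrow> norm (\<psi> (matrix_exp (t *\<^sub>R X) *v m) - \<psi> m) \<le> B) \<longrightarrow>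
     norm (\<phi> (matrix_exp ((- h) *\<^sub>R X) *v m) - \<phi> m - h *\<^sub>R \<psi> m) \<le> \<bar>h\<bar> * B)"

lemma flow_has_vector_derivative:
  assumes "C1_deriv F F'"
  shows "((\<lambda>t. F (matrix_exp ((- t) *\<^sub>R X) *v z)) has_vector_derivative
    - F' (matrix_exp ((- t) *\<^sub>R X) *v z) (X *v (matrix_exp ((- t) *\<^sub>R X) *v z))) (at t within S)"
proof -
  have m: "((\<lambda>t. - t) has_vector_derivative - 1) (at t within S)"
    by (auto intro!: derivative_eq_intros)
  have "((\<lambda>t. matrix_exp ((- t) *\<^sub>R X)) has_vector_derivative - (X ** matrix_exp ((- t) *\<^sub>R X))) (at t within S)"
    using vector_diff_chain_within[OF m matrix_exp_has_vector_derivative[of X "- t"]] by (simp add: o_def)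
  then have "((\<lambda>t. matrix_exp ((- t) *\<^sub>R X) *v z) has_vector_derivative
      - (X ** matrix_exp ((- t) *\<^sub>R X)) *v z) (at t within S)"
    by (rule bounded_linear.has_vector_derivative[OF matvec.bounded_linear_left])
  from has_derivative_compose[OF this[unfolded has_vector_derivative_def] C1_derivD[OF assms]]
  show ?thesis
    unfolding has_vector_derivative_def
    by (simp add: matvec.minus_left matrix_vector_mul_assoc linear_scale[OF C1_deriv_linear[OF assms]]
        linear_neg[OF C1_deriv_linear[OF assms]])
qed

lemma vector_mean_value:
  fixes f :: "real \<Rightarrow> 'a::real_normed_vector"
  assumes "\<And>t. (f has_vector_derivative f' t) (at t)" "\<And>t. \<bar>t\<bar> \<le> \<bar>h\<bar> \<Longrightarrow> norm (f' t - c) \<le> B"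
  shows "norm (f h - f 0 - h *\<^sub>R c) \<le> \<bar>h\<bar> * B"
proof -
  let ?u = "\<lambda>t. f t - t *\<^sub>R c"
  have "norm (?u h - ?u 0) \<le> B * norm (h - 0)"
  proof (rule differentiable_bound[of "{- \<bar>h\<bar>..\<bar>h\<bar>}" ?u "\<lambda>t x. x *\<^sub>R (f' t - c)"])
    fix t assume t: "t \<in> {- \<bar>h\<bar>..\<bar>h\<bar>}"
    have "(?u has_derivative (\<lambda>x. x *\<^sub>R f' t - x *\<^sub>R c)) (at t)"
      using assms(1)[of t, unfolded has_vector_derivative_def]
      by (intro has_derivative_diff) (auto intro!: derivative_eq_intros)
    then show "(?u has_derivative (\<lambda>x. x *\<^sub>R (f' t - c))) (at t within {- \<bar>h\<bar>..\<bar>h\<bar>})"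
      by (simp add: scaleR_diff_right has_derivative_at_withinI)
    have "\<bar>t\<bar> \<le> \<bar>h\<bar>" using t by auto
    then have "norm (x *\<^sub>R (f' t - c)) \<le> norm x * B" for x :: real
      using assms(2) by (simp add: mult_left_mono)
    then show "onorm (\<lambda>x. x *\<^sub>R (f' t - c)) \<le> B"
      by (intro onorm_le) (simp add: mult.commute)
  qed auto
  then show ?thesis by (simp add: mult.commute algebra_simps)
qed

lemma mean_value_pair_C1:
  assumes "C1_deriv F F'" "\<And>z. - F' z (X *v z) = G z"
  shows "mean_value_pair M X F G"
  unfolding mean_value_pair_def
proof (intro allI ballI impI)
  fix h B :: real and m
  assume B: "\<forall>t. \<bar>t\<bar> \<le> \<bar>h\<bar> \<longrightarrow> norm (G (matrix_exp (t *\<^sub>R X) *v m) - G m) \<le> B"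
  have "norm (F (matrix_exp ((- h) *\<^sub>R X) *v m) - F (matrix_exp ((- 0) *\<^sub>R X) *v m) - h *\<^sub>R G m) \<le> \<bar>h\<bar> * B"
  proof (rule vector_mean_value)
    show "((\<lambda>t. F (matrix_exp ((- t) *\<^sub>R X) *v m)) has_vector_derivative
        G (matrix_exp ((- t) *\<^sub>R X) *v m)) (at t)" for t
      using flow_has_vector_derivative[OF assms(1), of X m t UNIV] unfolding assms(2) .
    show "norm (G (matrix_exp ((- t) *\<^sub>R X) *v m) - G m) \<le> B" if "\<bar>t\<bar> \<le> \<bar>h\<bar>" for t
      using B[rule_format, of "- t"] that by simp
  qed
  then show "norm (F (matrix_exp ((- h) *\<^sub>R X) *v m) - F m - h *\<^sub>R G m) \<le> \<bar>h\<bar> * B" by simp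
qed

lemma mean_value_pair_limit:
  assumes inv: "\<And>t m. m \<in> M \<Longrightarrow> matrix_exp (t *\<^sub>R X) *v m \<in> M"
    and approx: "\<And>\<epsilon>. \<epsilon> > 0 \<Longrightarrow> \<exists>f g. mean_value_pair M X f g \<and>
      (\<forall>m\<in>M. norm (\<phi> m - f m) \<le> \<epsilon> \<and> norm (\<psi> m - g m) \<le> \<epsilon>)"
  shows "mean_value_pair M X \<phi> \<psi>"
  unfolding mean_value_pair_def
proof (intro allI ballI impI)
  fix h B :: real and m
  assume m: "m \<in> M" and B: "\<forall>t. \<bar>t\<bar> \<le> \<bar>h\<bar> \<longrightarrow> norm (\<psi> (matrix_exp (t *\<^sub>R X) *v m) - \<psi> m) \<le> B"
  let ?E = "\<lambda>t. matrix_exp (t *\<^sub>R X) *v m"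
  show "norm (\<phi> (?E (- h)) - \<phi> m - h *\<^sub>R \<psi> m) \<le> \<bar>h\<bar> * B"
  proof (rule field_le_epsilon)
    fix e :: real assume "e > 0"
    \<comment> \<open>The weights count the errors: \<phi> is replaced by f at two points, the
      oscillation of g exceeds that of \<psi> by 2\<epsilon>, which enters multiplied by |h|, and h
      \<psi>(m) is replaced once.\<close>
    define \<epsilon> where "\<epsilon> = e / (2 + 3 * \<bar>h\<bar>)"
    have \<epsilon>: "\<epsilon> > 0" "\<epsilon> * (2 + 3 * \<bar>h\<bar>) = e"
      using \<open>e > 0\<close> by (auto simp: \<epsilon>_def intro!: divide_pos_pos add_pos_nonneg)
    obtain f g where fg: "mean_value_pair M X f g"
      "\<And>m. m \<in> M \<Longrightarrow> norm (\<phi> m - f m) \<le> \<epsilon>" "\<And>m. m \<in> M \<Longrightarrow> norm (\<psi> m - g m) \<le> \<epsilon>"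
      using approx[OF \<epsilon>(1)] by blast
    have "norm (g (?E t) - g m) \<le> B + 2 * \<epsilon>" if "\<bar>t\<bar> \<le> \<bar>h\<bar>" for t
    proof -
      have "g (?E t) - g m = (\<psi> (?E t) - \<psi> m) - (\<psi> (?E t) - g (?E t)) + (\<psi> m - g m)" by simp
      also have "norm \<dots> \<le> norm (\<psi> (?E t) - \<psi> m) + norm (\<psi> (?E t) - g (?E t)) + norm (\<psi> m - g m)"
        by (intro norm_triangle_le add_right_mono norm_triangle_ineq4)
      also have "\<dots> \<le> B + \<epsilon> + \<epsilon>"
        using B that fg(3)[OF m] fg(3)[OF inv[OF m]] by (intro add_mono) auto
      finally show ?thesis by simp
    qed
    then have mv: "norm (f (?E (- h)) - f m - h *\<^sub>R g m) \<le> \<bar>h\<bar> * (B + 2 * \<epsilon>)"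
      using fg(1) m unfolding mean_value_pair_def by blast
    have "\<phi> (?E (- h)) - \<phi> m - h *\<^sub>R \<psi> m = (f (?E (- h)) - f m - h *\<^sub>R g m) +
        (\<phi> (?E (- h)) - f (?E (- h))) - (\<phi> m - f m) - h *\<^sub>R (\<psi> m - g m)"
      by (simp add: algebra_simps)
    also have "norm \<dots> \<le> norm (f (?E (- h)) - f m - h *\<^sub>R g m) + norm (\<phi> (?E (- h)) - f (?E (- h)))
        + norm (\<phi> m - f m) + norm (h *\<^sub>R (\<psi> m - g m))"
      by (intro order_trans[OF norm_triangle_ineq4] add_right_mono norm_triangle_ineq)
    also have "\<dots> \<le> \<bar>h\<bar> * (B + 2 * \<epsilon>) + \<epsilon> + \<epsilon> + \<bar>h\<bar> * \<epsilon>"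
      using mv fg(2)[OF m] fg(2)[OF inv[OF m]] fg(3)[OF m]
      by (intro add_mono) (auto intro: mult_left_mono simp del: scaleR_minus_left)
    also have "\<dots> = \<bar>h\<bar> * B + \<epsilon> * (2 + 3 * \<bar>h\<bar>)" by (simp add: algebra_simps)
    finally show "norm (\<phi> (?E (- h)) - \<phi> m - h *\<^sub>R \<psi> m) \<le> \<bar>h\<bar> * B + e" using \<epsilon>(2) by simp
  qed
qed

lemma strong_continuity_exp:
  fixes M :: "(real^'n) set"
  assumes "closed M" "\<And>t m. m \<in> M \<Longrightarrow> matrix_exp (t *\<^sub>R X) *v m \<in> M" "c0 M \<phi>" "\<epsilon> > 0"
  obtains \<delta> where "\<delta> > 0" "\<And>t m. \<bar>t\<bar> < \<delta> \<Longrightarrow> m \<in> M \<Longrightarrow>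
    norm (\<phi> (matrix_exp (t *\<^sub>R X) *v m) - \<phi> m) < \<epsilon>"
proof -
  obtain d where d: "d > 0" "\<And>g m. norm (g - mat 1) < d \<Longrightarrow> m \<in> M \<Longrightarrow> g *v m \<in> M \<Longrightarrow>
      norm (\<phi> (g *v m) - \<phi> m) < \<epsilon>"
    using strong_continuity[OF assms(1,3,4)] by blast
  have "continuous_on UNIV (\<lambda>t. matrix_exp (t *\<^sub>R X))" by (intro continuous_intros)
  then have "isCont (\<lambda>t. matrix_exp (t *\<^sub>R X)) 0" by (simp add: continuous_on_eq_continuous_at)
  then obtain \<delta> where "\<delta> > 0" "\<And>t. \<bar>t\<bar> < \<delta> \<Longrightarrow> norm (matrix_exp (t *\<^sub>R X) - mat 1) < d"
    using d(1) unfolding continuous_at_eps_delta by (auto simp: dist_norm)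
  then show ?thesis using that[of \<delta>] d(2) assms(2) by blast
qed

text \<open>Strong continuity bounds the oscillation of \<psi> along short orbits uniformly in m.
  Dividing the mean value inequality by |h| then bounds the error of the difference
  quotient.\<close>

lemma mean_value_pair_generator:
  fixes M :: "(real^'n) set"
  assumes M: "closed M" "\<And>t m. m \<in> M \<Longrightarrow> matrix_exp (t *\<^sub>R X) *v m \<in> M"
    and "\<phi> \<in> mspace (c0_space M)" "\<psi> \<in> mspace (c0_space M)" "mean_value_pair M X \<phi> \<psi>"
  shows "has_generator_value M X \<phi> \<psi>"
proof (subst has_generator_value_iff, rule M(1), erule M(2), rule assms(3), intro conjI assms(4) allI impI)
  fix \<epsilon> :: real assume "\<epsilon> > 0"
  have "c0 M \<psi>" using assms(4) mspace_c0_space[OF M(1)] by blast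
  then obtain \<delta> where \<delta>: "\<delta> > 0" "\<And>t m. \<bar>t\<bar> < \<delta> \<Longrightarrow> m \<in> M \<Longrightarrow>
      norm (\<psi> (matrix_exp (t *\<^sub>R X) *v m) - \<psi> m) < \<epsilon>"
    using strong_continuity_exp[OF M _ \<open>\<epsilon> > 0\<close>] by blast
  show "\<exists>\<delta>>0. \<forall>h. 0 < \<bar>h\<bar> \<and> \<bar>h\<bar> < \<delta> \<longrightarrow>
      (\<forall>m\<in>M. norm ((\<phi> (matrix_exp ((- h) *\<^sub>R X) *v m) - \<phi> m) /\<^sub>R h - \<psi> m) \<le> \<epsilon>)"
  proof (intro exI[of _ \<delta>] conjI \<delta>(1) allI impI ballI)
    fix h m assume h: "0 < \<bar>h\<bar> \<and> \<bar>h\<bar> < \<delta>" and m: "m \<in> M"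
    have "norm (\<psi> (matrix_exp (t *\<^sub>R X) *v m) - \<psi> m) \<le> \<epsilon>" if "\<bar>t\<bar> \<le> \<bar>h\<bar>" for t
      using \<delta>(2)[of t m] h m that by simp
    then have mv: "norm (\<phi> (matrix_exp ((- h) *\<^sub>R X) *v m) - \<phi> m - h *\<^sub>R \<psi> m) \<le> \<bar>h\<bar> * \<epsilon>"
      using assms(5) m unfolding mean_value_pair_def by blast
    have "(\<phi> (matrix_exp ((- h) *\<^sub>R X) *v m) - \<phi> m) /\<^sub>R h - \<psi> m =
        (\<phi> (matrix_exp ((- h) *\<^sub>R X) *v m) - \<phi> m - h *\<^sub>R \<psi> m) /\<^sub>R h"
      using h by (simp add: scaleR_diff_right)
    also have "norm \<dots> = norm (\<phi> (matrix_exp ((- h) *\<^sub>R X) *v m) - \<phi> m - h *\<^sub>R \<psi> m) / \<bar>h\<bar>"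
      by (simp add: divide_inverse mult.commute)
    also have "\<dots> \<le> \<epsilon>" using mv h by (simp add: pos_divide_le_eq mult.commute)
    finally show "norm ((\<phi> (matrix_exp ((- h) *\<^sub>R X) *v m) - \<phi> m) /\<^sub>R h - \<psi> m) \<le> \<epsilon>" .
  qed
qed

lemma mean_value_pair_cong:
  assumes "\<And>t m. m \<in> M \<Longrightarrow> matrix_exp (t *\<^sub>R X) *v m \<in> M"
    "\<And>m. m \<in> M \<Longrightarrow> \<phi> m = \<phi>' m" "\<And>m. m \<in> M \<Longrightarrow> \<psi> m = \<psi>' m"
  shows "mean_value_pair M X \<phi> \<psi> \<longleftrightarrow> mean_value_pair M X \<phi>' \<psi>'"
  unfolding mean_value_pair_def
  by (simp add: assms(2,3) assms(1)[of _ "- _", simplified] assms(1) cong: ball_cong)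

lemma generator_gauss:
  fixes M :: "(real^'n) set"
  assumes M: "closed M" "\<And>t m. m \<in> M \<Longrightarrow> matrix_exp (t *\<^sub>R X) *v m \<in> M"
    and "a > 0" "polynomial_function p" "C1_deriv (gauss a p) F'"
    and G: "\<And>z. - F' z (X *v z) = G z" "c0 M G"
  shows "has_generator_value M X (restrict (gauss a p) M) (restrict G M)"
proof (rule mean_value_pair_generator[OF M])
  show "mean_value_pair M X (restrict (gauss a p) M) (restrict G M)"
    using mean_value_pair_C1[OF assms(5) G(1)]
    by (subst mean_value_pair_cong[where \<phi>'="gauss a p" and \<psi>'=G]) (simp_all add: M(2))
qed (simp_all add: mspace_c0_space[OF M(1)] c0_gauss assms)

section \<open>Density of Gaussian polynomials\<close>

lemma power_fact_le_exp:
  assumes "(y::real) \<ge> 0" shows "y ^ n / fact n \<le> exp y"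
proof -
  have "(\<Sum>k\<in>{n}. y ^ k /\<^sub>R fact k) \<le> (\<Sum>k. y ^ k /\<^sub>R fact k)"
    by (rule sum_le_suminf) (use assms summable_exp_generic[of y] in auto)
  then show ?thesis by (simp add: exp_def divide_inverse mult.commute)
qed

definition exp_poly :: "nat \<Rightarrow> real \<Rightarrow> real" where
  "exp_poly K t = (\<Sum>k<K. t ^ k / fact k)"

text \<open>Writing |t|^K as 2^(-K) (2|t|)^K in the Lagrange remainder trades growth in t for a
  factor that tends to 0 uniformly in t. The price e^(3|t|) is affordable when a stronger Gaussian
  is present.\<close>

lemma exp_poly_tail: "\<bar>exp t - exp_poly K t\<bar> \<le> (1 / 2) ^ K * exp (3 * \<bar>t\<bar>)"
proof -
  obtain u where u: "\<bar>u\<bar> \<le> \<bar>t\<bar>" "exp t = (\<Sum>k<K. t ^ k / fact k) + exp u / fact K * t ^ K"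
    using Maclaurin_exp_le by blast
  have "\<bar>exp t - exp_poly K t\<bar> = exp u * (\<bar>t\<bar> ^ K / fact K)"
    using u(2) by (simp add: exp_poly_def abs_mult power_abs)
  also have "\<bar>t\<bar> ^ K / fact K = (1 / 2) ^ K * ((2 * \<bar>t\<bar>) ^ K / fact K)"
    by (simp add: power_mult_distrib power_divide)
  also have "exp u * ((1 / 2) ^ K * ((2 * \<bar>t\<bar>) ^ K / fact K)) \<le> exp \<bar>t\<bar> * ((1 / 2) ^ K * exp (2 * \<bar>t\<bar>))"
    using u(1) by (intro mult_mono mult_left_mono power_fact_le_exp) auto
  also have "\<dots> = (1 / 2) ^ K * exp (3 * \<bar>t\<bar>)"
    by (simp add: mult_exp_exp)
  finally show ?thesis .
qed

section \<open>Lowering the exponent of a Gaussian\<close>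

lemma real_polynomial_function_exp_poly:
  "real_polynomial_function q \<Longrightarrow> real_polynomial_function (\<lambda>z. exp_poly K (q z))"
  unfolding exp_poly_def
  by (intro real_polynomial_function_sum real_polynomial_function_divide real_polynomial_function_power) auto

lemma exists_half_power_less: "\<epsilon> > 0 \<Longrightarrow> \<exists>K. (1 / 2) ^ K * C < (\<epsilon>::real)"
proof -
  assume \<epsilon>: "\<epsilon> > 0"
  then obtain K where "(1 / 2) ^ K < \<epsilon> / (\<bar>C\<bar> + 1)"
    using real_arch_pow_inv[of "\<epsilon> / (\<bar>C\<bar> + 1)" "1 / 2"] by auto
  then have "(1 / 2) ^ K * (\<bar>C\<bar> + 1) < \<epsilon>" by (simp add: pos_less_divide_eq)
  moreover have "(1 / 2) ^ K * C \<le> (1 / 2 :: real) ^ K * (\<bar>C\<bar> + 1)" by (intro mult_left_mono) auto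
  ultimately show ?thesis by (intro exI[of _ K]) linarith
qed

text \<open>Expand the surplus factor e^(-|z|^2/6). With r = |z|^2 its Taylor error costs e^(r/2)
  and the polynomial e^(r/4), together less than the available e^(-r). A full unit of the exponent
  would cost e^(3r), hence the reduction in steps of 1/6.\<close>

lemma gauss_exponent_step:
  fixes p :: "real^'n \<Rightarrow> complex"
  assumes p: "polynomial_function p" and "b \<ge> 1" "\<epsilon> > 0"
  obtains q where "polynomial_function q" "\<And>z. norm (gauss (b + 1 / 6) p z - gauss b q z) < \<epsilon>"
proof -
  obtain C where C: "C \<ge> 0" "\<And>z. norm (p z) \<le> C * exp (1 / 4 * (z \<bullet> z))"
    using polynomial_function_gauss_bound[OF p, of "1 / 4"] by auto
  obtain K where K: "(1 / 2) ^ K * C < \<epsilon>" using exists_half_power_less[OF assms(3)] by blast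
  define q where "q z = exp_poly K (- (z \<bullet> z) / 6) *\<^sub>R p z" for z
  show ?thesis
  proof (rule that[of q])
    show "polynomial_function q"
      unfolding q_def
      by (intro polynomial_function_mult p real_polynomial_function_eq[THEN iffD1, OF real_polynomial_function_exp_poly]
          real_polynomial_function_divide real_polynomial_function_minus polynomial_function_inner_self
          polynomial_function_id)
    fix z :: "real^'n"
    let ?r = "z \<bullet> z"
    have "gauss (b + 1 / 6) p z - gauss b q z =
        (exp (- b * ?r) * (exp (- ?r / 6) - exp_poly K (- ?r / 6))) *\<^sub>R p z"
      by (simp add: gauss_def q_def algebra_simps exp_add[symmetric])
    also have "norm \<dots> = exp (- b * ?r) * \<bar>exp (- ?r / 6) - exp_poly K (- ?r / 6)\<bar> * norm (p z)"
      by (simp add: abs_mult)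
    also have "\<dots> \<le> exp (- 1 * ?r) * ((1 / 2) ^ K * exp (3 * \<bar>- ?r / 6\<bar>)) * (C * exp (1 / 4 * ?r))"
      using mult_right_mono[OF assms(2), of ?r] by (intro mult_mono exp_poly_tail C(2)) auto
    also have "\<dots> = (1 / 2) ^ K * C * (exp (- ?r) * exp (?r / 2) * exp (?r / 4))"
      by simp
    also have "exp (- ?r) * exp (?r / 2) * exp (?r / 4) = exp (- ?r / 4)"
      unfolding mult_exp_exp by simp
    also have "(1 / 2) ^ K * C * exp (- ?r / 4) \<le> (1 / 2) ^ K * C * 1"
      using C(1) by (intro mult_left_mono) auto
    finally show "norm (gauss (b + 1 / 6) p z - gauss b q z) < \<epsilon>" using K by simp
  qed
qed

lemma gauss_exponent_reduction:
  fixes p :: "real^'n \<Rightarrow> complex"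
  assumes "polynomial_function p" "\<epsilon> > 0"
  shows "\<exists>q. polynomial_function q \<and> (\<forall>z. norm (gauss (1 + real j / 6) p z - gauss 1 q z) < \<epsilon>)"
  using assms
proof (induction j arbitrary: p \<epsilon>)
  case 0
  then show ?case by (intro exI[of _ p]) simp
next
  case (Suc j)
  have e2: "\<epsilon> / 2 > 0" using Suc.prems by simp
  obtain q where q: "polynomial_function q"
    "\<And>z. norm (gauss (1 + real j / 6 + 1 / 6) p z - gauss (1 + real j / 6) q z) < \<epsilon> / 2"
    by (rule gauss_exponent_step[OF Suc.prems(1), of "1 + real j / 6", OF _ e2]) auto
  obtain r where r: "polynomial_function r"
    "\<And>z. norm (gauss (1 + real j / 6) q z - gauss 1 r z) < \<epsilon> / 2"
    using Suc.IH[OF q(1) e2] by blast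
  have "norm (gauss (1 + real (Suc j) / 6) p z - gauss 1 r z) < \<epsilon>" for z
  proof -
    have eq: "1 + real (Suc j) / 6 = 1 + real j / 6 + 1 / 6" by (simp add: add_divide_distrib)
    show ?thesis
      unfolding eq using norm_triangle_lt[OF _ , of "gauss (1 + real j / 6 + 1 / 6) p z - gauss (1 + real j / 6) q z"
          "gauss (1 + real j / 6) q z - gauss 1 r z" \<epsilon>] q(2)[of z] r(2)[of z] by simp
  qed
  then show ?case using r(1) by blast
qed

text \<open>An algebra without unit: exponents add under multiplication and never fall below 1. They
  are integers, so six steps of size 1/6 per unit bring every summand down to exponent 1.\<close>

inductive gauss_sum :: "(real^'n \<Rightarrow> complex) \<Rightarrow> bool" where
  gauss_sum_gauss: "polynomial_function p \<Longrightarrow> gauss_sum (gauss (real (Suc j)) p)"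
| gauss_sum_add: "gauss_sum f \<Longrightarrow> gauss_sum g \<Longrightarrow> gauss_sum (\<lambda>z. f z + g z)"

lemma polynomial_function_complex_mult:
  fixes p q :: "'a::real_normed_vector \<Rightarrow> complex"
  assumes "polynomial_function p" "polynomial_function q"
  shows "polynomial_function (\<lambda>z. p z * q z)"
proof -
  have "real_polynomial_function (\<lambda>z. Re (p z))" "real_polynomial_function (\<lambda>z. Im (p z))"
    "real_polynomial_function (\<lambda>z. Re (q z))" "real_polynomial_function (\<lambda>z. Im (q z))"
    using assms unfolding polynomial_function_iff_Basis_inner Basis_complex_def
    by (auto simp: inner_complex_def)
  then show ?thesis
    unfolding polynomial_function_iff_Basis_inner Basis_complex_def
    by (auto simp: inner_complex_def intro!: real_polynomial_function_diff real_polynomial_function.intros(3,4))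
qed

lemma polynomial_function_of_real:
  "real_polynomial_function p \<Longrightarrow> polynomial_function (\<lambda>z. complex_of_real (p z))"
  unfolding polynomial_function_iff_Basis_inner Basis_complex_def
  by (auto simp: inner_complex_def real_polynomial_function.intros(2))

lemma gauss_sum_mult:
  assumes "gauss_sum f" "gauss_sum g"
  shows "gauss_sum (\<lambda>z. f z * g z)"
  using assms
proof (induction f rule: gauss_sum.induct)
  case (gauss_sum_gauss p i)
  from gauss_sum_gauss(2) show ?case
  proof (induction g rule: gauss_sum.induct)
    case (gauss_sum_gauss q j)
    have "(\<lambda>z. gauss (real (Suc i)) p z * gauss (real (Suc j)) q z) =
        gauss (real (Suc (Suc (i + j)))) (\<lambda>z. p z * q z)"
      by (rule ext) (simp add: gauss_def exp_add[symmetric] algebra_simps)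
    then show ?case
      using polynomial_function_complex_mult[OF \<open>polynomial_function p\<close> \<open>polynomial_function q\<close>]
      by (simp only: gauss_sum.gauss_sum_gauss)
  next
    case (gauss_sum_add f g)
    then show ?case by (simp add: distrib_left gauss_sum.gauss_sum_add)
  qed
next
  case (gauss_sum_add f h)
  then show ?case by (simp add: distrib_right gauss_sum.gauss_sum_add)
qed

lemma gauss_sum_cmult:
  assumes "gauss_sum f"
  shows "gauss_sum (\<lambda>z. c * f z)"
  using assms
proof (induction f rule: gauss_sum.induct)
  case (gauss_sum_gauss p i)
  have "(\<lambda>z. c * gauss (real (Suc i)) p z) = gauss (real (Suc i)) (\<lambda>z. c * p z)"
    by (rule ext) (simp add: gauss_def)
  then show ?case
    using polynomial_function_complex_mult[OF polynomial_function_const \<open>polynomial_function p\<close>, of c]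
    by (simp only: gauss_sum.gauss_sum_gauss)
next
  case (gauss_sum_add f g)
  then show ?case by (simp add: distrib_left gauss_sum.gauss_sum_add)
qed

lemma gauss_sum_approx:
  assumes "gauss_sum f" "\<epsilon> > 0"
  shows "\<exists>q. polynomial_function q \<and> (\<forall>z. norm (f z - gauss 1 q z) < \<epsilon>)"
  using assms
proof (induction f arbitrary: \<epsilon> rule: gauss_sum.induct)
  case (gauss_sum_gauss p i)
  have "real (Suc i) = 1 + real (6 * i) / 6" by simp
  then show ?case using gauss_exponent_reduction[OF gauss_sum_gauss, of "6 * i"] by simp
next
  case (gauss_sum_add f g)
  have e2: "\<epsilon> / 2 > 0" using gauss_sum_add.prems by simp
  obtain q where q: "polynomial_function q" "\<And>z. norm (f z - gauss 1 q z) < \<epsilon> / 2"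
    using gauss_sum_add.IH(1)[OF e2] by blast
  obtain r where r: "polynomial_function r" "\<And>z. norm (g z - gauss 1 r z) < \<epsilon> / 2"
    using gauss_sum_add.IH(2)[OF e2] by blast
  have "norm (f z + g z - gauss 1 (\<lambda>z. q z + r z) z) < \<epsilon>" for z
  proof -
    have eq: "f z + g z - gauss 1 (\<lambda>z. q z + r z) z = (f z - gauss 1 q z) + (g z - gauss 1 r z)"
      by (simp add: gauss_def algebra_simps)
    show ?thesis
      unfolding eq by (rule norm_triangle_lt) (use q(2)[of z] r(2)[of z] in linarith)
  qed
  then show ?case using q(1) r(1) by (intro exI[of _ "\<lambda>z. q z + r z"]) auto
qed

text \<open>
  The map \<open>z \<mapsto> (e\<^bsup>-|z|\<^sup>2\<^esup> z, e\<^bsup>-|z|\<^sup>2\<^esup>)\<close> compactifies \<open>M\<close> by the point \<open>0\<close>. Polynomials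
  without constant term pull back along it to sums of polynomials times \<open>e\<^bsup>-j|z|\<^sup>2\<^esup>\<close>, \<open>j \<ge> 1\<close>,
  so that the Stone-Weierstrass theorem applies.
\<close>

definition compactify :: "real^'n \<Rightarrow> (real^'n) \<times> real" where
  "compactify z = (exp (- (z \<bullet> z)) *\<^sub>R z, exp (- (z \<bullet> z)))"

lemma gauss_sum_real_polynomial:
  assumes "real_polynomial_function q"
  shows "gauss_sum (\<lambda>z. complex_of_real (q (compactify z) - q 0))"
  using assms
proof (induction q rule: real_polynomial_function.induct)
  case (linear f)
  interpret bounded_linear f by fact
  have "f (compactify z) = exp (- (z \<bullet> z)) * f (z, 1)" for z
    using scale[of "exp (- (z \<bullet> z))" "(z, 1)"] by (simp add: compactify_def)
  then have eq: "(\<lambda>z. complex_of_real (f (compactify z) - f 0)) = gauss (real (Suc 0)) (\<lambda>z. complex_of_real (f (z, 1)))"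
    by (auto simp: gauss_def zero scaleR_conv_of_real)
  have "(\<lambda>z. f (z, 1)) = (\<lambda>z. f (z, 0) + f (0, 1))"
    by (simp add: add[symmetric])
  moreover have "bounded_linear (\<lambda>z. f (z, 0))"
    by (rule bounded_linear_compose[OF bounded_linear_axioms])
      (rule bounded_linear_Pair[OF bounded_linear_ident bounded_linear_zero])
  ultimately have "real_polynomial_function (\<lambda>z. f (z, 1))"
    by (simp add: real_polynomial_function.intros)
  then show ?case
    unfolding eq by (intro gauss_sum.intros polynomial_function_of_real)
next
  case (const c)
  have eq: "(\<lambda>z. complex_of_real (c - c)) = gauss (real (Suc 0)) (\<lambda>z. 0)"
    by (simp add: gauss_def fun_eq_iff)
  show ?case unfolding eq by (intro gauss_sum.intros polynomial_function_const)
next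
  case (add f g)
  from gauss_sum_add[OF add.IH] show ?case by (simp add: algebra_simps)
next
  case (mult f g)
  \<comment> \<open>The identity fg - f(0)g(0) = (f - f(0))(g - g(0)) + g(0)(f - f(0)) + f(0)(g -
    g(0)) keeps every summand free of a constant term.\<close>
  from gauss_sum_add[OF gauss_sum_mult[OF mult.IH]
      gauss_sum_add[OF gauss_sum_cmult[OF mult.IH(1), of "complex_of_real (g 0)"]
        gauss_sum_cmult[OF mult.IH(2), of "complex_of_real (f 0)"]]]
  show ?case by (simp add: algebra_simps)
qed

lemma gauss_sum_polynomial:
  assumes "polynomial_function (q :: (real^'n) \<times> real \<Rightarrow> complex)"
  shows "gauss_sum (\<lambda>z. q (compactify z) - q 0)"
proof -
  have "real_polynomial_function (\<lambda>z. Re (q z))" "real_polynomial_function (\<lambda>z. Im (q z))"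
    using assms unfolding polynomial_function_iff_Basis_inner Basis_complex_def
    by (auto simp: inner_complex_def)
  from gauss_sum_add[OF gauss_sum_real_polynomial[OF this(1)]
      gauss_sum_cmult[OF gauss_sum_real_polynomial[OF this(2)], of \<i>]]
  have "gauss_sum (\<lambda>z. complex_of_real (Re (q (compactify z)) - Re (q 0)) +
      \<i> * complex_of_real (Im (q (compactify z)) - Im (q 0)))" .
  also have "(\<lambda>z. complex_of_real (Re (q (compactify z)) - Re (q 0)) +
      \<i> * complex_of_real (Im (q (compactify z)) - Im (q 0))) = (\<lambda>z. q (compactify z) - q 0)"
    by (auto simp: complex_eq_iff)
  finally show ?thesis .
qed

text \<open>From |z| \<le> 1 + |z|^2/2 \<le> e^(|z|^2/2). In the coordinates (v, s) of the image it
  reads |v| \<le> sqrt s, so an image sequence with s \<rightarrow> 0 can converge only to the added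
  point.\<close>

lemma norm_compactify_le: "norm (exp (- (z \<bullet> z)) *\<^sub>R z) \<le> sqrt (exp (- (z \<bullet> z)))"
proof -
  have "norm z \<le> 1 + (z \<bullet> z) / 2"
    using zero_le_power2[of "norm z - 1"] by (simp add: dot_square_norm power2_eq_square algebra_simps)
  also have "\<dots> \<le> exp ((z \<bullet> z) / 2)" by (rule exp_ge_add_one_self)
  finally have "exp (- (z \<bullet> z)) * norm z \<le> exp (- (z \<bullet> z)) * exp ((z \<bullet> z) / 2)" by simp
  also have "\<dots> = exp (- (z \<bullet> z) / 2)" unfolding mult_exp_exp by simp
  also have "\<dots> = sqrt (exp (- (z \<bullet> z)))"
    by (rule real_sqrt_unique[symmetric]) (simp_all flip: exp_double)
  finally show ?thesis by simp
qed

text \<open>Let (v, s) be the limit of a sequence. If s = 0, then v = 0 by the previous estimate; if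
  s > 0, the preimages are recovered as v_n / s_n and converge in M because M is closed.\<close>

lemma compact_compactify:
  fixes M :: "(real^'n) set"
  assumes "closed M"
  shows "compact (insert 0 (compactify ` M))"
  unfolding compact_eq_bounded_closed
proof
  have "norm (compactify z) \<le> 2" for z :: "real^'n"
  proof -
    have "norm (compactify z) \<le> norm (exp (- (z \<bullet> z)) *\<^sub>R z) + norm (exp (- (z \<bullet> z)))"
      unfolding compactify_def by (rule norm_Pair_le)
    also have "\<dots> \<le> sqrt (exp (- (z \<bullet> z))) + exp (- (z \<bullet> z))"
      using norm_compactify_le[of z] by simp
    also have "\<dots> \<le> 1 + 1" by (intro add_mono) auto
    finally show ?thesis by simp
  qed
  then show "bounded (insert 0 (compactify ` M))"
    by (auto intro!: boundedI[of _ 2])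
  show "closed (insert 0 (compactify ` M))"
    unfolding closed_sequential_limits
  proof (intro allI impI, elim conjE)
    fix x l assume x: "\<forall>n. x n \<in> insert 0 (compactify ` M)" and lim: "x \<longlonglongrightarrow> l"
    obtain v s where l: "l = (v, s)" by (cases l)
    have lim1: "(\<lambda>n. fst (x n)) \<longlonglongrightarrow> v" and lim2: "(\<lambda>n. snd (x n)) \<longlonglongrightarrow> s"
      using tendsto_fst[OF lim] tendsto_snd[OF lim] l by auto
    have snd_nonneg: "snd (x n) \<ge> 0" and fst_le: "norm (fst (x n)) \<le> sqrt (snd (x n))" for n
      using x[rule_format, of n] norm_compactify_le by (auto simp: compactify_def)
    have "s \<ge> 0" using lim2 snd_nonneg by (intro LIMSEQ_le_const) auto
    show "l \<in> insert 0 (compactify ` M)"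
    proof (cases "s = 0")
      case True
      have "norm v \<le> sqrt s"
        using tendsto_norm[OF lim1] tendsto_real_sqrt[OF lim2] fst_le by (intro LIMSEQ_le) auto
      then show ?thesis using True l by (simp add: zero_prod_def)
    next
      case False
      then have "s > 0" using \<open>s \<ge> 0\<close> by simp
      define m where "m n = fst (x n) /\<^sub>R snd (x n)" for n
      have m_lim: "m \<longlonglongrightarrow> v /\<^sub>R s"
        unfolding m_def using lim1 lim2 False by (intro tendsto_scaleR tendsto_inverse) auto
      have ev: "\<forall>\<^sub>F n in sequentially. m n \<in> M \<and> snd (x n) = exp (- (m n \<bullet> m n))"
        using order_tendstoD(1)[OF lim2 \<open>s > 0\<close>]
      proof eventually_elim
        case (elim n)
        then have "x n \<noteq> 0" by auto
        then obtain z where "z \<in> M" "x n = compactify z" using x by blast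
        then show ?case by (simp add: m_def compactify_def)
      qed
      have "v /\<^sub>R s \<in> M"
        using Lim_in_closed_set[OF assms _ _ m_lim] ev by (simp add: eventually_conj_iff)
      moreover have "(\<lambda>n. exp (- (m n \<bullet> m n))) \<longlonglongrightarrow> exp (- ((v /\<^sub>R s) \<bullet> (v /\<^sub>R s)))"
        by (intro tendsto_intros m_lim)
      then have "(\<lambda>n. snd (x n)) \<longlonglongrightarrow> exp (- ((v /\<^sub>R s) \<bullet> (v /\<^sub>R s)))"
        by (rule Lim_transform_eventually) (use ev in \<open>auto elim: eventually_mono\<close>)
      then have "s = exp (- ((v /\<^sub>R s) \<bullet> (v /\<^sub>R s)))"
        using LIMSEQ_unique lim2 by blast
      then have "l = compactify (v /\<^sub>R s)"
        using False unfolding l compactify_def by (metis divideR_right scaleR_one)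
      ultimately show ?thesis by blast
    qed
  qed
qed

text \<open>Transported to the compactification and extended by 0, \<phi> becomes a function
  \<open>H\<close> whose continuity at the added point is exactly the decay of \<phi>. A polynomial
  close to \<open>H\<close>, minus its constant term, pulls back to a
  \<open>gauss_sum\<close>.\<close>

lemma gauss_dense:
  fixes M :: "(real^'n) set"
  assumes M: "closed M" and \<phi>: "c0 M \<phi>" and "\<epsilon> > 0"
  obtains p where "polynomial_function p" "\<And>m. m \<in> M \<Longrightarrow> norm (\<phi> m - gauss 1 p m) < \<epsilon>"
proof -
  let ?K = "insert 0 (compactify ` M)"
  define H where "H x = (if snd x > 0 then \<phi> (fst x /\<^sub>R snd x) else 0)" for x :: "(real^'n) \<times> real"
  have H: "H (compactify m) = \<phi> m" for m by (simp add: H_def compactify_def)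
  have H0: "H 0 = 0" by (simp add: H_def)
  have "continuous_on ?K H"
    unfolding continuous_on_def
  proof
    fix x assume x: "x \<in> ?K"
    show "(H \<longlongrightarrow> H x) (at x within ?K)"
    proof (cases "x = 0")
      case True
      show ?thesis
        unfolding True H0 tendsto_iff
      proof (intro allI impI)
        fix e :: real assume "e > 0"
        then obtain R where R: "\<And>m. m \<in> M \<Longrightarrow> norm m > R \<Longrightarrow> norm (\<phi> m) < e"
          using \<phi> unfolding c0_def by meson
        show "\<forall>\<^sub>F y in at 0 within ?K. dist (H y) 0 < e"
          unfolding eventually_at
        proof (intro exI[of _ "exp (- (R * R))"] conjI ballI impI)
          fix y assume y: "y \<in> ?K" "y \<noteq> 0 \<and> dist y 0 < exp (- (R * R))"
          then obtain m where m: "m \<in> M" "y = compactify m" by auto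
          have "exp (- (m \<bullet> m)) \<le> norm y"
            using norm_snd_le[of "exp (- (m \<bullet> m))" "exp (- (m \<bullet> m)) *\<^sub>R m"] by (simp add: m(2) compactify_def)
          also have "norm y < exp (- (R * R))" using y(2) by simp
          finally have "R * R < norm m * norm m" by (simp add: dot_square_norm power2_eq_square)
          then have "norm m > R"
            by (smt (verit) mult_mono norm_ge_zero)
          then show "dist (H y) 0 < e" using R m by (simp add: H)
        qed simp
      qed
    next
      case False
      then obtain z where z: "z \<in> M" "x = compactify z" using x by blast
      have pos: "snd x > 0" by (simp add: z(2) compactify_def)
      have lim: "((\<lambda>y. fst y /\<^sub>R snd y) \<longlongrightarrow> fst x /\<^sub>R snd x) (at x within ?K)"
        using pos by (intro tendsto_intros) auto
      have lim2: "((\<lambda>y. snd y) \<longlongrightarrow> snd x) (at x within ?K)"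
        by (intro tendsto_intros)
      have ev: "\<forall>\<^sub>F y in at x within ?K. snd y > 0 \<and> fst y /\<^sub>R snd y \<in> M"
      proof -
        have "\<forall>\<^sub>F y in at x within ?K. y \<in> ?K" by (auto simp: eventually_at_filter)
        with order_tendstoD(1)[OF lim2 pos] show ?thesis
          by eventually_elim (auto simp: compactify_def)
      qed
      have "((\<lambda>y. \<phi> (fst y /\<^sub>R snd y)) \<longlongrightarrow> \<phi> (fst x /\<^sub>R snd x)) (at x within ?K)"
        using \<phi> z ev by (intro continuous_on_tendsto_compose[OF _ lim])
          (auto simp: c0_def compactify_def elim: eventually_mono)
      then have "(H \<longlongrightarrow> \<phi> (fst x /\<^sub>R snd x)) (at x within ?K)"
        by (rule Lim_transform_eventually) (use ev in \<open>auto simp: H_def elim: eventually_mono\<close>)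
      then show ?thesis using pos by (simp add: H_def)
    qed
  qed
  moreover have "\<epsilon> / 4 > 0" using assms(3) by simp
  ultimately obtain q where q: "polynomial_function q" "\<And>x. x \<in> ?K \<Longrightarrow> norm (H x - q x) < \<epsilon> / 4"
    using Stone_Weierstrass_polynomial_function[OF compact_compactify[OF M]] by metis
  obtain p where p: "polynomial_function p" "\<And>z. norm (q (compactify z) - q 0 - gauss 1 p z) < \<epsilon> / 4"
    using gauss_sum_approx[OF gauss_sum_polynomial[OF q(1)], of "\<epsilon> / 4"] assms(3) by auto
  show ?thesis
  proof (rule that[OF p(1)])
    fix m assume m: "m \<in> M"
    \<comment> \<open>As \<open>H 0 = 0\<close>, the discarded constant \<open>q 0\<close> is itself
      smaller than \<epsilon>/4; the other two errors come from Stone-Weierstrass and from the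
      reduction of the exponents.\<close>
    have "\<phi> m - gauss 1 p m = (H (compactify m) - q (compactify m)) - (H 0 - q 0) +
        (q (compactify m) - q 0 - gauss 1 p m)"
      by (simp add: H H0)
    also have "norm \<dots> \<le> norm (H (compactify m) - q (compactify m)) + norm (H 0 - q 0) +
        norm (q (compactify m) - q 0 - gauss 1 p m)"
      by (intro norm_triangle_le add_right_mono norm_triangle_ineq4)
    also have "\<dots> < \<epsilon> / 4 + \<epsilon> / 4 + \<epsilon> / 4"
      using m by (intro add_strict_mono q(2) p(2)) auto
    finally show "norm (\<phi> m - gauss 1 p m) < \<epsilon>" using assms(3) by simp
  qed
qed

section \<open>Averages of Gaussian polynomials\<close>

text \<open>Finite sums of products c(y) p(z). Integrating such a function over y leaves a
  polynomial in z, and no degrees or coefficients have to be tracked.\<close>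

inductive param_poly :: "(real^'m \<Rightarrow> real^'n \<Rightarrow> complex) \<Rightarrow> bool" where
  param_poly_prod: "continuous_on UNIV c \<Longrightarrow> polynomial_function p \<Longrightarrow> param_poly (\<lambda>y z. c y *\<^sub>R p z)"
| param_poly_add: "param_poly f \<Longrightarrow> param_poly g \<Longrightarrow> param_poly (\<lambda>y z. f y z + g y z)"

lemma param_poly_mult:
  assumes "param_poly f" "param_poly g"
  shows "param_poly (\<lambda>y z. f y z * g y z)"
  using assms
proof (induction f rule: param_poly.induct)
  case (param_poly_prod c p)
  from param_poly_prod(3) show ?case
  proof (induction g rule: param_poly.induct)
    case (param_poly_prod d q)
    have eq: "(\<lambda>y z. (c y *\<^sub>R p z) * (d y *\<^sub>R q z)) = (\<lambda>y z. (c y * d y) *\<^sub>R (p z * q z))"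
      by (simp add: fun_eq_iff)
    show ?case
      unfolding eq using \<open>continuous_on UNIV c\<close> \<open>continuous_on UNIV d\<close>
        \<open>polynomial_function p\<close> \<open>polynomial_function q\<close>
      by (intro param_poly.param_poly_prod continuous_on_mult polynomial_function_complex_mult)
  next
    case (param_poly_add f g)
    then show ?case by (simp add: distrib_left param_poly.param_poly_add)
  qed
next
  case (param_poly_add f h)
  then show ?case by (simp add: distrib_right param_poly.param_poly_add)
qed

lemma param_poly_polynomial: "polynomial_function p \<Longrightarrow> param_poly (\<lambda>y. p)"
  using param_poly_prod[OF continuous_on_const, of p 1] by simp

lemma param_poly_sum:
  "(\<And>i. i \<in> I \<Longrightarrow> param_poly (f i)) \<Longrightarrow> param_poly (\<lambda>y z. \<Sum>i\<in>I. f i y z)"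
proof (induction I rule: infinite_finite_induct)
  case (insert x F)
  then show ?case by (simp add: param_poly_add)
qed (simp_all add: param_poly_polynomial)

lemma param_poly_power: "param_poly f \<Longrightarrow> param_poly (\<lambda>y z. f y z ^ k)"
  by (induction k) (simp_all add: param_poly_polynomial param_poly_mult)

lemma param_poly_cmult: "param_poly f \<Longrightarrow> param_poly (\<lambda>y z. c * f y z)"
  by (rule param_poly_mult[OF param_poly_polynomial]) auto

lemma param_poly_exp_poly:
  assumes "param_poly (\<lambda>y z. complex_of_real (f y z))"
  shows "param_poly (\<lambda>y z. complex_of_real (exp_poly K (f y z)))"
proof -
  have eq: "(\<lambda>y z. complex_of_real (exp_poly K (f y z))) =
      (\<lambda>y z. \<Sum>k<K. (1 / fact k) * complex_of_real (f y z) ^ k)"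
    by (simp add: fun_eq_iff exp_poly_def)
  show ?thesis
    unfolding eq by (intro param_poly_sum param_poly_cmult param_poly_power assms)
qed

lemma param_poly_real_compose:
  fixes u :: "real^'m \<Rightarrow> real^'n^'n"
  assumes "real_polynomial_function q" and u: "continuous_on UNIV u"
  shows "param_poly (\<lambda>y z. complex_of_real (q (u y *v z)))"
  using assms(1)
proof (induction q rule: real_polynomial_function.induct)
  case (linear f)
  interpret bounded_linear f by fact
  have u_z: "u y *v z = (\<Sum>j\<in>UNIV. z $ j *\<^sub>R (u y *v axis j 1))" for y z
  proof -
    have "z = (\<Sum>j\<in>UNIV. z $ j *\<^sub>R axis j 1)"
      by (simp only: basis_expansion flip: scalar_mult_eq_scaleR)
    then have "u y *v z = u y *v (\<Sum>j\<in>UNIV. z $ j *\<^sub>R axis j 1)" by (rule arg_cong)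
    then show ?thesis by (simp add: matvec.sum_right matvec.scaleR_right)
  qed
  have f_u_z: "f (u y *v z) = (\<Sum>j\<in>UNIV. z $ j * f (u y *v axis j 1))" for y z
    unfolding arg_cong[OF u_z, of f y z] by (simp add: sum scaleR)
  have eq: "(\<lambda>y z. complex_of_real (f (u y *v z))) =
      (\<lambda>y z. \<Sum>j\<in>UNIV. f (u y *v axis j 1) *\<^sub>R complex_of_real (z $ j))"
  proof (intro ext)
    fix y z
    show "complex_of_real (f (u y *v z)) = (\<Sum>j\<in>UNIV. f (u y *v axis j 1) *\<^sub>R complex_of_real (z $ j))"
      unfolding f_u_z[of y z] by (simp add: scaleR_conv_of_real mult.commute)
  qed
  have "continuous_on UNIV (\<lambda>y. f (u y *v axis j 1))" for j
    by (intro continuous_on matvec.continuous_on u continuous_on_const)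
  moreover have "polynomial_function (\<lambda>z::real^'n. complex_of_real (z $ j))" for j
    by (intro polynomial_function_of_real real_polynomial_function.intros(1) bounded_linear_vec_nth)
  ultimately show ?case
    unfolding eq by (intro param_poly_sum param_poly_prod)
next
  case (const c)
  show ?case by (intro param_poly_polynomial polynomial_function_const)
next
  case (add f g)
  then show ?case by (simp add: param_poly_add)
next
  case (mult f g)
  then show ?case by (simp add: param_poly_mult)
qed

lemma param_poly_compose:
  fixes u :: "real^'m \<Rightarrow> real^'n^'n" and p :: "real^'n \<Rightarrow> complex"
  assumes "polynomial_function p" and u: "continuous_on UNIV u"
  shows "param_poly (\<lambda>y z. p (u y *v z))"
proof -
  have re: "real_polynomial_function (\<lambda>z. Re (p z))" "real_polynomial_function (\<lambda>z. Im (p z))"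
    using assms unfolding polynomial_function_iff_Basis_inner Basis_complex_def
    by (auto simp: inner_complex_def)
  have eq: "(\<lambda>y z. p (u y *v z)) =
      (\<lambda>y z. complex_of_real (Re (p (u y *v z))) + \<i> * complex_of_real (Im (p (u y *v z))))"
    by (simp add: fun_eq_iff complex_eq_iff)
  show ?thesis
    unfolding eq by (intro param_poly_add param_poly_cmult param_poly_real_compose[OF re(1) u]
        param_poly_real_compose[OF re(2) u])
qed

lemma param_poly_continuous: "param_poly f \<Longrightarrow> continuous_on UNIV (\<lambda>y. f y z)"
  by (induction f rule: param_poly.induct) (auto intro: continuous_intros)

lemma param_poly_integral:
  fixes f :: "real^'m \<Rightarrow> real^'n \<Rightarrow> complex"
  assumes "param_poly f" and \<kappa>: "continuous_on UNIV \<kappa>"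
  shows "polynomial_function (\<lambda>z. integral big_box (\<lambda>y. \<kappa> y *\<^sub>R f y z))"
  using assms(1)
proof (induction f rule: param_poly.induct)
  case (param_poly_prod c p)
  have "(\<lambda>z. integral big_box (\<lambda>y. \<kappa> y *\<^sub>R c y *\<^sub>R p z)) = (\<lambda>z. integral big_box (\<lambda>y. \<kappa> y * c y) *\<^sub>R p z)"
  proof
    fix z
    have "(\<lambda>y. \<kappa> y * c y) integrable_on big_box"
      by (intro continuous_integrable_big_box continuous_on_mult \<kappa> param_poly_prod)
    then show "integral big_box (\<lambda>y. \<kappa> y *\<^sub>R c y *\<^sub>R p z) = integral big_box (\<lambda>y. \<kappa> y * c y) *\<^sub>R p z"
      using integral_linear[OF _ bounded_linear_scaleR_left, of "\<lambda>y. \<kappa> y * c y" big_box "p z"]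
      by (simp add: o_def)
  qed
  then show ?case using param_poly_prod by auto
next
  case (param_poly_add f g)
  have "(\<lambda>y. \<kappa> y *\<^sub>R h y z) integrable_on big_box" if "param_poly h" for h z
    by (intro continuous_integrable_big_box continuous_on_scaleR \<kappa> param_poly_continuous that)
  from integral_add[OF this[OF param_poly_add(1)] this[OF param_poly_add(2)]]
  have "(\<lambda>z. integral big_box (\<lambda>y. \<kappa> y *\<^sub>R (f y z + g y z))) =
      (\<lambda>z. integral big_box (\<lambda>y. \<kappa> y *\<^sub>R f y z) + integral big_box (\<lambda>y. \<kappa> y *\<^sub>R g y z))"
    by (simp only: scaleR_add_right)
  then show ?case
    using param_poly_add(3,4) by (simp only: polynomial_function_add)
qed

text \<open>The kernel is a parameter because partial integration changes nothing else: T d\<pi>(X)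
  and the commutator are averages along the same \<open>u\<close> with other kernels.\<close>

definition average ::
  "(real^'m \<Rightarrow> real) \<Rightarrow> (real^'m \<Rightarrow> real^'n^'n) \<Rightarrow> (real^'n \<Rightarrow> complex) \<Rightarrow> real^'n \<Rightarrow> complex" where
  "average \<kappa> u \<phi> z = integral big_box (\<lambda>y. \<kappa> y *\<^sub>R \<phi> (u y *v z))"

lemma leibniz_flow:
  fixes \<Phi> :: "real^'m \<Rightarrow> real^'n \<Rightarrow> complex"
  assumes \<Phi>: "\<And>y. C1_deriv (\<Phi> y) (\<Phi>' y)" "\<And>z. continuous_on UNIV (\<lambda>y. \<Phi> y z)"
    and cont: "continuous_on UNIV (\<lambda>(y, z). \<Phi>' y z (X *v z))"
  shows "((\<lambda>t. integral big_box (\<lambda>y. \<Phi> y (matrix_exp ((- t) *\<^sub>R X) *v z))) has_vector_derivative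
    integral big_box (\<lambda>y. - \<Phi>' y (matrix_exp ((- t) *\<^sub>R X) *v z) (X *v (matrix_exp ((- t) *\<^sub>R X) *v z)))) (at t)"
  unfolding big_box_def
proof (rule leibniz_rule_vector_derivative[where U = UNIV])
  show "((\<lambda>t. \<Phi> y (matrix_exp ((- t) *\<^sub>R X) *v z)) has_vector_derivative
      - \<Phi>' y (matrix_exp ((- t) *\<^sub>R X) *v z) (X *v (matrix_exp ((- t) *\<^sub>R X) *v z))) (at t within UNIV)" for t y
    by (rule flow_has_vector_derivative[OF \<Phi>(1)])
  show "(\<lambda>y. \<Phi> y (matrix_exp ((- t) *\<^sub>R X) *v z)) integrable_on cbox (- 2 *\<^sub>R One) (2 *\<^sub>R One)" for t
    using continuous_integrable_big_box[OF \<Phi>(2)] by (simp add: big_box_def)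
  have "continuous_on (UNIV \<times> cbox (- 2 *\<^sub>R One) (2 *\<^sub>R One))
      (\<lambda>s::real \<times> (real^'m). (snd s, matrix_exp ((- fst s) *\<^sub>R X) *v z))"
    by (intro continuous_on_Pair continuous_on_snd continuous_on_fst continuous_on_id matvec.continuous_on
        continuous_on_matrix_exp continuous_on_minus continuous_on_const)
  from continuous_on_minus[OF continuous_on_compose2[OF cont this]]
  show "continuous_on (UNIV \<times> cbox (- 2 *\<^sub>R One) (2 *\<^sub>R One)) (\<lambda>(t, y).
      - \<Phi>' y (matrix_exp ((- t) *\<^sub>R X) *v z) (X *v (matrix_exp ((- t) *\<^sub>R X) *v z)))"
    by (simp add: case_prod_unfold)
qed auto

section \<open>Taylor approximation of a transported Gaussian polynomial\<close>

lemma C1_deriv_matrix_compose: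
  assumes "C1_deriv F F'"
  shows "C1_deriv (\<lambda>z. F ((A::real^'n^'n) *v z)) (\<lambda>z v. F' (A *v z) (A *v v))"
  using C1_deriv_compose[OF assms C1_deriv_bounded_linear[OF matvec.bounded_linear_right]] .

lemma C1_deriv_cmult: "C1_deriv F F' \<Longrightarrow> C1_deriv (\<lambda>z. (r::real) *\<^sub>R F z) (\<lambda>z v. r *\<^sub>R F' z v)"
  using C1_deriv_bilinear[OF bounded_bilinear_scaleR C1_deriv_const] by fastforce

lemma exp_poly_has_derivative:
  "(exp_poly (Suc K) has_real_derivative exp_poly K t) (at t)"
proof (induction K)
  case 0
  show ?case by (simp add: exp_poly_def)
next
  case (Suc K)
  have "((\<lambda>t. t ^ Suc K / fact (Suc K)) has_real_derivative t ^ K / fact K) (at t)"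
    by (auto intro!: derivative_eq_intros simp: field_simps simp del: power_Suc of_nat_Suc)
  from DERIV_add[OF Suc this] show ?case
    by (simp add: exp_poly_def[abs_def])
qed

lemma C1_deriv_exp_poly: "C1_deriv (exp_poly (Suc K)) (\<lambda>t v. exp_poly K t * v)"
  by (rule C1_derivI)
    (use exp_poly_has_derivative[unfolded has_field_derivative_def]
     in \<open>auto simp: exp_poly_def intro!: continuous_intros\<close>)

lemma C1_deriv_inner_self:
  "C1_deriv (\<lambda>z::'a::euclidean_space. z \<bullet> z) (\<lambda>z v. 2 * (z \<bullet> v))"
  by (rule C1_derivI) (auto intro!: derivative_eq_intros continuous_intros simp: inner_commute)

text \<open>
  With \<open>q(z) = |A z|\<^sup>2 - |z|\<^sup>2\<close>, replace \<open>p(A z) e\<^bsup>-|A z|\<^sup>2\<^esup> = p(A z) e\<^bsup>-q(z)\<^esup> e\<^bsup>-|z|\<^sup>2\<^esup>\<close> by the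
  Gaussian polynomial obtained from a Taylor polynomial of the factor \<open>e\<^bsup>-q(z)\<^esup>\<close>.
\<close>

definition quad_defect :: "real^'n^'n \<Rightarrow> real^'n \<Rightarrow> real" where
  "quad_defect A z = (A *v z) \<bullet> (A *v z) - z \<bullet> z"

definition gauss_taylor :: "nat \<Rightarrow> (real^'n \<Rightarrow> complex) \<Rightarrow> real^'n^'n \<Rightarrow> real^'n \<Rightarrow> complex" where
  "gauss_taylor K p A = gauss 1 (\<lambda>z. exp_poly K (- quad_defect A z) *\<^sub>R p (A *v z))"

text \<open>The derivative of \<open>gauss_taylor (Suc K) p A\<close>; the index is shifted because
  differentiating \<open>exp_poly (Suc K)\<close> gives \<open>exp_poly K\<close>, so both
  truncations occur.\<close>

definition gauss_taylor_deriv ::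
  "nat \<Rightarrow> (real^'n \<Rightarrow> complex) \<Rightarrow> (real^'n \<Rightarrow> real^'n \<Rightarrow> complex) \<Rightarrow> real^'n^'n \<Rightarrow> real^'n \<Rightarrow> real^'n \<Rightarrow> complex" where
  "gauss_taylor_deriv K p p' A z v = exp (- (z \<bullet> z)) *\<^sub>R
     (exp_poly (Suc K) (- quad_defect A z) *\<^sub>R (p' (A *v z) (A *v v) - (2 * (z \<bullet> v)) *\<^sub>R p (A *v z))
      - (exp_poly K (- quad_defect A z) * (2 * ((A *v z) \<bullet> (A *v v)) - 2 * (z \<bullet> v))) *\<^sub>R p (A *v z))"

lemma C1_deriv_quad_defect:
  "C1_deriv (quad_defect A) (\<lambda>z v. 2 * ((A *v z) \<bullet> (A *v v)) - 2 * (z \<bullet> v))"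
  unfolding quad_defect_def[abs_def]
  using C1_deriv_add[OF C1_deriv_matrix_compose[OF C1_deriv_inner_self, of A]
      C1_deriv_cmult[OF C1_deriv_inner_self, of "- 1"]]
  by simp

lemma C1_deriv_gauss_taylor:
  assumes p: "C1_deriv p p'"
  shows "C1_deriv (gauss_taylor (Suc K) p A) (gauss_taylor_deriv K p p' A)"
proof -
  have "C1_deriv (\<lambda>z. - quad_defect A z) (\<lambda>z v. - (2 * ((A *v z) \<bullet> (A *v v)) - 2 * (z \<bullet> v)))"
    using C1_deriv_cmult[OF C1_deriv_quad_defect, of "- 1" A] by simp
  from C1_deriv_compose[OF C1_deriv_exp_poly this]
  have "C1_deriv (\<lambda>z. exp_poly (Suc K) (- quad_defect A z))
    (\<lambda>z v. exp_poly K (- quad_defect A z) * - (2 * ((A *v z) \<bullet> (A *v v)) - 2 * (z \<bullet> v)))" .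
  from C1_deriv_gauss[OF C1_deriv_bilinear[OF bounded_bilinear_scaleR this C1_deriv_matrix_compose[OF p, of A]], of 1]
  show ?thesis
    unfolding gauss_taylor_def gauss_taylor_deriv_def[abs_def] by (simp add: algebra_simps)
qed

lemma continuous_gauss_taylor_deriv:
  fixes u :: "real^'m \<Rightarrow> real^'n^'n"
  assumes p: "C1_deriv p p'" and u: "continuous_on UNIV u"
  shows "continuous_on UNIV (\<lambda>(y, z). gauss_taylor_deriv K p p' (u y) z (X *v z))"
proof -
  have [continuous_intros]: "continuous_on UNIV (\<lambda>s::(real^'m) \<times> (real^'n). u (fst s) *v f s)"
    if "continuous_on UNIV f" for f :: "_ \<Rightarrow> real^'n"
    by (intro matvec.continuous_on that continuous_on_compose2[OF u] continuous_on_fst continuous_on_id) auto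
  have [continuous_intros]: "continuous_on UNIV (\<lambda>s::(real^'m) \<times> (real^'n). X *v f s)"
    if "continuous_on UNIV f" for f :: "_ \<Rightarrow> real^'n"
    by (intro matvec.continuous_on that continuous_on_const)
  have [continuous_intros]: "continuous_on UNIV (\<lambda>s::(real^'m) \<times> (real^'n). exp_poly j (f s))"
    if "continuous_on UNIV f" for f :: "_ \<Rightarrow> real" and j
    unfolding exp_poly_def by (intro continuous_intros that) simp
  have [continuous_intros]: "continuous_on UNIV (\<lambda>s::(real^'m) \<times> (real^'n). p (f s))"
    if "continuous_on UNIV f" for f :: "_ \<Rightarrow> real^'n"
    by (intro continuous_on_compose2[OF C1_deriv_continuous[OF p, of UNIV]] that) auto
  note [continuous_intros] = C1_deriv_continuous_joint[OF p]
  show ?thesis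
    unfolding gauss_taylor_deriv_def quad_defect_def case_prod_unfold
    by (intro continuous_intros)
qed

text \<open>After truncation the only exponential left is e^(-|z|^2), which does not depend on y and
  leaves the integral; the remaining integrand is a \<open>param_poly\<close>.\<close>

lemma gauss_taylor_polynomial:
  fixes u :: "real^'m \<Rightarrow> real^'n^'n"
  assumes p: "polynomial_function p" and \<kappa>: "continuous_on UNIV \<kappa>" and u: "continuous_on UNIV u"
  obtains P where "polynomial_function P"
    "\<And>z. integral big_box (\<lambda>y. \<kappa> y *\<^sub>R gauss_taylor K p (u y) z) = gauss 1 P z"
proof
  let ?f = "\<lambda>y z. complex_of_real (exp_poly K (- quad_defect (u y) z)) * p (u y *v z)"
  have "param_poly (\<lambda>y z. complex_of_real (- quad_defect (u y) z))"
  proof -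
    have eq: "(\<lambda>y z. complex_of_real (- quad_defect (u y) z)) =
        (\<lambda>y z. (- 1) * complex_of_real ((u y *v z) \<bullet> (u y *v z)) + complex_of_real (z \<bullet> z))"
      by (simp add: fun_eq_iff quad_defect_def)
    have q: "real_polynomial_function (\<lambda>z::real^'n. z \<bullet> z)"
      by (intro polynomial_function_inner_self polynomial_function_id)
    show ?thesis
      unfolding eq
      by (intro param_poly_add param_poly_cmult param_poly_real_compose[OF q u] param_poly_polynomial
          polynomial_function_of_real q)
  qed
  then have "param_poly ?f"
    by (intro param_poly_mult param_poly_exp_poly param_poly_compose p u)
  then show "polynomial_function (\<lambda>z. integral big_box (\<lambda>y. \<kappa> y *\<^sub>R ?f y z))"
    by (rule param_poly_integral[OF _ \<kappa>])
  have int: "(\<lambda>y. \<kappa> y *\<^sub>R ?f y z) integrable_on big_box" for z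
    by (intro continuous_integrable_big_box continuous_on_scaleR \<kappa> param_poly_continuous) fact
  have "integral big_box (\<lambda>y. \<kappa> y *\<^sub>R gauss_taylor K p (u y) z) =
      integral big_box (\<lambda>y. exp (- (z \<bullet> z)) *\<^sub>R (\<kappa> y *\<^sub>R ?f y z))" for z
    by (simp add: gauss_taylor_def gauss_def scaleR_conv_of_real mult_ac)
  then show "integral big_box (\<lambda>y. \<kappa> y *\<^sub>R gauss_taylor K p (u y) z) =
      gauss 1 (\<lambda>z. integral big_box (\<lambda>y. \<kappa> y *\<^sub>R ?f y z)) z" for z
    by (simp only: integral_cmul gauss_def) simp
qed

text \<open>The error must be uniform in z although the Taylor tail grows like e^(3|q(z)|). With
  |q(z)| \<le> |z|^2/4 this growth is e^(3|z|^2/4), which leaves a quarter of the Gaussian exponent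
  for the polynomial factors. The derivative is compared as well, since the approximation has to
  hold in the graph norm.\<close>

lemma gauss_taylor_error:
  fixes X :: "real^'n^'n"
  assumes p: "polynomial_function p" "C1_deriv p p'" "\<And>v. polynomial_function (\<lambda>z. p' z v)"
  obtains C where "C \<ge> 0"
    "\<And>A z K. (\<And>w. \<bar>quad_defect A w\<bar> \<le> (w \<bullet> w) / 4) \<Longrightarrow>
       norm (gauss 1 p (A *v z) - gauss_taylor (Suc K) p A z) \<le> C * (1 / 2) ^ K"
    "\<And>A z K. (\<And>w. \<bar>quad_defect A w\<bar> \<le> (w \<bullet> w) / 4) \<Longrightarrow>
       norm (exp (- 1 * ((A *v z) \<bullet> (A *v z))) *\<^sub>R (p' (A *v z) (A *v (X *v z)) -
         (2 * 1 * ((A *v z) \<bullet> (A *v (X *v z)))) *\<^sub>R p (A *v z))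
         - gauss_taylor_deriv K p p' A z (X *v z)) \<le> C * (1 / 2) ^ K"
proof -
  \<comment> \<open>The rate 1/20 is meant for w = A z: |w|^2 \<le> 5/4 |z|^2 turns it into
    e^(|z|^2/16) in terms of z.\<close>
  obtain Cp where Cp: "Cp \<ge> 0" "\<And>z. norm (p z) \<le> Cp * exp (1 / 20 * (z \<bullet> z))"
    using polynomial_function_gauss_bound[OF p(1), of "1 / 20"] by auto
  have "\<exists>C\<ge>0. \<forall>z. norm (p' z b) \<le> C * exp (1 / 20 * (z \<bullet> z))" for b
  proof -
    obtain C where "C \<ge> 0" "\<And>z. norm (p' z b) \<le> C * exp (1 / 20 * (z \<bullet> z))"
      by (rule polynomial_function_gauss_bound[OF p(3), of "1 / 20"]) auto
    then show ?thesis by blast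
  qed
  then have "\<forall>b. \<exists>C. C \<ge> 0 \<and> (\<forall>z. norm (p' z b) \<le> C * exp (1 / 20 * (z \<bullet> z)))" by blast
  from choice[OF this] obtain Cb where
    Cb: "\<And>b. Cb b \<ge> 0" "\<And>b z. norm (p' z b) \<le> Cb b * exp (1 / 20 * (z \<bullet> z))"
    by blast
  define CD where "CD = (\<Sum>b\<in>(Basis :: (real^'n) set). Cb b)"
  have CD: "CD \<ge> 0" "norm (p' z h) \<le> norm h * (CD * exp (1 / 20 * (z \<bullet> z)))" for z h
  proof -
    show "CD \<ge> 0" unfolding CD_def by (intro sum_nonneg Cb)
    have "norm (p' z h) \<le> (\<Sum>b\<in>Basis. norm ((h \<bullet> b) *\<^sub>R p' z b))"
      unfolding C1_deriv_basis_sum[OF p(2), of z h] by (rule norm_sum)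
    also have "\<dots> \<le> (\<Sum>b\<in>Basis. norm h * (Cb b * exp (1 / 20 * (z \<bullet> z))))"
      unfolding norm_scaleR by (intro sum_mono mult_mono Cb) (auto intro: Basis_le_norm)
    finally show "norm (p' z h) \<le> norm h * (CD * exp (1 / 20 * (z \<bullet> z)))"
      by (simp add: CD_def sum_distrib_left sum_distrib_right)
  qed
  obtain CX where CX: "CX \<ge> 0" "\<And>z. norm (X *v z) \<le> CX * exp (1 / 16 * (z \<bullet> z))"
    using polynomial_function_gauss_bound[OF polynomial_function_matrix[of X], of "1 / 16"] by auto
  obtain C1 where C1: "C1 \<ge> 0" "\<And>z::real^'n. norm z \<le> C1 * exp (1 / 16 * (z \<bullet> z))"
    using polynomial_function_gauss_bound[OF polynomial_function_id, of "1 / 16"] by auto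
  define C where "C = Cp + (2 * CD * CX + 12 * (C1 * CX) * Cp)"
  have "Cp \<le> C" "2 * CD * CX + 12 * (C1 * CX) * Cp \<le> C" "C \<ge> 0"
    using Cp(1) CD(1) CX(1) C1(1) by (auto simp: C_def)
  note C_le = this
  have main: "norm (gauss 1 p (A *v z) - gauss_taylor (Suc K) p A z) \<le> C * (1 / 2) ^ K \<and>
       norm (exp (- 1 * ((A *v z) \<bullet> (A *v z))) *\<^sub>R (p' (A *v z) (A *v (X *v z)) -
         (2 * 1 * ((A *v z) \<bullet> (A *v (X *v z)))) *\<^sub>R p (A *v z))
         - gauss_taylor_deriv K p p' A z (X *v z)) \<le> C * (1 / 2) ^ K"
    if A: "\<And>w. \<bar>quad_defect A w\<bar> \<le> (w \<bullet> w) / 4" for A z K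
  proof -
    define r where "r = z \<bullet> z"
    define q where "q = quad_defect A z"
    define w where "w = A *v z"
    \<comment> \<open>Unit of growth. At most three such factors occur in a term, and -1 + 3/4 +
      3/16 < 0.\<close>
    define e where "e = exp (r / 16)"
    have r0: "r \<ge> 0" by (simp add: r_def)
    have e1: "e \<ge> 1" "e > 0" using r0 by (auto simp: e_def)
    have q: "\<bar>q\<bar> \<le> r / 4" using A[of z] by (simp add: q_def r_def)
    have ww: "w \<bullet> w = r + q" by (simp add: q_def quad_defect_def w_def r_def)
    have A2: "norm (A *v v) \<le> 2 * norm v" for v
    proof (rule power2_le_imp_le)
      have "(A *v v) \<bullet> (A *v v) \<le> (v \<bullet> v) + (v \<bullet> v) / 4"
        using A[of v] abs_ge_self[of "quad_defect A v"] unfolding quad_defect_def by linarith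
      also have "\<dots> \<le> 4 * (v \<bullet> v)" using inner_ge_zero[of v] by linarith
      finally show "(norm (A *v v))\<^sup>2 \<le> (2 * norm v)\<^sup>2"
        by (simp add: power2_norm_eq_inner power_mult_distrib)
    qed simp
    have exp_w: "exp (1 / 20 * (w \<bullet> w)) \<le> e" using q by (simp add: ww e_def)
    have pw: "norm (p w) \<le> Cp * e"
      using Cp(2)[of w] mult_left_mono[OF exp_w Cp(1)] by linarith
    have Xz: "norm (X *v z) \<le> CX * e" and zz: "norm z \<le> C1 * e"
      using CX(2)[of z] C1(2)[of z] by (simp_all add: e_def r_def)
    have AX: "norm (A *v (X *v z)) \<le> 2 * (CX * e)" and w2: "norm w \<le> 2 * (C1 * e)"
      using A2[of "X *v z"] A2[of z] Xz zz by (auto simp: w_def)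
    have p'w: "norm (p' w (A *v (X *v z))) \<le> 2 * CD * CX * e ^ 3"
    proof -
      have "norm (p' w (A *v (X *v z))) \<le> norm (A *v (X *v z)) * (CD * exp (1 / 20 * (w \<bullet> w)))" by (rule CD)
      also have "\<dots> \<le> (2 * (CX * e)) * (CD * e)"
        using AX exp_w CD(1) CX(1) e1 by (intro mult_mono mult_left_mono) auto
      also have "\<dots> = 2 * CD * CX * e ^ 2" by (simp add: power2_eq_square)
      also have "\<dots> \<le> 2 * CD * CX * e ^ 3"
        using CD(1) CX(1) e1 by (intro mult_left_mono power_increasing) auto
      finally show ?thesis .
    qed
    have zX: "\<bar>z \<bullet> (X *v z)\<bar> \<le> C1 * CX * e ^ 2"
    proof -
      have "\<bar>z \<bullet> (X *v z)\<bar> \<le> norm z * norm (X *v z)" by (rule Cauchy_Schwarz_ineq2)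
      also have "\<dots> \<le> (C1 * e) * (CX * e)" by (intro mult_mono zz Xz) (use C1(1) e1 in auto)
      finally show ?thesis by (simp add: power2_eq_square mult_ac)
    qed
    have wX: "\<bar>w \<bullet> (A *v (X *v z))\<bar> \<le> 4 * (C1 * CX * e ^ 2)"
    proof -
      have "\<bar>w \<bullet> (A *v (X *v z))\<bar> \<le> norm w * norm (A *v (X *v z))" by (rule Cauchy_Schwarz_ineq2)
      also have "\<dots> \<le> (2 * (C1 * e)) * (2 * (CX * e))" by (intro mult_mono w2 AX) (use C1(1) e1 in auto)
      finally show ?thesis by (simp add: power2_eq_square mult_ac)
    qed
    define T where "T = (1 / 2) ^ K * exp (3 * r / 4)"
    have tail: "\<bar>exp (- q) - exp_poly K (- q)\<bar> \<le> T" "\<bar>exp (- q) - exp_poly (Suc K) (- q)\<bar> \<le> T"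
    proof -
      have ex: "exp (3 * \<bar>- q\<bar>) \<le> exp (3 * r / 4)" using q by simp
      have "\<bar>exp (- q) - exp_poly K (- q)\<bar> \<le> (1 / 2) ^ K * exp (3 * \<bar>- q\<bar>)" by (rule exp_poly_tail)
      also have "\<dots> \<le> T" unfolding T_def by (intro mult_left_mono ex) simp
      finally show "\<bar>exp (- q) - exp_poly K (- q)\<bar> \<le> T" .
      have "\<bar>exp (- q) - exp_poly (Suc K) (- q)\<bar> \<le> (1 / 2) ^ Suc K * exp (3 * \<bar>- q\<bar>)" by (rule exp_poly_tail)
      also have "\<dots> \<le> T" unfolding T_def by (intro mult_mono ex) auto
      finally show "\<bar>exp (- q) - exp_poly (Suc K) (- q)\<bar> \<le> T" .
    qed
    have T0: "T \<ge> 0" by (simp add: T_def)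
    have eT: "exp (- r) * (T * e ^ 3) \<le> (1 / 2) ^ K"
    proof -
      have "exp (- r) * (T * e ^ 3) = (1 / 2) ^ K * (exp (- r) * exp (3 * r / 4) * exp (3 * (r / 16)))"
        by (simp add: T_def e_def exp_of_nat_mult[symmetric])
      also have "exp (- r) * exp (3 * r / 4) * exp (3 * (r / 16)) \<le> 1"
        unfolding mult_exp_exp using r0 by simp
      finally show ?thesis by simp
    qed
    have exp_split: "exp (- (w \<bullet> w)) = exp (- r) * exp (- q)" by (simp add: ww mult_exp_exp)
    have "norm (gauss 1 p (A *v z) - gauss_taylor (Suc K) p A z) \<le> C * (1 / 2) ^ K"
    proof -
      have "gauss 1 p (A *v z) - gauss_taylor (Suc K) p A z =
          (exp (- r) * (exp (- q) - exp_poly (Suc K) (- q))) *\<^sub>R p w"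
        by (simp add: gauss_taylor_def gauss_def w_def[symmetric] q_def[symmetric] r_def[symmetric] exp_split
            algebra_simps)
      also have "norm \<dots> = exp (- r) * (\<bar>exp (- q) - exp_poly (Suc K) (- q)\<bar> * norm (p w))"
        by (simp add: abs_mult)
      also have "\<dots> \<le> exp (- r) * (T * (Cp * e))"
        by (intro mult_left_mono mult_mono tail pw T0) auto
      also have "\<dots> = Cp * (exp (- r) * (T * e ^ 1))" by simp
      also have "\<dots> \<le> Cp * (exp (- r) * (T * e ^ 3))"
        using Cp(1) T0 e1 by (intro mult_left_mono power_increasing) auto
      also have "\<dots> \<le> C * (1 / 2) ^ K"
        using eT C_le Cp(1) by (intro mult_mono) (auto simp: T0 e1 less_imp_le intro!: mult_nonneg_nonneg)
      finally show ?thesis .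
    qed
    moreover have "norm (exp (- 1 * (w \<bullet> w)) *\<^sub>R (p' w (A *v (X *v z)) -
         (2 * 1 * (w \<bullet> (A *v (X *v z)))) *\<^sub>R p w)
         - gauss_taylor_deriv K p p' A z (X *v z)) \<le> C * (1 / 2) ^ K"
    proof -
      let ?a = "p' w (A *v (X *v z)) - (2 * (z \<bullet> (X *v z))) *\<^sub>R p w"
      let ?b = "2 * (w \<bullet> (A *v (X *v z))) - 2 * (z \<bullet> (X *v z))"
      have na: "norm ?a \<le> (2 * CD * CX + 2 * (C1 * CX) * Cp) * e ^ 3"
      proof -
        have "norm ?a \<le> norm (p' w (A *v (X *v z))) + 2 * \<bar>z \<bullet> (X *v z)\<bar> * norm (p w)"
          using norm_triangle_ineq4[of "p' w (A *v (X *v z))" "(2 * (z \<bullet> (X *v z))) *\<^sub>R p w"] by (simp add: abs_mult)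
        also have "\<dots> \<le> 2 * CD * CX * e ^ 3 + 2 * (C1 * CX * e ^ 2) * (Cp * e)"
          using zX by (intro add_mono mult_mono p'w pw) (use C1 CX in auto)
        finally show ?thesis by (simp add: algebra_simps power2_eq_square power3_eq_cube)
      qed
      have nb: "\<bar>?b\<bar> * norm (p w) \<le> 10 * (C1 * CX) * Cp * e ^ 3"
      proof -
        have "\<bar>?b\<bar> * norm (p w) \<le> (10 * (C1 * CX * e ^ 2)) * (Cp * e)"
          using zX wX by (intro mult_mono pw) (use C1 CX in auto)
        then show ?thesis by (simp add: algebra_simps power2_eq_square power3_eq_cube)
      qed
      have "exp (- 1 * (w \<bullet> w)) *\<^sub>R (p' w (A *v (X *v z)) - (2 * 1 * (w \<bullet> (A *v (X *v z)))) *\<^sub>R p w)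
          - gauss_taylor_deriv K p p' A z (X *v z) =
          exp (- r) *\<^sub>R ((exp (- q) - exp_poly (Suc K) (- q)) *\<^sub>R ?a
             - ((exp (- q) - exp_poly K (- q)) * ?b) *\<^sub>R p w)"
      proof -
        \<comment> \<open>Stated for variables so that the algebra sees neither exponentials nor
          inner products. Grouping by \<open>P - Z *\<^sub>R Q\<close> leaves each of the two
          truncation errors as a separate factor.\<close>
        have alg: "(E * a) *\<^sub>R (P - W *\<^sub>R Q) - E *\<^sub>R (t1 *\<^sub>R (P - Z *\<^sub>R Q) - (t0 * (W - Z)) *\<^sub>R Q) =
            E *\<^sub>R ((a - t1) *\<^sub>R (P - Z *\<^sub>R Q) - ((a - t0) * (W - Z)) *\<^sub>R Q)"
          for E a W Z t0 t1 :: real and P Q :: complex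
          by (simp add: scaleR_conv_of_real algebra_simps)
        show ?thesis
          unfolding gauss_taylor_deriv_def w_def[symmetric] q_def[symmetric] r_def[symmetric]
            mult_minus_left mult_1_left mult_1_right exp_split by (rule alg)
      qed
      also have "norm \<dots> \<le> exp (- r) * (\<bar>exp (- q) - exp_poly (Suc K) (- q)\<bar> * norm ?a +
          \<bar>exp (- q) - exp_poly K (- q)\<bar> * (\<bar>?b\<bar> * norm (p w)))"
        unfolding norm_scaleR abs_exp_cancel
        by (intro mult_left_mono order_trans[OF norm_triangle_ineq4]) (auto simp: abs_mult)
      also have "\<dots> \<le> exp (- r) * (T * ((2 * CD * CX + 2 * (C1 * CX) * Cp) * e ^ 3) +
          T * (10 * (C1 * CX) * Cp * e ^ 3))"
        by (intro mult_left_mono add_mono mult_mono tail na nb T0) auto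
      also have "\<dots> = (2 * CD * CX + 12 * (C1 * CX) * Cp) * (exp (- r) * (T * e ^ 3))"
        by (simp add: algebra_simps)
      also have "\<dots> \<le> C * (1 / 2) ^ K"
        using eT C_le by (intro mult_mono) (auto simp: T0 e1 less_imp_le intro!: mult_nonneg_nonneg)
      finally show ?thesis .
    qed
    ultimately show ?thesis unfolding w_def by blast
  qed
  show ?thesis by (rule that[OF C_le(3)]) (use main in blast)+
qed

text \<open>What differentiating the average of F along -X z under the integral sign gives. The
  field acts before u(y); in T d\<pi>(X) it acts after u(y), and the commutator comes from this
  difference.\<close>

definition average_deriv ::
  "(real^'m \<Rightarrow> real) \<Rightarrow> (real^'m \<Rightarrow> real^'n^'n) \<Rightarrow> (real^'n \<Rightarrow> real^'n \<Rightarrow> complex) \<Rightarrow> real^'n^'n \<Rightarrow>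
    real^'n \<Rightarrow> complex" where
  "average_deriv \<kappa> u F' X z = integral big_box (\<lambda>y. - (\<kappa> y *\<^sub>R F' (u y *v z) (u y *v (X *v z))))"

lemma bounded_kernel:
  fixes \<kappa> :: "real^'m \<Rightarrow> real"
  assumes "continuous_on UNIV \<kappa>" "\<And>y. norm y > 1 \<Longrightarrow> \<kappa> y = 0"
  obtains B where "B \<ge> 0" "\<And>y. \<bar>\<kappa> y\<bar> \<le> B"
proof -
  have "bounded (\<kappa> ` cball 0 1)"
    by (intro compact_imp_bounded compact_continuous_image continuous_on_subset[OF assms(1)]) auto
  then have "\<exists>B. \<forall>y\<in>cball 0 1. \<bar>\<kappa> y\<bar> \<le> B"
    unfolding bounded_iff by simp
  then obtain B where B: "\<And>y. y \<in> cball 0 1 \<Longrightarrow> \<bar>\<kappa> y\<bar> \<le> B"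
    by blast
  have "B \<ge> 0" using B[of 0] by auto
  moreover have "\<bar>\<kappa> y\<bar> \<le> B" for y
    using B[of y] assms(2)[of y] \<open>B \<ge> 0\<close> by (cases "norm y > 1") auto
  ultimately show ?thesis using that by blast
qed

lemma matvec_continuous_left:
  "continuous_on S u \<Longrightarrow> continuous_on S (\<lambda>y. u y *v (z :: real^'n))"
  by (intro matvec.continuous_on continuous_on_const)

text \<open>One Taylor degree serves the average and its derivatives along finitely many fields, so
  that a single Gaussian polynomial approximates in all graph coordinates at once. Outside the unit
  ball the kernel vanishes, so closeness of u(y) to the identity is needed only inside.\<close>

lemma average_gauss_approx:
  fixes u :: "real^'m \<Rightarrow> real^'n^'n"
  assumes p: "polynomial_function p" and F': "C1_deriv (gauss 1 p) F'"
    and \<kappa>: "continuous_on UNIV \<kappa>" "\<And>y. norm y > 1 \<Longrightarrow> \<kappa> y = 0"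
    and u: "continuous_on UNIV u" "\<And>y w. norm y \<le> 1 \<Longrightarrow> \<bar>quad_defect (u y) w\<bar> \<le> (w \<bullet> w) / 4"
    and "finite \<X>" "\<epsilon> > 0"
  obtains P P' where "polynomial_function P" "C1_deriv (gauss 1 P) P'"
    "\<And>z. norm (average \<kappa> u (gauss 1 p) z - gauss 1 P z) \<le> \<epsilon>"
    "\<And>X z. X \<in> \<X> \<Longrightarrow> norm (average_deriv \<kappa> u F' X z - - P' z (X *v z)) \<le> \<epsilon>"
proof -
  obtain p' where p': "C1_deriv p p'" "\<And>v. polynomial_function (\<lambda>z. p' z v)"
    using polynomial_function_derivative[OF p] by blast
  have F'_eq: "F' z v = exp (- 1 * (z \<bullet> z)) *\<^sub>R (p' z v - (2 * 1 * (z \<bullet> v)) *\<^sub>R p z)" for z v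
    using has_derivative_unique[OF C1_derivD[OF F', of z UNIV] C1_derivD[OF C1_deriv_gauss[OF p'(1), of 1], of z UNIV]]
    by (rule fun_cong)
  define err where "err X C \<longleftrightarrow> C \<ge> 0 \<and> (\<forall>A z K. (\<forall>w. \<bar>quad_defect A w\<bar> \<le> (w \<bullet> w) / 4) \<longrightarrow>
       norm (gauss 1 p (A *v z) - gauss_taylor (Suc K) p A z) \<le> C * (1 / 2) ^ K \<and>
       norm (F' (A *v z) (A *v (X *v z)) - gauss_taylor_deriv K p p' A z (X *v z)) \<le> C * (1 / 2) ^ K)"
    for X C
  have "\<exists>C. err X C" for X
  proof -
    obtain C where "C \<ge> 0"
      "\<And>A z K. (\<And>w. \<bar>quad_defect A w\<bar> \<le> (w \<bullet> w) / 4) \<Longrightarrow>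
         norm (gauss 1 p (A *v z) - gauss_taylor (Suc K) p A z) \<le> C * (1 / 2) ^ K"
      "\<And>A z K. (\<And>w. \<bar>quad_defect A w\<bar> \<le> (w \<bullet> w) / 4) \<Longrightarrow>
         norm (F' (A *v z) (A *v (X *v z)) - gauss_taylor_deriv K p p' A z (X *v z)) \<le> C * (1 / 2) ^ K"
      unfolding F'_eq by (rule gauss_taylor_error[OF p p', of X]) blast
    then have "err X C" unfolding err_def by simp
    then show ?thesis by blast
  qed
  then obtain c where c: "\<And>X. err X (c X)" by metis
  \<comment> \<open>The error of the function itself does not involve X and is read off at X = 0;
    inserting 0 makes that bound available for every set \<X>, also the empty one.\<close>
  define C where "C = (\<Sum>X\<in>insert 0 \<X>. c X)"
  have c0: "c X \<ge> 0" for X using c[of X] by (simp add: err_def)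
  have C: "c X \<le> C" if "X \<in> insert 0 \<X>" for X
    unfolding C_def using that assms(7) c0 by (intro member_le_sum) auto
  have C0: "C \<ge> 0" unfolding C_def by (intro sum_nonneg c0)
  obtain B where B: "B \<ge> 0" "\<And>y. \<bar>\<kappa> y\<bar> \<le> B" using bounded_kernel[OF \<kappa>] by blast
  define V where "V = measure lborel (big_box :: (real^'m) set)"
  obtain K where K: "(1 / 2) ^ K * (B * C * V) < \<epsilon>" using exists_half_power_less[OF assms(8)] by blast
  obtain P where P: "polynomial_function P"
    "\<And>z. integral big_box (\<lambda>y. \<kappa> y *\<^sub>R gauss_taylor (Suc K) p (u y) z) = gauss 1 P z"
    using gauss_taylor_polynomial[OF p \<kappa>(1) u(1)] by blast
  obtain P1 where P1: "C1_deriv P P1" using polynomial_function_derivative[OF P(1)] by blast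
  define P' where "P' z v = exp (- 1 * (z \<bullet> z)) *\<^sub>R (P1 z v - (2 * 1 * (z \<bullet> v)) *\<^sub>R P z)" for z v
  have P': "C1_deriv (gauss 1 P) P'"
    using C1_deriv_gauss[OF P1, of 1] unfolding P'_def[abs_def] .
  note taylor = C1_deriv_gauss_taylor[OF p'(1), of K]
  have cont_taylor: "continuous_on UNIV (\<lambda>y. gauss_taylor (Suc K) p (u y) z)" for z
    unfolding gauss_taylor_def gauss_def quad_defect_def exp_poly_def
    by (intro continuous_intros matvec_continuous_left u
        continuous_on_compose2[OF C1_deriv_continuous[OF p'(1), of UNIV]]) auto
  have cont_deriv: "continuous_on UNIV (\<lambda>y. gauss_taylor_deriv K p p' (u y) z (X *v z))" for X z
    using continuous_on_compose2[OF continuous_gauss_taylor_deriv[OF p'(1) u(1), of K X], of UNIV "\<lambda>y. (y, z)"]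
    by (simp add: continuous_on_Pair continuous_on_id continuous_on_const)
  have cont_F: "continuous_on UNIV (\<lambda>y. gauss 1 p (u y *v z))" for z
    by (intro continuous_on_compose2[OF C1_deriv_continuous[OF F', of UNIV]] matvec_continuous_left u) auto
  have cont_F': "continuous_on UNIV (\<lambda>y. F' (u y *v z) (u y *v v))" for z v
    by (intro C1_deriv_continuous_joint[OF F'] matvec_continuous_left u)
  \<comment> \<open>P is known only as an integral. Its derivative along X is therefore identified
    by uniqueness: both sides are the derivative at t = 0 of \<open>gauss 1 P\<close> along the
    flow.\<close>
  have P'_eq: "- P' z (X *v z) = integral big_box (\<lambda>y. - (\<kappa> y *\<^sub>R gauss_taylor_deriv K p p' (u y) z (X *v z)))" for X z
  proof -
    have "((\<lambda>t. integral big_box (\<lambda>y. \<kappa> y *\<^sub>R gauss_taylor (Suc K) p (u y) (matrix_exp ((- t) *\<^sub>R X) *v z)))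
        has_vector_derivative integral big_box (\<lambda>y. - (\<kappa> y *\<^sub>R gauss_taylor_deriv K p p' (u y)
          (matrix_exp ((- 0) *\<^sub>R X) *v z) (X *v (matrix_exp ((- 0) *\<^sub>R X) *v z))))) (at 0)"
    proof (rule leibniz_flow)
      show "C1_deriv (\<lambda>z. \<kappa> y *\<^sub>R gauss_taylor (Suc K) p (u y) z)
          (\<lambda>z v. \<kappa> y *\<^sub>R gauss_taylor_deriv K p p' (u y) z v)" for y
        by (intro C1_deriv_cmult taylor)
      show "continuous_on UNIV (\<lambda>y. \<kappa> y *\<^sub>R gauss_taylor (Suc K) p (u y) z)" for z
        by (intro continuous_on_scaleR \<kappa> cont_taylor)
      have "continuous_on UNIV (\<lambda>s::(real^'m) \<times> (real^'n). \<kappa> (fst s))"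
        by (intro continuous_on_compose2[OF \<kappa>(1)] continuous_on_fst continuous_on_id) auto
      from continuous_on_scaleR[OF this continuous_gauss_taylor_deriv[OF p'(1) u(1), of K X]]
      show "continuous_on UNIV (\<lambda>(y, z). \<kappa> y *\<^sub>R gauss_taylor_deriv K p p' (u y) z (X *v z))"
        by (simp add: case_prod_unfold)
    qed
    then have "((\<lambda>t. gauss 1 P (matrix_exp ((- t) *\<^sub>R X) *v z)) has_vector_derivative
        integral big_box (\<lambda>y. - (\<kappa> y *\<^sub>R gauss_taylor_deriv K p p' (u y) z (X *v z)))) (at 0)"
      unfolding P(2) by simp
    from vector_derivative_unique_at[OF flow_has_vector_derivative[OF P', where z=z and t=0] this]
    show ?thesis by simp
  qed
  have bound: "norm (\<kappa> y *\<^sub>R d) \<le> B * (C * (1 / 2) ^ K)"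
    if "norm y \<le> 1 \<Longrightarrow> norm d \<le> C * (1 / 2) ^ K" for y and d :: complex
  proof (cases "norm y \<le> 1")
    case True
    have "\<bar>\<kappa> y\<bar> * norm d \<le> B * (C * (1 / 2) ^ K)"
      by (intro mult_mono B that True) auto
    then show ?thesis by simp
  next
    case False
    then show ?thesis using \<kappa>(2)[of y] B(1) C0 by simp
  qed
  have total: "B * (C * (1 / 2) ^ K) * V \<le> \<epsilon>" using K by (simp add: mult_ac)
  have err1: "norm (gauss 1 p (u y *v z) - gauss_taylor (Suc K) p (u y) z) \<le> C * (1 / 2) ^ K"
    if "norm y \<le> 1" for y z
  proof -
    have "norm (gauss 1 p (u y *v z) - gauss_taylor (Suc K) p (u y) z) \<le> c 0 * (1 / 2) ^ K"
      using c[of 0] u(2)[OF that] unfolding err_def by blast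
    also have "\<dots> \<le> C * (1 / 2) ^ K" by (intro mult_right_mono C) auto
    finally show ?thesis .
  qed
  have err2: "norm (F' (u y *v z) (u y *v (X *v z)) - gauss_taylor_deriv K p p' (u y) z (X *v z)) \<le> C * (1 / 2) ^ K"
    if "norm y \<le> 1" "X \<in> \<X>" for y z X
  proof -
    have "norm (F' (u y *v z) (u y *v (X *v z)) - gauss_taylor_deriv K p p' (u y) z (X *v z)) \<le> c X * (1 / 2) ^ K"
      using c[of X] u(2)[OF that(1)] unfolding err_def by blast
    also have "\<dots> \<le> C * (1 / 2) ^ K" using that by (intro mult_right_mono C) auto
    finally show ?thesis .
  qed
  show ?thesis
  proof (rule that[OF P(1) P'])
    fix z
    have "average \<kappa> u (gauss 1 p) z - gauss 1 P z =
        integral big_box (\<lambda>y. \<kappa> y *\<^sub>R gauss 1 p (u y *v z) - \<kappa> y *\<^sub>R gauss_taylor (Suc K) p (u y) z)"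
      unfolding average_def P(2)[symmetric]
      by (intro integral_diff[symmetric] continuous_integrable_big_box continuous_on_scaleR \<kappa> cont_F cont_taylor)
    also have "\<dots> = integral big_box (\<lambda>y. \<kappa> y *\<^sub>R (gauss 1 p (u y *v z) - gauss_taylor (Suc K) p (u y) z))"
      by (simp only: scaleR_diff_right)
    also have "norm \<dots> \<le> B * (C * (1 / 2) ^ K) * V"
      unfolding V_def
      by (intro norm_integral_big_box_le continuous_on_scaleR continuous_on_diff \<kappa> cont_F cont_taylor bound err1)
    finally show "norm (average \<kappa> u (gauss 1 p) z - gauss 1 P z) \<le> \<epsilon>" using total by linarith
  next
    fix X z assume X: "X \<in> \<X>"
    have "average_deriv \<kappa> u F' X z - - P' z (X *v z) = integral big_box (\<lambda>y. - (\<kappa> y *\<^sub>R F' (u y *v z) (u y *v (X *v z)))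
        - - (\<kappa> y *\<^sub>R gauss_taylor_deriv K p p' (u y) z (X *v z)))"
      unfolding average_deriv_def P'_eq
      by (intro integral_diff[symmetric] continuous_integrable_big_box continuous_on_scaleR continuous_on_minus
          \<kappa> cont_F' cont_deriv)
    also have "\<dots> = integral big_box (\<lambda>y. \<kappa> y *\<^sub>R - (F' (u y *v z) (u y *v (X *v z))
        - gauss_taylor_deriv K p p' (u y) z (X *v z)))"
      by (simp add: scaleR_diff_right)
    also have "norm \<dots> \<le> B * (C * (1 / 2) ^ K) * V"
      unfolding V_def
    proof (rule norm_integral_big_box_le)
      show "continuous_on UNIV (\<lambda>y. \<kappa> y *\<^sub>R - (F' (u y *v z) (u y *v (X *v z))
          - gauss_taylor_deriv K p p' (u y) z (X *v z)))"
        by (intro continuous_on_scaleR continuous_on_diff continuous_on_minus \<kappa> cont_F' cont_deriv)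
      show "norm (\<kappa> y *\<^sub>R - (F' (u y *v z) (u y *v (X *v z)) - gauss_taylor_deriv K p p' (u y) z (X *v z)))
          \<le> B * (C * (1 / 2) ^ K)" for y
        by (rule bound) (simp only: norm_minus_cancel err2 X)
    qed
    finally show "norm (average_deriv \<kappa> u F' X z - - P' z (X *v z)) \<le> \<epsilon>" using total by linarith
  qed
qed

section \<open>Friedrichs mollification along the group\<close>

lemma c0_compose_continuous:
  fixes u :: "real^'m \<Rightarrow> real^'n^'n"
  assumes "c0 M \<phi>" "continuous_on UNIV u" "\<And>y. u y *v m \<in> M"
  shows "continuous_on UNIV (\<lambda>y. \<phi> (u y *v m))"
proof (rule continuous_on_compose2[of M \<phi>])
  show "continuous_on M \<phi>" using assms(1) by (simp add: c0_def)
  show "continuous_on UNIV (\<lambda>y. u y *v m)" by (rule matvec_continuous_left[OF assms(2)])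
  show "(\<lambda>y. u y *v m) ` UNIV \<subseteq> M" using assms(3) by blast
qed

text \<open>The reason why uniform closeness of functions suffices: once the kernel is bounded,
  averaging is Lipschitz for the supremum over M, whatever the derivatives of the two
  functions.\<close>

lemma average_diff_le:
  fixes u :: "real^'m \<Rightarrow> real^'n^'n"
  assumes k: "continuous_on UNIV k" "\<And>y. \<bar>k y\<bar> \<le> B"
    and u: "continuous_on UNIV u" "\<And>y. u y *v m \<in> M"
    and "c0 M \<phi>" "c0 M \<psi>" "\<And>m. m \<in> M \<Longrightarrow> norm (\<phi> m - \<psi> m) \<le> \<eta>"
  shows "norm (average k u \<phi> m - average k u \<psi> m) \<le> B * measure lborel (big_box :: (real^'m) set) * \<eta>"
proof -
  have "average k u \<phi> m - average k u \<psi> m = integral big_box (\<lambda>y. k y *\<^sub>R \<phi> (u y *v m) - k y *\<^sub>R \<psi> (u y *v m))"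
    unfolding average_def
    by (intro integral_diff[symmetric] continuous_integrable_big_box continuous_on_scaleR k
        c0_compose_continuous[OF assms(5) u] c0_compose_continuous[OF assms(6) u])
  also have "\<dots> = integral big_box (\<lambda>y. k y *\<^sub>R (\<phi> (u y *v m) - \<psi> (u y *v m)))"
    by (simp only: scaleR_diff_right)
  also have "norm \<dots> \<le> B * \<eta> * measure lborel (big_box :: (real^'m) set)"
  proof (rule norm_integral_big_box_le)
    show "continuous_on UNIV (\<lambda>y. k y *\<^sub>R (\<phi> (u y *v m) - \<psi> (u y *v m)))"
      by (intro continuous_on_scaleR continuous_on_diff k
        c0_compose_continuous[OF assms(5) u] c0_compose_continuous[OF assms(6) u])
    show "norm (k y *\<^sub>R (\<phi> (u y *v m) - \<psi> (u y *v m))) \<le> B * \<eta>" for y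
      unfolding norm_scaleR by (intro mult_mono k(2) assms(7) u(2)) (use k(2)[of y] in auto)
  qed
  finally show ?thesis by (simp add: mult_ac)
qed

section \<open>Normalised bump, dilated charts and partial integration\<close>

definition mollifier :: "'a::euclidean_space \<Rightarrow> real" where
  "mollifier y = bump y / integral big_box (bump :: 'a \<Rightarrow> real)"

definition mollifier' :: "'a::euclidean_space \<Rightarrow> 'a \<Rightarrow> real" where
  "mollifier' y v = bump' y v / integral big_box (bump :: 'a \<Rightarrow> real)"

lemma C1_deriv_mollifier: "C1_deriv (mollifier :: 'a::euclidean_space \<Rightarrow> real) mollifier'"
proof -
  have "C1_deriv (\<lambda>y::'a. (1 / integral big_box (bump :: 'a \<Rightarrow> real)) *\<^sub>R bump y)
      (\<lambda>y v. (1 / integral big_box (bump :: 'a \<Rightarrow> real)) *\<^sub>R bump' y v)"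
    by (rule C1_deriv_cmult[OF C1_deriv_bump])
  then show ?thesis unfolding mollifier_def[abs_def] mollifier'_def[abs_def] by simp
qed

lemma continuous_mollifier: "continuous_on S mollifier"
  by (rule C1_deriv_continuous[OF C1_deriv_mollifier])

lemma mollifier_eq_0: "norm y > 1 \<Longrightarrow> mollifier y = 0"
  by (simp add: mollifier_def bump_eq_0)

lemma mollifier'_eq_0: "norm y > 1 \<Longrightarrow> mollifier' y v = 0"
proof -
  assume "norm y > 1"
  then have "y \<bullet> y > 1" by (simp add: dot_square_norm)
  then show ?thesis by (simp add: mollifier'_def bump'_def)
qed

lemma mollifier_bounds:
  obtains B where "B > 0" "\<And>y::'a::euclidean_space. \<bar>mollifier y\<bar> \<le> B"
    "\<And>y v::'a. \<bar>mollifier' y v\<bar> \<le> B * norm v"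
proof (rule that[of "4 / integral big_box (bump :: 'a \<Rightarrow> real)"])
  let ?m = "integral big_box (bump :: 'a \<Rightarrow> real)"
  have m: "?m > 0" by (rule integral_bump_pos)
  then show "4 / ?m > 0" by simp
  show "\<bar>mollifier y\<bar> \<le> 4 / ?m" for y :: 'a
    using m bump_nonneg[of y] bump_le_1[of y] unfolding mollifier_def by (simp add: divide_right_mono)
  show "\<bar>mollifier' y v\<bar> \<le> 4 / ?m * norm v" for y v :: 'a
    using m bump'_bound[of y v] unfolding mollifier'_def by (simp add: divide_right_mono)
qed

lemma integral_mollifier: "integral big_box (mollifier :: 'a::euclidean_space \<Rightarrow> real) = 1"
  unfolding mollifier_def[abs_def] using integral_bump_pos[where 'a='a] by simp

text \<open>
  \<open>V x\<close> is the inverse of the group element \<open>U x\<close>. The assumption \<open>field\<close> lifts the vector field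
  \<open>U x Y x\<close> on the group to the coordinates; the determinant \<open>D\<close> clears the denominators, which is
  why it is a factor of \<open>\<kappa>\<close> below.
\<close>

locale action_chart =
  fixes G :: "(real^'n^'n) set" and M :: "(real^'n) set"
    and U V :: "real^('n \<times> 'n) \<Rightarrow> real^'n^'n" and U' and D :: "real^('n \<times> 'n) \<Rightarrow> real" and \<delta> :: real
  assumes closed_M: "closed M"
    and invariant: "\<And>g m. g \<in> G \<Longrightarrow> m \<in> M \<Longrightarrow> g *v m \<in> M"
    and U_in: "\<And>x. U x \<in> G" and VU: "\<And>x. V x ** U x = mat 1" and U_0: "U 0 = mat 1"
    and conj: "\<And>x X. X \<in> lie_algebra G \<Longrightarrow> V x ** X ** U x \<in> lie_algebra G"
    and U': "C1_deriv U U'" and C1_V: "C1 V" and C1_D: "C1 D" and D_0: "D 0 = 1" and \<delta>_pos: "\<delta> > 0"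
    and field: "\<And>Y. C1 Y \<Longrightarrow> (\<And>x. Y x \<in> span (lie_algebra G)) \<Longrightarrow>
       \<exists>c. C1 c \<and> (Y 0 = 0 \<longrightarrow> c 0 = 0) \<and> (\<forall>x. norm x < \<delta> \<longrightarrow> U' x (c x) = D x *\<^sub>R (U x ** Y x))"
begin

definition u :: "real \<Rightarrow> real^('n \<times> 'n) \<Rightarrow> real^'n^'n" where
  "u \<epsilon> y = U (\<epsilon> *\<^sub>R y)"

definition \<kappa> :: "real \<Rightarrow> real^('n \<times> 'n) \<Rightarrow> real" where
  "\<kappa> \<epsilon> y = mollifier y * D (\<epsilon> *\<^sub>R y)"

text \<open>The divergence of \<open>y \<mapsto> mollifier y / \<epsilon> *\<^sub>R c (\<epsilon> *\<^sub>R y)\<close>.\<close>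

definition kern ::
  "(real^('n \<times> 'n) \<Rightarrow> real^('n \<times> 'n)) \<Rightarrow> (real^('n \<times> 'n) \<Rightarrow> real^('n \<times> 'n) \<Rightarrow> real^('n \<times> 'n)) \<Rightarrow>
    real \<Rightarrow> real^('n \<times> 'n) \<Rightarrow> real" where
  "kern c c' \<epsilon> y = mollifier y * divergence c' (\<epsilon> *\<^sub>R y) + mollifier' y (c (\<epsilon> *\<^sub>R y)) / \<epsilon>"

lemma exp_invariant: "X \<in> lie_algebra G \<Longrightarrow> m \<in> M \<Longrightarrow> matrix_exp (t *\<^sub>R X) *v m \<in> M"
  by (intro invariant matrix_exp_in_group)

lemma C1_deriv_scale:
  assumes "C1_deriv f f'"
  shows "C1_deriv (\<lambda>y. f (\<epsilon> *\<^sub>R y)) (\<lambda>y v. f' (\<epsilon> *\<^sub>R y) (\<epsilon> *\<^sub>R v))"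
  using C1_deriv_compose[OF assms C1_deriv_bounded_linear[OF bounded_linear_scaleR_right]] .

lemma continuous_scale:
  fixes \<epsilon> :: real
  assumes "continuous_on UNIV f"
  shows "continuous_on UNIV (\<lambda>y::'a::real_normed_vector. f (\<epsilon> *\<^sub>R y))"
  by (rule continuous_on_compose2[OF assms]) (simp_all add: continuous_on_scaleR continuous_on_id)

lemma continuous_u: "continuous_on UNIV (u \<epsilon>)"
  unfolding u_def by (rule continuous_scale[OF C1_deriv_continuous[OF U']])

lemma u_invariant: "m \<in> M \<Longrightarrow> u \<epsilon> y *v m \<in> M"
  unfolding u_def by (intro invariant U_in)

lemma continuous_\<kappa>: "continuous_on UNIV (\<kappa> \<epsilon>)"
  unfolding \<kappa>_def
  by (rule continuous_on_mult[OF continuous_mollifier continuous_scale[OF C1_continuous[OF C1_D]]])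

lemma \<kappa>_eq_0: "norm y > 1 \<Longrightarrow> \<kappa> \<epsilon> y = 0"
  by (simp add: \<kappa>_def mollifier_eq_0)

lemma kern_eq_0: "norm y > 1 \<Longrightarrow> kern c c' \<epsilon> y = 0"
  by (simp add: kern_def mollifier_eq_0 mollifier'_eq_0)

lemma continuous_kern:
  assumes "C1_deriv c c'"
  shows "continuous_on UNIV (kern c c' \<epsilon>)"
proof -
  have "continuous_on UNIV (\<lambda>y. mollifier' y (c (\<epsilon> *\<^sub>R y)))"
    by (rule C1_deriv_continuous_joint[OF C1_deriv_mollifier continuous_on_id
        continuous_scale[OF C1_deriv_continuous[OF assms]]])
  from continuous_on_mult[OF this continuous_on_const[of _ "1 / \<epsilon>"]]
  have "continuous_on UNIV (\<lambda>y. mollifier' y (c (\<epsilon> *\<^sub>R y)) / \<epsilon>)" by simp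
  then show ?thesis
    unfolding kern_def
    by (intro continuous_on_add continuous_on_mult[OF continuous_mollifier
        continuous_scale[OF continuous_on_divergence[OF assms]]])
qed

text \<open>Differentiating c(\<epsilon> y) yields a factor \<epsilon> that cancels 1/\<epsilon>,
  whereas the derivative of the mollifier keeps 1/\<epsilon>. Hence the kernel may blow up as
  \<epsilon> \<rightarrow> 0 unless c vanishes at 0.\<close>

lemma kern_divergence:
  assumes c: "C1_deriv c c'" and "\<epsilon> \<noteq> 0"
  obtains w' where "C1_deriv (\<lambda>y. (mollifier y / \<epsilon>) *\<^sub>R c (\<epsilon> *\<^sub>R y)) w'" "divergence w' = kern c c' \<epsilon>"
proof
  define w' where "w' y v = (mollifier y / \<epsilon>) *\<^sub>R c' (\<epsilon> *\<^sub>R y) (\<epsilon> *\<^sub>R v) +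
    (mollifier' y v / \<epsilon>) *\<^sub>R c (\<epsilon> *\<^sub>R y)" for y v
  have "C1_deriv (\<lambda>y::real^('n \<times> 'n). (1 / \<epsilon>) *\<^sub>R mollifier y) (\<lambda>y v. (1 / \<epsilon>) *\<^sub>R mollifier' y v)"
    by (rule C1_deriv_cmult[OF C1_deriv_mollifier])
  then have "C1_deriv (\<lambda>y::real^('n \<times> 'n). mollifier y / \<epsilon>) (\<lambda>y v. mollifier' y v / \<epsilon>)"
    by simp
  from C1_deriv_bilinear[OF bounded_bilinear_scaleR this C1_deriv_scale[OF c]]
  show "C1_deriv (\<lambda>y. (mollifier y / \<epsilon>) *\<^sub>R c (\<epsilon> *\<^sub>R y)) w'"
    unfolding w'_def[abs_def] .
  show "divergence w' = kern c c' \<epsilon>"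
  proof
    fix y
    have "divergence w' y = (\<Sum>b\<in>Basis. mollifier y * (c' (\<epsilon> *\<^sub>R y) b \<bullet> b)) +
        (\<Sum>b\<in>Basis. (c (\<epsilon> *\<^sub>R y) \<bullet> b) *\<^sub>R mollifier' y b) / \<epsilon>"
      unfolding divergence_def w'_def sum_divide_distrib sum.distrib[symmetric]
      using assms(2)
      by (intro sum.cong refl)
        (simp add: inner_add_left linear_scale[OF C1_deriv_linear[OF c]] field_simps)
    also have "\<dots> = kern c c' \<epsilon> y"
      unfolding C1_deriv_basis_sum[OF C1_deriv_mollifier, of y "c (\<epsilon> *\<^sub>R y)", symmetric]
      by (simp add: kern_def divergence_def sum_distrib_left sum_divide_distrib add_divide_distrib mult_ac)
    finally show "divergence w' y = kern c c' \<epsilon> y" .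
  qed
qed

text \<open>Partial integration against the constant function 1: the kernel is the divergence of a
  compactly supported field.\<close>

lemma kern_integral:
  assumes "C1_deriv c c'" "\<epsilon> \<noteq> 0"
  shows "integral big_box (kern c c' \<epsilon>) = 0"
proof -
  obtain w' where w': "C1_deriv (\<lambda>y. (mollifier y / \<epsilon>) *\<^sub>R c (\<epsilon> *\<^sub>R y)) w'" "divergence w' = kern c c' \<epsilon>"
    by (rule kern_divergence[OF assms])
  have "integral big_box (\<lambda>y::real^('n \<times> 'n). 0::real) = - integral big_box (\<lambda>y. divergence w' y *\<^sub>R 1)"
    by (rule divergence_integral_zero[OF w'(1) _ C1_deriv_const]) (simp add: mollifier_eq_0)
  then show ?thesis by (simp add: w'(2))
qed

text \<open>The left integrand is the derivative of y \<mapsto> F(U(\<epsilon> y) z) along the field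
  mollifier(y)/\<epsilon> c(\<epsilon> y): the factor \<epsilon> of the chain rule cancels, and the
  defining property of c turns mollifier times D into \<kappa>. For |y| > 1 both sides vanish, so
  the lifting is used only inside its radius \<delta>.\<close>

lemma integration_by_parts:
  assumes c: "C1_deriv c c'" "\<And>x. norm x < \<delta> \<Longrightarrow> U' x (c x) = D x *\<^sub>R (U x ** Y x)"
    and \<epsilon>: "0 < \<epsilon>" "\<epsilon> < \<delta>" and F: "C1_deriv F F'"
  shows "integral big_box (\<lambda>y. \<kappa> \<epsilon> y *\<^sub>R F' (u \<epsilon> y *v z) ((u \<epsilon> y ** Y (\<epsilon> *\<^sub>R y)) *v z)) =
    - average (kern c c' \<epsilon>) (u \<epsilon>) F z"
proof -
  obtain w' where w': "C1_deriv (\<lambda>y. (mollifier y / \<epsilon>) *\<^sub>R c (\<epsilon> *\<^sub>R y)) w'" "divergence w' = kern c c' \<epsilon>"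
    by (rule kern_divergence[OF c(1), of \<epsilon>]) (use \<epsilon>(1) in auto)
  have "C1_deriv (\<lambda>y. U (\<epsilon> *\<^sub>R y) *v z) (\<lambda>y v. U' (\<epsilon> *\<^sub>R y) (\<epsilon> *\<^sub>R v) *v z)"
    by (rule C1_deriv_compose[OF C1_deriv_bounded_linear[OF matvec.bounded_linear_left] C1_deriv_scale[OF U']])
  note G = C1_deriv_compose[OF F this]
  have eq: "F' (U (\<epsilon> *\<^sub>R y) *v z) (U' (\<epsilon> *\<^sub>R y) (\<epsilon> *\<^sub>R ((mollifier y / \<epsilon>) *\<^sub>R c (\<epsilon> *\<^sub>R y))) *v z) =
      \<kappa> \<epsilon> y *\<^sub>R F' (u \<epsilon> y *v z) ((u \<epsilon> y ** Y (\<epsilon> *\<^sub>R y)) *v z)" for y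
  proof (cases "norm y \<le> 1")
    case True
    have "norm (\<epsilon> *\<^sub>R y) \<le> \<epsilon>" using True \<epsilon> by (simp add: mult_left_le)
    then have "norm (\<epsilon> *\<^sub>R y) < \<delta>" using \<epsilon> by linarith
    then have "U' (\<epsilon> *\<^sub>R y) (\<epsilon> *\<^sub>R ((mollifier y / \<epsilon>) *\<^sub>R c (\<epsilon> *\<^sub>R y))) =
        \<kappa> \<epsilon> y *\<^sub>R (U (\<epsilon> *\<^sub>R y) ** Y (\<epsilon> *\<^sub>R y))"
      using c(2) \<epsilon>(1) by (simp add: linear_scale[OF C1_deriv_linear[OF U']] \<kappa>_def)
    then show ?thesis
      by (simp add: matvec.scaleR_left linear_scale[OF C1_deriv_linear[OF F]] u_def)
  next
    case False
    then show ?thesis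
      by (simp add: mollifier_eq_0 \<kappa>_eq_0 linear_0[OF C1_deriv_linear[OF F]] linear_0[OF C1_deriv_linear[OF U']])
  qed
  have "integral big_box (\<lambda>y. F' (U (\<epsilon> *\<^sub>R y) *v z)
      (U' (\<epsilon> *\<^sub>R y) (\<epsilon> *\<^sub>R ((mollifier y / \<epsilon>) *\<^sub>R c (\<epsilon> *\<^sub>R y))) *v z)) =
    - integral big_box (\<lambda>y. divergence w' y *\<^sub>R F (U (\<epsilon> *\<^sub>R y) *v z))"
    by (rule divergence_integral_zero[OF w'(1) _ G]) (simp add: mollifier_eq_0)
  then show ?thesis
    unfolding eq average_def u_def w'(2) .
qed

lemma vector_field_ex:
  assumes "C1 Y" "\<And>x. Y x \<in> span (lie_algebra G)"
  obtains c c' where "C1_deriv c c'" "Y 0 = 0 \<Longrightarrow> c 0 = 0"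
    "\<And>x. norm x < \<delta> \<Longrightarrow> U' x (c x) = D x *\<^sub>R (U x ** Y x)"
proof -
  obtain c where "C1 c" "Y 0 = 0 \<longrightarrow> c 0 = 0" "\<forall>x. norm x < \<delta> \<longrightarrow> U' x (c x) = D x *\<^sub>R (U x ** Y x)"
    using field[OF assms] by blast
  moreover then obtain c' where "C1_deriv c c'" unfolding C1_def by blast
  ultimately show ?thesis using that by blast
qed

text \<open>
  With \<open>T\<close> the averaging operator, \<open>kern c c'\<close> represents \<open>T d\<pi>(X)\<close>, and \<open>kern e e'\<close>
  the commutator \<open>d\<pi>(X) T - T d\<pi>(X)\<close>.
\<close>

lemma commutator_kernels:
  assumes X: "X \<in> lie_algebra G"
  obtains c c' e e' where "C1_deriv c c'" "C1_deriv e e'" "e 0 = 0"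
    "\<And>\<epsilon> F F' z. 0 < \<epsilon> \<Longrightarrow> \<epsilon> < \<delta> \<Longrightarrow> C1_deriv F F' \<Longrightarrow>
       average (\<kappa> \<epsilon>) (u \<epsilon>) (\<lambda>z. - F' z (X *v z)) z = average (kern c c' \<epsilon>) (u \<epsilon>) F z"
    "\<And>\<epsilon> F F' z. 0 < \<epsilon> \<Longrightarrow> \<epsilon> < \<delta> \<Longrightarrow> C1_deriv F F' \<Longrightarrow>
       average_deriv (\<kappa> \<epsilon>) (u \<epsilon>) F' X z =
         average (kern c c' \<epsilon>) (u \<epsilon>) F z + average (kern e e' \<epsilon>) (u \<epsilon>) F z"
proof -
  have UV: "U x ** V x = mat 1" for x using VU matrix_left_right_inverse by blast
  \<comment> \<open>Conjugation rewrites X U as U Y, the shape that lifts to the coordinates. T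
    d\<pi>(X) carries the field X U and d\<pi>(X) T the field U X, so the commutator has the field U
    (X - Y); it vanishes at 0 because Y(0) = X.\<close>
  define Y where "Y x = V x ** X ** U x" for x
  have UY: "U x ** Y x = X ** U x" for x
    by (simp add: Y_def matrix_mul_assoc UV)
  have C1_U: "C1 U" unfolding C1_def using U' by blast
  have C1_Y: "C1 Y" unfolding Y_def by (intro C1_matrix_mult C1_V C1_const C1_U)
  have Y_in: "Y x \<in> span (lie_algebra G)" for x
    unfolding Y_def by (intro span_base conj X)
  have Y_0: "Y 0 = X" using VU[of 0] by (simp add: Y_def U_0)
  obtain c c' where c: "C1_deriv c c'" "\<And>x. norm x < \<delta> \<Longrightarrow> U' x (c x) = D x *\<^sub>R (U x ** Y x)"
    using vector_field_ex[OF C1_Y Y_in] by blast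
  have "C1 (\<lambda>x. X - Y x)" by (intro C1_diff C1_const C1_Y)
  then obtain e e' where e: "C1_deriv e e'" "e 0 = 0"
      "\<And>x. norm x < \<delta> \<Longrightarrow> U' x (e x) = D x *\<^sub>R (U x ** (X - Y x))"
    by (rule vector_field_ex) (auto intro: span_diff Y_in span_base X simp: Y_0)
  have first: "average (\<kappa> \<epsilon>) (u \<epsilon>) (\<lambda>z. - F' z (X *v z)) z = average (kern c c' \<epsilon>) (u \<epsilon>) F z"
    if "0 < \<epsilon>" "\<epsilon> < \<delta>" "C1_deriv F F'" for \<epsilon> F F' z
  proof -
    have "average (\<kappa> \<epsilon>) (u \<epsilon>) (\<lambda>z. - F' z (X *v z)) z =
        - integral big_box (\<lambda>y. \<kappa> \<epsilon> y *\<^sub>R F' (u \<epsilon> y *v z) (X *v (u \<epsilon> y *v z)))"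
      unfolding average_def by simp
    also have "(\<lambda>y. \<kappa> \<epsilon> y *\<^sub>R F' (u \<epsilon> y *v z) (X *v (u \<epsilon> y *v z))) =
        (\<lambda>y. \<kappa> \<epsilon> y *\<^sub>R F' (u \<epsilon> y *v z) ((u \<epsilon> y ** Y (\<epsilon> *\<^sub>R y)) *v z))"
      by (simp add: u_def UY matrix_vector_mul_assoc)
    also have "- integral big_box \<dots> = average (kern c c' \<epsilon>) (u \<epsilon>) F z"
      using integration_by_parts[OF c that] by simp
    finally show ?thesis .
  qed
  show ?thesis
  proof (rule that[of c c' e e'])
    show "C1_deriv c c'" "C1_deriv e e'" "e 0 = 0" by fact+
    show "average (\<kappa> \<epsilon>) (u \<epsilon>) (\<lambda>z. - F' z (X *v z)) z = average (kern c c' \<epsilon>) (u \<epsilon>) F z"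
      if "0 < \<epsilon>" "\<epsilon> < \<delta>" "C1_deriv F F'" for \<epsilon> F F' z
      by (rule first[OF that])
  next
    fix \<epsilon> z and F :: "real^'n \<Rightarrow> complex" and F' assume a: "0 < \<epsilon>" "\<epsilon> < \<delta>" "C1_deriv F F'"
    have lin: "linear (F' z)" for z using C1_deriv_linear[OF a(3)] .
    have cont: "continuous_on UNIV (\<lambda>y. \<kappa> \<epsilon> y *\<^sub>R F' (u \<epsilon> y *v z) (A y *v z))" if "continuous_on UNIV A" for A
      by (intro continuous_on_scaleR continuous_\<kappa> C1_deriv_continuous_joint[OF a(3)] matvec_continuous_left
          continuous_u that)
    have cont_Y: "continuous_on UNIV (\<lambda>y. Y (\<epsilon> *\<^sub>R y))"
      by (rule continuous_scale[OF C1_continuous[OF C1_Y]])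
    have "average_deriv (\<kappa> \<epsilon>) (u \<epsilon>) F' X z = - integral big_box (\<lambda>y.
        \<kappa> \<epsilon> y *\<^sub>R F' (u \<epsilon> y *v z) ((u \<epsilon> y ** Y (\<epsilon> *\<^sub>R y)) *v z) +
        \<kappa> \<epsilon> y *\<^sub>R F' (u \<epsilon> y *v z) ((u \<epsilon> y ** (X - Y (\<epsilon> *\<^sub>R y))) *v z))"
      unfolding average_deriv_def scaleR_add_right[symmetric] linear_add[OF lin, symmetric]
        matvec.add_left[symmetric] matmul.add_right[symmetric]
      by (simp add: matrix_vector_mul_assoc)
    also have "\<dots> = - (integral big_box (\<lambda>y. \<kappa> \<epsilon> y *\<^sub>R F' (u \<epsilon> y *v z) ((u \<epsilon> y ** Y (\<epsilon> *\<^sub>R y)) *v z)) +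
        integral big_box (\<lambda>y. \<kappa> \<epsilon> y *\<^sub>R F' (u \<epsilon> y *v z) ((u \<epsilon> y ** (X - Y (\<epsilon> *\<^sub>R y))) *v z)))"
      by (intro arg_cong[of _ _ uminus] integral_add continuous_integrable_big_box cont matmul.continuous_on
          continuous_u cont_Y continuous_on_diff continuous_on_const)
    also have "\<dots> = average (kern c c' \<epsilon>) (u \<epsilon>) F z + average (kern e e' \<epsilon>) (u \<epsilon>) F z"
      using integration_by_parts[OF c a] integration_by_parts[OF e(1,3) a] by simp
    finally show "average_deriv (\<kappa> \<epsilon>) (u \<epsilon>) F' X z =
         average (kern c c' \<epsilon>) (u \<epsilon>) F z + average (kern e e' \<epsilon>) (u \<epsilon>) F z" .
  qed
qed

end

lemma norm_difference_quotient_triangle: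
  fixes a b c a' b' c' :: "'a::real_normed_vector"
  shows "norm (a - b - h *\<^sub>R c) \<le>
    norm (a' - b' - h *\<^sub>R c') + norm (a - a') + norm (b - b') + \<bar>h\<bar> * norm (c - c')"
proof -
  have "a - b - h *\<^sub>R c = (a' - b' - h *\<^sub>R c') + (a - a') - (b - b') - h *\<^sub>R (c - c')"
    by (simp add: algebra_simps)
  also have "norm \<dots> \<le> norm (a' - b' - h *\<^sub>R c') + norm (a - a') + norm (b - b') + norm (h *\<^sub>R (c - c'))"
    by (intro order_trans[OF norm_triangle_ineq4] add_right_mono norm_triangle_ineq)
  finally show ?thesis by simp
qed

section \<open>Kernels and averages as \<epsilon> tends to 0, and averages of generator
  values\<close>

context action_chart
begin

text \<open>Since e is differentiable at 0 with e(0) = 0, |e(\<epsilon> y)| is at most (L + 1)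
  \<epsilon> on the unit ball for small \<epsilon>, which cancels the factor 1/\<epsilon> in front
  of the derivative of the mollifier.\<close>

lemma kern_bound:
  assumes e: "C1_deriv e e'" "e 0 = 0"
  obtains B where "\<forall>\<^sub>F \<epsilon> in at_right 0. \<forall>y. \<bar>kern e e' \<epsilon> y\<bar> \<le> B"
proof -
  obtain B0 where B0: "B0 > 0" "\<And>y::real^('n \<times> 'n). \<bar>mollifier y\<bar> \<le> B0"
    "\<And>y v::real^('n \<times> 'n). \<bar>mollifier' y v\<bar> \<le> B0 * norm v"
    using mollifier_bounds[where 'a="real^('n \<times> 'n)"] by blast
  have "bounded (divergence e' ` cball 0 1)"
    by (intro compact_imp_bounded compact_continuous_image continuous_on_divergence[OF e(1)]) auto
  then obtain Bd where Bd: "\<And>x. x \<in> cball 0 1 \<Longrightarrow> \<bar>divergence e' x\<bar> \<le> Bd"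
    unfolding bounded_iff by (metis imageI real_norm_def)
  have Bd0: "Bd \<ge> 0" using Bd[of 0] by auto
  have der: "(e has_derivative e' 0) (at 0)" by (rule C1_derivD[OF e(1)])
  obtain L where L: "\<And>x. norm (e' 0 x) \<le> norm x * L" "L > 0"
    using bounded_linear.pos_bounded[OF has_derivative_bounded_linear[OF der]] by blast
  obtain r where r: "r > 0" "\<And>x. norm x < r \<Longrightarrow> norm (e x - e' 0 x) \<le> norm x"
    using der[unfolded has_derivative_at_alt] e(2) by (auto dest: spec[of _ 1])
  have e_le: "norm (e x) \<le> (L + 1) * norm x" if "norm x < r" for x
    using r(2)[OF that] L(1)[of x] norm_triangle_sub[of "e x" "e' 0 x"] by (simp add: algebra_simps)
  have "\<bar>kern e e' \<epsilon> y\<bar> \<le> B0 * Bd + B0 * (L + 1)" if \<epsilon>: "0 < \<epsilon>" "\<epsilon> < min 1 r" for \<epsilon> y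
  proof (cases "norm y \<le> 1")
    case True
    have le: "norm (\<epsilon> *\<^sub>R y) \<le> \<epsilon>" using True \<epsilon> by (simp add: mult_left_le)
    have "\<bar>mollifier' y (e (\<epsilon> *\<^sub>R y))\<bar> \<le> B0 * norm (e (\<epsilon> *\<^sub>R y))" by (rule B0)
    also have "\<dots> \<le> B0 * ((L + 1) * \<epsilon>)"
    proof (intro mult_left_mono)
      have "norm (\<epsilon> *\<^sub>R y) < r" using le \<epsilon> by linarith
      then have "norm (e (\<epsilon> *\<^sub>R y)) \<le> (L + 1) * norm (\<epsilon> *\<^sub>R y)" by (rule e_le)
      also have "\<dots> \<le> (L + 1) * \<epsilon>" using le L(2) by (intro mult_left_mono) auto
      finally show "norm (e (\<epsilon> *\<^sub>R y)) \<le> (L + 1) * \<epsilon>" .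
    qed (use B0 in auto)
    finally have "\<bar>mollifier' y (e (\<epsilon> *\<^sub>R y)) / \<epsilon>\<bar> \<le> B0 * (L + 1)"
      using \<epsilon> by (simp add: pos_divide_le_eq mult_ac)
    moreover have "norm (\<epsilon> *\<^sub>R y) \<le> 1" using le \<epsilon> by linarith
    then have "\<epsilon> *\<^sub>R y \<in> cball 0 1" by (simp only: mem_cball_0)
    then have "\<bar>mollifier y * divergence e' (\<epsilon> *\<^sub>R y)\<bar> \<le> B0 * Bd"
      unfolding abs_mult using B0(1) by (intro mult_mono B0(2) Bd) auto
    ultimately show ?thesis unfolding kern_def by linarith
  next
    case False
    then show ?thesis using kern_eq_0[of y] B0(1) Bd0 L(2) by simp
  qed
  moreover have "\<forall>\<^sub>F \<epsilon> in at_right 0. 0 < \<epsilon> \<and> \<epsilon> < min 1 r"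
    using r(1) by (auto simp: eventually_at_right_field intro!: exI[of _ "min 1 r"])
  ultimately show ?thesis
    using that[of "B0 * Bd + B0 * (L + 1)"] by (simp add: eventually_mono)
qed

lemma small_dilation:
  fixes f :: "real^('n \<times> 'n) \<Rightarrow> 'b::metric_space"
  assumes "continuous_on UNIV f" "d > 0"
  shows "\<forall>\<^sub>F \<epsilon> in at_right 0. \<forall>y. norm y \<le> 1 \<longrightarrow> dist (f (\<epsilon> *\<^sub>R y)) (f 0) < d"
proof -
  have "isCont f 0" using assms(1) by (simp add: continuous_on_eq_continuous_at)
  then obtain r where r: "r > 0" "\<And>x. dist x 0 < r \<Longrightarrow> dist (f x) (f 0) < d"
    using assms(2) unfolding continuous_at_eps_delta by blast
  have "dist (f (\<epsilon> *\<^sub>R y)) (f 0) < d" if "0 < \<epsilon>" "\<epsilon> < r" "norm y \<le> 1" for \<epsilon> y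
  proof (rule r(2))
    have "norm (\<epsilon> *\<^sub>R y) \<le> \<epsilon>" using that by (simp add: mult_left_le)
    then show "dist (\<epsilon> *\<^sub>R y) 0 < r" using that(2) unfolding dist_0_norm dist_norm by simp
  qed
  then show ?thesis
    unfolding eventually_at_right_field using r(1) by (intro exI[of _ r]) auto
qed

lemma \<kappa>_bound:
  obtains B where "\<forall>\<^sub>F \<epsilon> in at_right 0. \<forall>y. \<bar>\<kappa> \<epsilon> y\<bar> \<le> B"
proof -
  obtain B0 where B0: "B0 > 0" "\<And>y::real^('n \<times> 'n). \<bar>mollifier y\<bar> \<le> B0"
    "\<And>y v::real^('n \<times> 'n). \<bar>mollifier' y v\<bar> \<le> B0 * norm v"
    using mollifier_bounds[where 'a="real^('n \<times> 'n)"] by blast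
  have "\<forall>\<^sub>F \<epsilon> in at_right 0. \<forall>y. norm y \<le> 1 \<longrightarrow> dist (D (\<epsilon> *\<^sub>R y)) (D 0) < 1"
    by (intro small_dilation C1_continuous[OF C1_D]) simp
  then have "\<forall>\<^sub>F \<epsilon> in at_right 0. \<forall>y. \<bar>\<kappa> \<epsilon> y\<bar> \<le> B0 * 2"
  proof eventually_elim
    case (elim \<epsilon>)
    show ?case
    proof
      fix y
      show "\<bar>\<kappa> \<epsilon> y\<bar> \<le> B0 * 2"
      proof (cases "norm y \<le> 1")
        case True
        then have "\<bar>D (\<epsilon> *\<^sub>R y) - 1\<bar> < 1" using elim by (simp add: D_0 dist_real_def)
        then have "\<bar>D (\<epsilon> *\<^sub>R y)\<bar> \<le> 2" by linarith
        then show ?thesis unfolding \<kappa>_def abs_mult using B0 by (intro mult_mono) auto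
      next
        case False
        then show ?thesis using \<kappa>_eq_0[of y] B0(1) by simp
      qed
    qed
  qed
  then show ?thesis using that by blast
qed

lemma \<kappa>_integral: "((\<lambda>\<epsilon>. integral big_box (\<kappa> \<epsilon>)) \<longlongrightarrow> 1) (at_right 0)"
proof (rule tendstoI)
  fix e :: real assume "e > 0"
  let ?v = "measure lborel (big_box :: (real^('n \<times> 'n)) set)"
  obtain B0 where B0: "B0 > 0" "\<And>y::real^('n \<times> 'n). \<bar>mollifier y\<bar> \<le> B0"
    "\<And>y v::real^('n \<times> 'n). \<bar>mollifier' y v\<bar> \<le> B0 * norm v"
    using mollifier_bounds[where 'a="real^('n \<times> 'n)"] by blast
  define d where "d = e / (2 * (B0 * ?v + 1))"
  have pos: "B0 * ?v + 1 > 0" using B0(1) by (simp add: add_nonneg_pos)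
  have d: "d > 0" "B0 * d * ?v < e"
  proof -
    show "d > 0" using \<open>e > 0\<close> pos by (simp add: d_def)
    have "B0 * d * ?v \<le> d * (B0 * ?v + 1)" using \<open>d > 0\<close> by (simp add: algebra_simps)
    also have "\<dots> = e / 2" using pos by (simp add: d_def field_simps)
    also have "\<dots> < e" using \<open>e > 0\<close> by simp
    finally show "B0 * d * ?v < e" .
  qed
  have "\<forall>\<^sub>F \<epsilon> in at_right 0. \<forall>y. norm y \<le> 1 \<longrightarrow> dist (D (\<epsilon> *\<^sub>R y)) (D 0) < d"
    by (intro small_dilation C1_continuous[OF C1_D] d)
  then show "\<forall>\<^sub>F \<epsilon> in at_right 0. dist (integral big_box (\<kappa> \<epsilon>)) 1 < e"
  proof eventually_elim
    case (elim \<epsilon>)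
    have "integral big_box (\<kappa> \<epsilon>) - 1 = integral big_box (\<lambda>y. \<kappa> \<epsilon> y - mollifier y)"
      by (simp add: integral_diff continuous_integrable_big_box continuous_\<kappa> continuous_mollifier integral_mollifier)
    also have "norm \<dots> \<le> B0 * d * ?v"
    proof (rule norm_integral_big_box_le)
      show "continuous_on UNIV (\<lambda>y. \<kappa> \<epsilon> y - mollifier y)"
        by (intro continuous_on_diff continuous_\<kappa> continuous_mollifier)
      show "norm (\<kappa> \<epsilon> y - mollifier y) \<le> B0 * d" for y
      proof (cases "norm y \<le> 1")
        case True
        have "\<kappa> \<epsilon> y - mollifier y = mollifier y * (D (\<epsilon> *\<^sub>R y) - 1)" by (simp add: \<kappa>_def algebra_simps)
        moreover have "\<bar>D (\<epsilon> *\<^sub>R y) - 1\<bar> \<le> d" using elim True by (simp add: D_0 dist_real_def less_imp_le)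
        ultimately show ?thesis using B0 by (simp add: abs_mult mult_mono)
      next
        case False
        then show ?thesis using \<kappa>_eq_0[of y] mollifier_eq_0[of y] B0(1) d(1) by simp
      qed
    qed
    finally show ?case using d(2) by (simp add: dist_norm)
  qed
qed

text \<open>Split into the integral of k(y) (\<phi>(u(y) m) - \<phi>(m)), small by strong
  continuity, and the defect of the total mass times \<phi>(m). It serves twice: s = 1 for the
  approximate identity \<kappa> and s = 0 for the commutator kernel.\<close>

lemma average_limit:
  assumes k: "\<And>\<epsilon>. continuous_on UNIV (k \<epsilon>)" "\<And>\<epsilon> y. norm y > 1 \<Longrightarrow> k \<epsilon> y = 0"
    "\<forall>\<^sub>F \<epsilon> in at_right 0. \<forall>y. \<bar>k \<epsilon> y\<bar> \<le> B" "((\<lambda>\<epsilon>. integral big_box (k \<epsilon>)) \<longlongrightarrow> s) (at_right 0)"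
    and \<phi>: "c0 M \<phi>" and "e > 0"
  shows "\<forall>\<^sub>F \<epsilon> in at_right 0. \<forall>m\<in>M. norm (average (k \<epsilon>) (u \<epsilon>) \<phi> m - s *\<^sub>R \<phi> m) \<le> e"
proof -
  let ?v = "measure lborel (big_box :: (real^('n \<times> 'n)) set)"
  obtain C where C: "C > 0" "\<And>m. m \<in> M \<Longrightarrow> norm (\<phi> m) \<le> C" using c0_bounded[OF closed_M \<phi>] by blast
  define d where "d = e / (2 * (\<bar>B\<bar> * ?v + 1))"
  have pos: "\<bar>B\<bar> * ?v + 1 > 0" by (simp add: add_nonneg_pos)
  have d: "d > 0" "\<bar>B\<bar> * d * ?v \<le> e / 2"
  proof -
    show "d > 0" using \<open>e > 0\<close> pos by (simp add: d_def)
    have "\<bar>B\<bar> * d * ?v \<le> d * (\<bar>B\<bar> * ?v + 1)" using \<open>d > 0\<close> by (simp add: algebra_simps)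
    also have "\<dots> = e / 2" using pos by (simp add: d_def field_simps)
    finally show "\<bar>B\<bar> * d * ?v \<le> e / 2" .
  qed
  obtain r where r: "r > 0" "\<And>g m. norm (g - mat 1) < r \<Longrightarrow> m \<in> M \<Longrightarrow> g *v m \<in> M \<Longrightarrow> norm (\<phi> (g *v m) - \<phi> m) < d"
    using strong_continuity[OF closed_M \<phi> d(1)] by blast
  have ev1: "\<forall>\<^sub>F \<epsilon> in at_right 0. \<forall>y. norm y \<le> 1 \<longrightarrow> dist (U (\<epsilon> *\<^sub>R y)) (U 0) < r"
    by (intro small_dilation C1_deriv_continuous[OF U'] r)
  have "e / (2 * C) > 0" using \<open>e > 0\<close> C(1) by simp
  with k(4) have ev2: "\<forall>\<^sub>F \<epsilon> in at_right 0. dist (integral big_box (k \<epsilon>)) s < e / (2 * C)"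
    by (rule tendstoD)
  from ev1 ev2 k(3) show ?thesis
  proof eventually_elim
    case (elim \<epsilon>)
    show ?case
    proof
      fix m assume m: "m \<in> M"
      have cont_\<phi>: "continuous_on UNIV (\<lambda>y. \<phi> (u \<epsilon> y *v m))"
        by (rule c0_compose_continuous[OF \<phi> continuous_u u_invariant[OF m]])
      have "integral big_box (k \<epsilon>) *\<^sub>R \<phi> m = integral big_box (\<lambda>y. k \<epsilon> y *\<^sub>R \<phi> m)"
        using integral_linear[OF continuous_integrable_big_box[OF k(1)[of \<epsilon>]] bounded_linear_scaleR_left[of "\<phi> m"]]
        by (simp add: o_def)
      then have "average (k \<epsilon>) (u \<epsilon>) \<phi> m - s *\<^sub>R \<phi> m =
          (integral big_box (\<lambda>y. k \<epsilon> y *\<^sub>R \<phi> (u \<epsilon> y *v m)) - integral big_box (\<lambda>y. k \<epsilon> y *\<^sub>R \<phi> m))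
          + (integral big_box (k \<epsilon>) - s) *\<^sub>R \<phi> m"
        by (simp add: average_def scaleR_diff_left)
      also have "integral big_box (\<lambda>y. k \<epsilon> y *\<^sub>R \<phi> (u \<epsilon> y *v m)) - integral big_box (\<lambda>y. k \<epsilon> y *\<^sub>R \<phi> m) =
          integral big_box (\<lambda>y. k \<epsilon> y *\<^sub>R (\<phi> (u \<epsilon> y *v m) - \<phi> m))"
        unfolding scaleR_diff_right
        by (intro integral_diff[symmetric] continuous_integrable_big_box continuous_on_scaleR k(1) cont_\<phi> continuous_on_const)
      also have "norm (\<dots> + (integral big_box (k \<epsilon>) - s) *\<^sub>R \<phi> m) \<le> \<bar>B\<bar> * d * ?v + e / (2 * C) * C"
      proof (intro norm_triangle_le add_mono)
        show "norm (integral big_box (\<lambda>y. k \<epsilon> y *\<^sub>R (\<phi> (u \<epsilon> y *v m) - \<phi> m))) \<le> \<bar>B\<bar> * d * ?v"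
        proof (rule norm_integral_big_box_le)
          show "continuous_on UNIV (\<lambda>y. k \<epsilon> y *\<^sub>R (\<phi> (u \<epsilon> y *v m) - \<phi> m))"
            by (intro continuous_on_scaleR k(1) continuous_on_diff cont_\<phi> continuous_on_const)
          show "norm (k \<epsilon> y *\<^sub>R (\<phi> (u \<epsilon> y *v m) - \<phi> m)) \<le> \<bar>B\<bar> * d" for y
          proof (cases "norm y \<le> 1")
            case True
            have "norm (u \<epsilon> y - mat 1) < r" using elim(1) True by (simp add: u_def U_0 dist_norm)
            then have "norm (\<phi> (u \<epsilon> y *v m) - \<phi> m) \<le> d" using r(2) m u_invariant less_imp_le by blast
            moreover have "\<bar>k \<epsilon> y\<bar> \<le> \<bar>B\<bar>" using elim(3) abs_ge_self[of B] order_trans by blast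
            ultimately show ?thesis unfolding norm_scaleR by (intro mult_mono) auto
          next
            case False
            then show ?thesis using k(2)[of y \<epsilon>] d(1) by simp
          qed
        qed
        show "norm ((integral big_box (k \<epsilon>) - s) *\<^sub>R \<phi> m) \<le> e / (2 * C) * C"
          unfolding norm_scaleR using elim(2) C m \<open>e > 0\<close>
          by (intro mult_mono) (auto simp: dist_real_def)
      qed
      also have "\<dots> \<le> e" using d(2) C(1) by simp
      finally show "norm (average (k \<epsilon>) (u \<epsilon>) \<phi> m - s *\<^sub>R \<phi> m) \<le> e" .
    qed
  qed
qed

text \<open>The flow of X commutes with X, so the derivative in t is again the field X applied to a
  function composed with the flow, and the kernel identity can be used for that composed function at
  every t.\<close>

lemma average_flow_gauss:
  assumes F: "C1_deriv F F'"
    and k: "\<And>F F' z. C1_deriv F F' \<Longrightarrow>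
       average (\<kappa> \<epsilon>) (u \<epsilon>) (\<lambda>z. - F' z (X *v z)) z = average k (u \<epsilon>) F z"
  shows "((\<lambda>t. average (\<kappa> \<epsilon>) (u \<epsilon>) (\<lambda>z. F (matrix_exp ((- t) *\<^sub>R X) *v z)) m) has_vector_derivative
    average k (u \<epsilon>) (\<lambda>z. F (matrix_exp ((- t) *\<^sub>R X) *v z)) m) (at t)"
proof -
  let ?E = "\<lambda>t. matrix_exp ((- t) *\<^sub>R X)"
  have comm: "X ** ?E t = ?E t ** X" for t by (rule matrix_exp_commute)
  have "((\<lambda>t. integral (cbox (- 2 *\<^sub>R One) (2 *\<^sub>R One)) (\<lambda>y. \<kappa> \<epsilon> y *\<^sub>R F (?E t *v (u \<epsilon> y *v m))))
      has_vector_derivative integral (cbox (- 2 *\<^sub>R One) (2 *\<^sub>R One))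
        (\<lambda>y. \<kappa> \<epsilon> y *\<^sub>R - F' (?E t *v (u \<epsilon> y *v m)) (X *v (?E t *v (u \<epsilon> y *v m))))) (at t within UNIV)"
  proof (rule leibniz_rule_vector_derivative)
    show "((\<lambda>t. \<kappa> \<epsilon> y *\<^sub>R F (?E t *v (u \<epsilon> y *v m))) has_vector_derivative
        \<kappa> \<epsilon> y *\<^sub>R - F' (?E t *v (u \<epsilon> y *v m)) (X *v (?E t *v (u \<epsilon> y *v m)))) (at t within UNIV)" for t y
      by (rule bounded_linear.has_vector_derivative[OF bounded_linear_scaleR_right flow_has_vector_derivative[OF F]])
    have cont: "continuous_on UNIV (\<lambda>y. ?E t *v (u \<epsilon> y *v m))" for t
      by (intro matvec.continuous_on continuous_on_const continuous_u)
    have "continuous_on UNIV (\<lambda>y. \<kappa> \<epsilon> y *\<^sub>R F (?E t *v (u \<epsilon> y *v m)))" for t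
      by (intro continuous_on_scaleR continuous_\<kappa> continuous_on_compose2[OF C1_deriv_continuous[OF F, of UNIV] cont]) simp
    from continuous_integrable_big_box[OF this]
    show "(\<lambda>y. \<kappa> \<epsilon> y *\<^sub>R F (?E t *v (u \<epsilon> y *v m))) integrable_on cbox (- 2 *\<^sub>R One) (2 *\<^sub>R One)" for t
      by (simp add: big_box_def)
    have c1: "continuous_on (UNIV \<times> cbox (- 2 *\<^sub>R One) (2 *\<^sub>R One)) (\<lambda>s::real \<times> _. \<kappa> \<epsilon> (snd s))"
      by (rule continuous_on_compose2[OF continuous_\<kappa>[of \<epsilon>] continuous_on_snd[OF continuous_on_id]]) simp
    have c2: "continuous_on (UNIV \<times> cbox (- 2 *\<^sub>R One) (2 *\<^sub>R One)) (\<lambda>s::real \<times> _. u \<epsilon> (snd s))"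
      by (rule continuous_on_compose2[OF continuous_u[of \<epsilon>] continuous_on_snd[OF continuous_on_id]]) simp
    show "continuous_on (UNIV \<times> cbox (- 2 *\<^sub>R One) (2 *\<^sub>R One)) (\<lambda>(t, y).
        \<kappa> \<epsilon> y *\<^sub>R - F' (?E t *v (u \<epsilon> y *v m)) (X *v (?E t *v (u \<epsilon> y *v m))))"
      unfolding case_prod_unfold
      by (intro continuous_on_scaleR c1 continuous_on_minus C1_deriv_continuous_joint[OF F] matvec.continuous_on c2
          continuous_on_const continuous_on_matrix_exp continuous_on_fst continuous_on_id)
  qed auto
  moreover have "average k (u \<epsilon>) (\<lambda>z. F (?E t *v z)) m =
      integral big_box (\<lambda>y. \<kappa> \<epsilon> y *\<^sub>R - F' (?E t *v (u \<epsilon> y *v m)) (X *v (?E t *v (u \<epsilon> y *v m))))"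
  proof -
    have "?E t *v (X *v z) = X *v (?E t *v z)" for z
      by (simp only: matrix_vector_mul_assoc comm)
    then show ?thesis
      using k[OF C1_deriv_matrix_compose[OF F], of "?E t" m] by (simp add: average_def)
  qed
  ultimately show ?thesis
    by (simp add: average_def big_box_def)
qed

text \<open>No derivative occurs in the estimate, so it passes from Gaussian polynomials, where the
  mean value inequality applies, to every \<phi> vanishing at infinity. It says that -h in the flow
  costs h times the k-average, up to the oscillation of \<phi>.\<close>

lemma average_mean_value:
  assumes X: "X \<in> lie_algebra G" and \<phi>: "c0 M \<phi>" and m: "m \<in> M"
    and k: "\<And>F F' z. C1_deriv F F' \<Longrightarrow>
       average (\<kappa> \<epsilon>) (u \<epsilon>) (\<lambda>z. - F' z (X *v z)) z = average k (u \<epsilon>) F z"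
    and k_cont: "continuous_on UNIV k" and k_le: "\<And>y. \<bar>k y\<bar> \<le> Bk" and \<kappa>_le: "\<And>y. \<bar>\<kappa> \<epsilon> y\<bar> \<le> B\<kappa>"
    and B: "\<And>t m. \<bar>t\<bar> \<le> \<bar>h\<bar> \<Longrightarrow> m \<in> M \<Longrightarrow> norm (\<phi> (matrix_exp (t *\<^sub>R X) *v m) - \<phi> m) \<le> B"
  shows "norm (average (\<kappa> \<epsilon>) (u \<epsilon>) (\<lambda>z. \<phi> (matrix_exp ((- h) *\<^sub>R X) *v z)) m
    - average (\<kappa> \<epsilon>) (u \<epsilon>) \<phi> m - h *\<^sub>R average k (u \<epsilon>) \<phi> m)
    \<le> \<bar>h\<bar> * (Bk * measure lborel (big_box :: (real^('n \<times> 'n)) set) * B)"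
proof (rule field_le_epsilon)
  let ?v = "measure lborel (big_box :: (real^('n \<times> 'n)) set)"
  let ?E = "\<lambda>t. matrix_exp (t *\<^sub>R X)"
  fix e :: real assume "e > 0"
  have Bk0: "Bk \<ge> 0" and B\<kappa>0: "B\<kappa> \<ge> 0" using k_le[of 0] \<kappa>_le[of 0] by auto
  \<comment> \<open>Total weight of the approximation error: two \<kappa>-averages are replaced, the
    oscillation contributes 2|h| and the k-average |h|; the summand 1 keeps Q positive.\<close>
  define Q where "Q = 2 * (B\<kappa> * ?v) + 3 * (\<bar>h\<bar> * (Bk * ?v)) + 1"
  have Q: "Q > 0" unfolding Q_def using Bk0 B\<kappa>0 by (intro add_nonneg_pos add_nonneg_nonneg mult_nonneg_nonneg) auto
  define \<eta> where "\<eta> = e / Q"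
  have \<eta>: "\<eta> > 0" "Q * \<eta> = e" using \<open>e > 0\<close> Q by (auto simp: \<eta>_def)
  obtain p where p: "polynomial_function p" "\<And>m. m \<in> M \<Longrightarrow> norm (\<phi> m - gauss 1 p m) < \<eta>"
    using gauss_dense[OF closed_M \<phi> \<eta>(1)] by blast
  let ?F = "gauss 1 p"
  obtain p' where "C1_deriv p p'" using polynomial_function_derivative[OF p(1)] by blast
  then obtain F' where F': "C1_deriv ?F F'" using C1_deriv_gauss by blast
  have c0_F: "c0 M ?F" by (rule c0_gauss[OF p(1)]) simp
  have c0_flow: "c0 M (\<lambda>z. f (?E t *v z))" if "c0 M f" for f t
    by (rule c0_matrix_compose[OF that exp_invariant[OF X] matrix_exp_minus(1)])
  have F_le: "norm (?F (?E t *v m) - ?F m) \<le> B + 2 * \<eta>" if "\<bar>t\<bar> \<le> \<bar>h\<bar>" "m \<in> M" for t m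
  proof -
    have "?F (?E t *v m) - ?F m = (\<phi> (?E t *v m) - \<phi> m) - (\<phi> (?E t *v m) - ?F (?E t *v m)) + (\<phi> m - ?F m)" by simp
    also have "norm \<dots> \<le> norm (\<phi> (?E t *v m) - \<phi> m) + norm (\<phi> (?E t *v m) - ?F (?E t *v m)) + norm (\<phi> m - ?F m)"
      by (intro norm_triangle_le add_right_mono norm_triangle_ineq4)
    also have "\<dots> \<le> B + \<eta> + \<eta>"
      using B[OF that] p(2)[OF that(2)] p(2)[OF exp_invariant[OF X that(2)], of t] by (intro add_mono) auto
    finally show ?thesis by simp
  qed
  let ?a = "\<lambda>f. average (\<kappa> \<epsilon>) (u \<epsilon>) f m" and ?b = "\<lambda>f. average k (u \<epsilon>) f m"
  have mv: "norm (?a (\<lambda>z. ?F (?E (- h) *v z)) - ?a ?F - h *\<^sub>R ?b ?F) \<le> \<bar>h\<bar> * (Bk * ?v * (B + 2 * \<eta>))"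
  proof -
    have "norm (?a (\<lambda>z. ?F (?E (- h) *v z)) - ?a (\<lambda>z. ?F (?E (- 0) *v z)) - h *\<^sub>R ?b ?F) \<le> \<bar>h\<bar> * (Bk * ?v * (B + 2 * \<eta>))"
    proof (rule vector_mean_value)
      show "((\<lambda>t. ?a (\<lambda>z. ?F (?E (- t) *v z))) has_vector_derivative ?b (\<lambda>z. ?F (?E (- t) *v z))) (at t)" for t
        by (rule average_flow_gauss[OF F']) (rule k)
      show "norm (?b (\<lambda>z. ?F (?E (- t) *v z)) - ?b ?F) \<le> Bk * ?v * (B + 2 * \<eta>)" if "\<bar>t\<bar> \<le> \<bar>h\<bar>" for t
        by (rule average_diff_le[OF k_cont k_le continuous_u u_invariant[OF m] c0_flow[OF c0_F] c0_F])
          (rule F_le, use that in auto)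
    qed
    then show ?thesis by simp
  qed
  have d1: "norm (?a (\<lambda>z. \<phi> (?E (- h) *v z)) - ?a (\<lambda>z. ?F (?E (- h) *v z))) \<le> B\<kappa> * ?v * \<eta>"
    by (rule average_diff_le[OF continuous_\<kappa> \<kappa>_le continuous_u u_invariant[OF m] c0_flow[OF \<phi>] c0_flow[OF c0_F]])
      (intro less_imp_le p(2) exp_invariant[OF X])
  have d2: "norm (?a \<phi> - ?a ?F) \<le> B\<kappa> * ?v * \<eta>"
    by (rule average_diff_le[OF continuous_\<kappa> \<kappa>_le continuous_u u_invariant[OF m] \<phi> c0_F])
      (intro less_imp_le p(2))
  have d3: "norm (?b \<phi> - ?b ?F) \<le> Bk * ?v * \<eta>"
    by (rule average_diff_le[OF k_cont k_le continuous_u u_invariant[OF m] \<phi> c0_F])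
      (intro less_imp_le p(2))
  have "norm (?a (\<lambda>z. \<phi> (?E (- h) *v z)) - ?a \<phi> - h *\<^sub>R ?b \<phi>) \<le>
      norm (?a (\<lambda>z. ?F (?E (- h) *v z)) - ?a ?F - h *\<^sub>R ?b ?F) +
      norm (?a (\<lambda>z. \<phi> (?E (- h) *v z)) - ?a (\<lambda>z. ?F (?E (- h) *v z))) + norm (?a \<phi> - ?a ?F)
      + \<bar>h\<bar> * norm (?b \<phi> - ?b ?F)"
    by (rule norm_difference_quotient_triangle)
  also have "\<dots> \<le> \<bar>h\<bar> * (Bk * ?v * (B + 2 * \<eta>)) + B\<kappa> * ?v * \<eta> + B\<kappa> * ?v * \<eta> + \<bar>h\<bar> * (Bk * ?v * \<eta>)"
    by (rule add_mono[OF add_mono[OF add_mono[OF mv d1] d2] mult_left_mono[OF d3 abs_ge_zero]])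
  also have "\<dots> \<le> \<bar>h\<bar> * (Bk * ?v * B) + e"
  proof -
    have split: "a * (b * v * (B + 2 * \<eta>)) + c * v * \<eta> + c * v * \<eta> + a * (b * v * \<eta>) =
        a * (b * v * B) + (2 * (c * v) + 3 * (a * (b * v)) + 1) * \<eta> - \<eta>" for a b c v :: real
      by (simp add: algebra_simps)
    show ?thesis
      unfolding split \<eta>(2)[unfolded Q_def] using \<eta>(1) by linarith
  qed
  finally show "norm (?a (\<lambda>z. \<phi> (?E (- h) *v z)) - ?a \<phi> - h *\<^sub>R ?b \<phi>) \<le> \<bar>h\<bar> * (Bk * ?v * B) + e" .
qed

text \<open>Extends the kernel identity for T d\<pi>(X) from differentiable functions to the whole
  domain of the generator. The average of the difference quotient is close to that of \<psi> by
  definition, and close to the k-average of \<phi> by \<open>average_mean_value\<close>, once h is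
  so small that \<phi> oscillates little along the flow.\<close>

lemma average_generator:
  assumes X: "X \<in> lie_algebra G" and \<phi>: "\<phi> \<in> mspace (c0_space M)" and gen: "has_generator_value M X \<phi> \<psi>" and m: "m \<in> M"
    and k: "\<And>F F' z. C1_deriv F F' \<Longrightarrow>
       average (\<kappa> \<epsilon>) (u \<epsilon>) (\<lambda>z. - F' z (X *v z)) z = average k (u \<epsilon>) F z"
    and k_cont: "continuous_on UNIV k" and k_0: "\<And>y. norm y > 1 \<Longrightarrow> k y = 0"
  shows "average (\<kappa> \<epsilon>) (u \<epsilon>) \<psi> m = average k (u \<epsilon>) \<phi> m"
proof -
  let ?v = "measure lborel (big_box :: (real^('n \<times> 'n)) set)"
  let ?a = "\<lambda>f. average (\<kappa> \<epsilon>) (u \<epsilon>) f m" and ?b = "average k (u \<epsilon>) \<phi> m"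
  let ?E = "\<lambda>t. matrix_exp (t *\<^sub>R X)"
  have gen': "\<psi> \<in> mspace (c0_space M) \<and>
    (\<forall>\<epsilon>>0. \<exists>\<delta>>0. \<forall>h. 0 < \<bar>h\<bar> \<and> \<bar>h\<bar> < \<delta> \<longrightarrow>
       (\<forall>m\<in>M. norm ((\<phi> (?E (- h) *v m) - \<phi> m) /\<^sub>R h - \<psi> m) \<le> \<epsilon>))"
    by (rule iffD1[OF has_generator_value_iff gen]) (rule closed_M, erule exp_invariant[OF X], rule \<phi>)
  have c0: "c0 M \<phi>" "c0 M \<psi>"
    using \<phi> conjunct1[OF gen'] by (simp_all only: mspace_c0_space[OF closed_M])
  obtain Bk where Bk: "Bk \<ge> 0" "\<And>y. \<bar>k y\<bar> \<le> Bk" using bounded_kernel[OF k_cont k_0] by blast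
  obtain B\<kappa> where B\<kappa>: "B\<kappa> \<ge> 0" "\<And>y. \<bar>\<kappa> \<epsilon> y\<bar> \<le> B\<kappa>" using bounded_kernel[OF continuous_\<kappa> \<kappa>_eq_0] by blast
  have "norm (?a \<psi> - ?b) \<le> 0 + e" if "e > 0" for e
  proof -
    define Q where "Q = B\<kappa> * ?v + Bk * ?v + 1"
    have Q: "Q > 0" unfolding Q_def using Bk B\<kappa> by (intro add_nonneg_pos add_nonneg_nonneg mult_nonneg_nonneg) auto
    define \<eta> where "\<eta> = e / Q"
    have \<eta>: "\<eta> > 0" "Q * \<eta> = e" using \<open>e > 0\<close> Q by (auto simp: \<eta>_def)
    obtain d1 where d1: "d1 > 0" "\<And>h m. 0 < \<bar>h\<bar> \<Longrightarrow> \<bar>h\<bar> < d1 \<Longrightarrow> m \<in> M \<Longrightarrow>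
        norm ((\<phi> (?E (- h) *v m) - \<phi> m) /\<^sub>R h - \<psi> m) \<le> \<eta>"
      using conjunct2[OF gen', rule_format, OF \<eta>(1)] by blast
    obtain d2 where d2: "d2 > 0" "\<And>t m. \<bar>t\<bar> < d2 \<Longrightarrow> m \<in> M \<Longrightarrow> norm (\<phi> (?E t *v m) - \<phi> m) < \<eta>"
      using strong_continuity_exp[OF closed_M exp_invariant[OF X] c0(1) \<eta>(1)] by blast
    define h where "h = min d1 d2 / 2"
    have h: "h > 0" "h < d1" "h < d2" using d1(1) d2(1) by (auto simp: h_def min_def)
    let ?q = "\<lambda>z. (1 / h) *\<^sub>R (\<phi> (?E (- h) *v z) - \<phi> z)"
    have c0_flow: "c0 M (\<lambda>z. \<phi> (?E (- h) *v z))"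
      by (rule c0_matrix_compose[OF c0(1) exp_invariant[OF X] matrix_exp_minus(1)])
    have c0_q: "c0 M ?q" by (intro c0_scaleR c0_diff c0_flow c0)
    have "norm (?a \<psi> - ?a ?q) \<le> B\<kappa> * ?v * \<eta>"
    proof (rule average_diff_le[OF continuous_\<kappa> B\<kappa>(2) continuous_u u_invariant[OF m] c0(2) c0_q])
      fix m assume "m \<in> M"
      then show "norm (\<psi> m - ?q m) \<le> \<eta>"
        using d1(2)[of h m] h by (simp add: norm_minus_commute divide_inverse)
    qed
    moreover have "norm (?a ?q - ?b) \<le> Bk * ?v * \<eta>"
    proof -
      have mv: "norm (?a (\<lambda>z. \<phi> (?E (- h) *v z)) - ?a \<phi> - h *\<^sub>R ?b) \<le> \<bar>h\<bar> * (Bk * ?v * \<eta>)"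
      proof (rule average_mean_value[OF X c0(1) m _ k_cont Bk(2) B\<kappa>(2)])
        fix t m assume t: "\<bar>t\<bar> \<le> \<bar>h\<bar>" and "m \<in> M"
        have "\<bar>t\<bar> < d2" using t h by linarith
        then show "norm (\<phi> (?E t *v m) - \<phi> m) \<le> \<eta>" using d2(2)[of t m] \<open>m \<in> M\<close> by simp
      qed (rule k)
      have cont1: "continuous_on UNIV (\<lambda>y. \<kappa> \<epsilon> y *\<^sub>R \<phi> (?E (- h) *v (u \<epsilon> y *v m)))"
        by (rule continuous_on_scaleR[OF continuous_\<kappa> c0_compose_continuous[OF c0_flow continuous_u u_invariant[OF m]]])
      have cont2: "continuous_on UNIV (\<lambda>y. \<kappa> \<epsilon> y *\<^sub>R \<phi> (u \<epsilon> y *v m))"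
        by (rule continuous_on_scaleR[OF continuous_\<kappa> c0_compose_continuous[OF c0(1) continuous_u u_invariant[OF m]]])
      have "?a ?q = integral big_box (\<lambda>y. (1 / h) *\<^sub>R (\<kappa> \<epsilon> y *\<^sub>R \<phi> (?E (- h) *v (u \<epsilon> y *v m)) - \<kappa> \<epsilon> y *\<^sub>R \<phi> (u \<epsilon> y *v m)))"
        unfolding average_def by (simp add: scaleR_diff_right mult_ac)
      also have "\<dots> = (1 / h) *\<^sub>R (?a (\<lambda>z. \<phi> (?E (- h) *v z)) - ?a \<phi>)"
        unfolding integral_cmul average_def
        by (subst integral_diff[OF continuous_integrable_big_box[OF cont1] continuous_integrable_big_box[OF cont2]]) (rule refl)
      finally have "?a ?q - ?b = (1 / h) *\<^sub>R (?a (\<lambda>z. \<phi> (?E (- h) *v z)) - ?a \<phi> - h *\<^sub>R ?b)"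
        using h(1) by (simp add: scaleR_diff_right)
      then have "norm (?a ?q - ?b) = (1 / h) * norm (?a (\<lambda>z. \<phi> (?E (- h) *v z)) - ?a \<phi> - h *\<^sub>R ?b)"
        using h(1) by simp
      also have "\<dots> \<le> (1 / h) * (\<bar>h\<bar> * (Bk * ?v * \<eta>))" using h(1) by (intro mult_left_mono mv) auto
      also have "\<dots> = Bk * ?v * \<eta>" using h(1) by simp
      finally show ?thesis .
    qed
    moreover have "norm (?a \<psi> - ?b) \<le> norm (?a \<psi> - ?a ?q) + norm (?a ?q - ?b)"
      using norm_triangle_ineq[of "?a \<psi> - ?a ?q" "?a ?q - ?b"] by simp
    moreover have "B\<kappa> * ?v * \<eta> + Bk * ?v * \<eta> \<le> Q * \<eta>" using \<eta>(1) by (simp add: Q_def algebra_simps)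
    ultimately show ?thesis using \<eta>(2) by linarith
  qed
  then have "norm (?a \<psi> - ?b) \<le> 0" by (rule field_le_epsilon)
  then show ?thesis by simp
qed

end

text \<open>With A w = w + v the defect is 2 (w \<bullet> v) + v \<bullet> v, and |v| \<le> |w|/12
  bounds it by (1/6 + 1/144) |w|^2, below a quarter.\<close>

lemma quad_defect_small:
  obtains r where "r > 0" "\<And>(A::real^'n^'n) w. norm (A - mat 1) < r \<Longrightarrow> \<bar>quad_defect A w\<bar> \<le> (w \<bullet> w) / 4"
proof -
  obtain K where K: "K > 0" "\<And>(A::real^'n^'n) x. norm (A *v x) \<le> K * norm A * norm x"
    by (rule matrix_vector_norm_bound) blast
  show ?thesis
  proof (rule that[of "1 / (12 * K)"])
    show "1 / (12 * K) > 0" using K(1) by simp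
    fix A :: "real^'n^'n" and w
    assume A: "norm (A - mat 1) < 1 / (12 * K)"
    define v where "v = (A - mat 1) *v w"
    have "A *v w = w + v" by (simp add: v_def matvec.diff_left)
    then have q: "quad_defect A w = 2 * (w \<bullet> v) + v \<bullet> v"
      by (simp add: quad_defect_def inner_add_left inner_add_right inner_commute)
    have "K * norm (A - mat 1) \<le> 1 / 12" using A K(1) by (simp add: field_simps)
    then have "K * norm (A - mat 1) * norm w \<le> 1 / 12 * norm w" by (rule mult_right_mono) simp
    then have v: "norm v \<le> 1 / 12 * norm w" using K(2)[of "A - mat 1" w] unfolding v_def by linarith
    have "\<bar>w \<bullet> v\<bar> \<le> norm w * norm v" by (rule Cauchy_Schwarz_ineq2)
    also have "\<dots> \<le> norm w * (1 / 12 * norm w)" by (intro mult_left_mono v) simp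
    finally have wv: "\<bar>w \<bullet> v\<bar> \<le> (w \<bullet> w) / 12" by (simp add: dot_square_norm power2_eq_square)
    have "norm v * norm v \<le> (1 / 12 * norm w) * (1 / 12 * norm w)" by (intro mult_mono v) auto
    then have vv: "v \<bullet> v \<le> (w \<bullet> w) / 144" by (simp add: dot_square_norm power2_eq_square)
    have "v \<bullet> v \<ge> 0" "w \<bullet> w \<ge> 0" by simp_all
    with wv vv show "\<bar>quad_defect A w\<bar> \<le> (w \<bullet> w) / 4" unfolding q by linarith
  qed
qed

lemma C1_deriv_unique: "C1_deriv F F' \<Longrightarrow> C1_deriv F F'' \<Longrightarrow> F' = F''"
  by (rule ext) (rule has_derivative_unique[OF C1_derivD C1_derivD])

lemma has_generator_value_gauss:
  fixes M :: "(real^'n) set"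
  assumes M: "closed M" "\<And>t m. m \<in> M \<Longrightarrow> matrix_exp (t *\<^sub>R X) *v m \<in> M"
    and p: "polynomial_function p" "C1_deriv (gauss 1 p) F'"
  shows "has_generator_value M X (restrict (gauss 1 p) M) (\<lambda>z\<in>M. - F' z (X *v z))"
proof -
  obtain F'' q where q: "C1_deriv (gauss 1 p) F''" "polynomial_function q" "\<And>z. - F'' z (X *v z) = gauss 1 q z"
    by (rule gauss_vector_field[OF p(1), where a=1 and X=X]) blast
  have "c0 M (gauss 1 q)" by (rule c0_gauss[OF q(2)]) simp
  then have "has_generator_value M X (restrict (gauss 1 p) M) (restrict (gauss 1 q) M)"
    by (intro generator_gauss[OF M _ p(1) q(1,3)]) simp_all
  then show ?thesis
    unfolding C1_deriv_unique[OF p(2) q(1)] q(3) .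
qed

section \<open>Simultaneous approximation of a function and its generator values\<close>

context action_chart
begin

text \<open>Packed as one existential over a pair so that a choice over the indices of the
  generators is possible. The first kernel represents T d\<pi>(X), the second the commutator; only
  the second is bounded uniformly in \<epsilon> and has integrals tending to 0.\<close>

lemma commutator_kernel_family:
  assumes X: "X \<in> lie_algebra G"
  shows "\<exists>kr :: (real \<Rightarrow> real^('n \<times> 'n) \<Rightarrow> real) \<times> (real \<Rightarrow> real^('n \<times> 'n) \<Rightarrow> real).
    (\<forall>\<epsilon>. continuous_on UNIV (fst kr \<epsilon>) \<and> continuous_on UNIV (snd kr \<epsilon>)) \<and>
    (\<forall>\<epsilon> y. norm y > 1 \<longrightarrow> fst kr \<epsilon> y = 0 \<and> snd kr \<epsilon> y = 0) \<and>
    (\<exists>B. \<forall>\<^sub>F \<epsilon> in at_right 0. \<forall>y. \<bar>snd kr \<epsilon> y\<bar> \<le> B) \<and>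
    ((\<lambda>\<epsilon>. integral big_box (snd kr \<epsilon>)) \<longlongrightarrow> 0) (at_right 0) \<and>
    (\<forall>\<epsilon> F F' z. 0 < \<epsilon> \<and> \<epsilon> < \<delta> \<and> C1_deriv F F' \<longrightarrow>
       average (\<kappa> \<epsilon>) (u \<epsilon>) (\<lambda>z. - F' z (X *v z)) z = average (fst kr \<epsilon>) (u \<epsilon>) F z \<and>
       average_deriv (\<kappa> \<epsilon>) (u \<epsilon>) F' X z = average (fst kr \<epsilon>) (u \<epsilon>) F z + average (snd kr \<epsilon>) (u \<epsilon>) F z)"
proof -
  obtain c c' e e' where c: "C1_deriv c c'" and e: "C1_deriv e e'" "e 0 = 0"
    and id: "\<And>\<epsilon> F F' z. 0 < \<epsilon> \<Longrightarrow> \<epsilon> < \<delta> \<Longrightarrow> C1_deriv F F' \<Longrightarrow>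
       average (\<kappa> \<epsilon>) (u \<epsilon>) (\<lambda>z. - F' z (X *v z)) z = average (kern c c' \<epsilon>) (u \<epsilon>) F z"
    "\<And>\<epsilon> F F' z. 0 < \<epsilon> \<Longrightarrow> \<epsilon> < \<delta> \<Longrightarrow> C1_deriv F F' \<Longrightarrow>
       average_deriv (\<kappa> \<epsilon>) (u \<epsilon>) F' X z =
         average (kern c c' \<epsilon>) (u \<epsilon>) F z + average (kern e e' \<epsilon>) (u \<epsilon>) F z"
    by (rule commutator_kernels[OF X]) (rule that; simp)
  obtain B where B: "\<forall>\<^sub>F \<epsilon> in at_right 0. \<forall>y. \<bar>kern e e' \<epsilon> y\<bar> \<le> B"
    by (rule kern_bound[OF e])
  have "\<forall>\<^sub>F \<epsilon>::real in at_right 0. integral big_box (kern e e' \<epsilon>) = 0"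
    by (rule eventually_mono[OF eventually_at_right_less]) (rule kern_integral[OF e(1)], simp)
  then have lim: "((\<lambda>\<epsilon>. integral big_box (kern e e' \<epsilon>)) \<longlongrightarrow> 0) (at_right 0)"
    by (rule tendsto_eventually)
  show ?thesis
  proof (rule exI[of _ "(kern c c', kern e e')"], unfold fst_conv snd_conv, intro conjI allI impI)
    show "continuous_on UNIV (kern c c' \<epsilon>)" "continuous_on UNIV (kern e e' \<epsilon>)" for \<epsilon>
      by (rule continuous_kern[OF c], rule continuous_kern[OF e(1)])
    show "kern c c' \<epsilon> y = 0" "kern e e' \<epsilon> y = 0" if "1 < norm y" for \<epsilon> y
      by (rule kern_eq_0[OF that])+
    show "\<exists>B. \<forall>\<^sub>F \<epsilon> in at_right 0. \<forall>y. \<bar>kern e e' \<epsilon> y\<bar> \<le> B" using B by blast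
    show "((\<lambda>\<epsilon>. integral big_box (kern e e' \<epsilon>)) \<longlongrightarrow> 0) (at_right 0)" by (rule lim)
    fix \<epsilon> and F :: "real^'n \<Rightarrow> complex" and F' z assume "0 < \<epsilon> \<and> \<epsilon> < \<delta> \<and> C1_deriv F F'"
    then have \<epsilon>: "0 < \<epsilon>" "\<epsilon> < \<delta>" "C1_deriv F F'" by simp_all
    show "average (\<kappa> \<epsilon>) (u \<epsilon>) (\<lambda>z. - F' z (X *v z)) z = average (kern c c' \<epsilon>) (u \<epsilon>) F z"
      "average_deriv (\<kappa> \<epsilon>) (u \<epsilon>) F' X z =
         average (kern c c' \<epsilon>) (u \<epsilon>) F z + average (kern e e' \<epsilon>) (u \<epsilon>) F z"
      by (rule id(1)[OF \<epsilon>], rule id(2)[OF \<epsilon>])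
  qed
qed

lemma ev_quad_defect:
  "\<forall>\<^sub>F \<epsilon> in at_right 0. \<forall>y. norm y \<le> 1 \<longrightarrow> (\<forall>w. \<bar>quad_defect (u \<epsilon> y) w\<bar> \<le> (w \<bullet> w) / 4)"
proof -
  obtain r where r: "r > 0" "\<And>(A::real^'n^'n) w. norm (A - mat 1) < r \<Longrightarrow> \<bar>quad_defect A w\<bar> \<le> (w \<bullet> w) / 4"
    by (rule quad_defect_small) blast
  have "\<forall>\<^sub>F \<epsilon> in at_right 0. \<forall>y. norm y \<le> 1 \<longrightarrow> dist (U (\<epsilon> *\<^sub>R y)) (U 0) < r"
    by (rule small_dilation[OF C1_deriv_continuous[OF U'] r(1)])
  then show ?thesis
    by (rule eventually_mono) (intro allI impI r(2), simp add: u_def U_0 dist_norm)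
qed

text \<open>The order of the choices is essential. The strong limits for \<phi>, the \<psi>_i and
  the commutators fix \<epsilon>; the kernels at this \<epsilon> have a common bound B; B determines
  how close a Gaussian polynomial must be to \<phi>; its average is finally replaced by a Gaussian
  polynomial. All fields are treated with the same \<epsilon> and the same polynomials.\<close>

lemma core_approximation:
  fixes X :: "nat \<Rightarrow> real^'n^'n"
  assumes X: "\<And>i. i \<in> {1..k} \<Longrightarrow> X i \<in> lie_algebra G"
    and \<phi>: "\<phi> \<in> mspace (c0_space M)"
    and gen: "\<And>i. i \<in> {1..k} \<Longrightarrow> has_generator_value M (X i) \<phi> (\<psi> i)" and "e > 0"
  shows "\<exists>p \<theta>. polynomial_function p \<and> (\<forall>m\<in>M. norm (\<phi> m - gauss 1 p m) \<le> e) \<and>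
    (\<forall>i\<in>{1..k}. has_generator_value M (X i) (restrict (gauss 1 p) M) (\<theta> i) \<and>
      (\<forall>m\<in>M. norm (\<psi> i m - \<theta> i m) \<le> e))"
proof -
  let ?v = "measure lborel (big_box :: (real^('n \<times> 'n)) set)"
  \<comment> \<open>Five error terms arise in the estimate of a generator value.\<close>
  define e5 where "e5 = e / 5"
  have e5: "e5 > 0" using \<open>e > 0\<close> by (simp add: e5_def)
  have c0_\<phi>: "c0 M \<phi>" using \<phi> mspace_c0_space[OF closed_M] by blast
  have c0_\<psi>: "c0 M (\<psi> i)" if i: "i \<in> {1..k}" for i
  proof -
    have "\<psi> i \<in> mspace (c0_space M)"
      by (rule conjunct1[OF iffD1[OF has_generator_value_iff gen[OF i]]])
        (rule closed_M, erule exp_invariant[OF X[OF i]], rule \<phi>)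
    then show ?thesis using mspace_c0_space[OF closed_M] by blast
  qed
  have "\<forall>i\<in>{1..k}. \<exists>kr :: (real \<Rightarrow> real^('n \<times> 'n) \<Rightarrow> real) \<times> (real \<Rightarrow> real^('n \<times> 'n) \<Rightarrow> real).
    (\<forall>\<epsilon>. continuous_on UNIV (fst kr \<epsilon>) \<and> continuous_on UNIV (snd kr \<epsilon>)) \<and>
    (\<forall>\<epsilon> y. norm y > 1 \<longrightarrow> fst kr \<epsilon> y = 0 \<and> snd kr \<epsilon> y = 0) \<and>
    (\<exists>B. \<forall>\<^sub>F \<epsilon> in at_right 0. \<forall>y. \<bar>snd kr \<epsilon> y\<bar> \<le> B) \<and>
    ((\<lambda>\<epsilon>. integral big_box (snd kr \<epsilon>)) \<longlongrightarrow> 0) (at_right 0) \<and>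
    (\<forall>\<epsilon> F F' z. 0 < \<epsilon> \<and> \<epsilon> < \<delta> \<and> C1_deriv F F' \<longrightarrow>
       average (\<kappa> \<epsilon>) (u \<epsilon>) (\<lambda>z. - F' z (X i *v z)) z = average (fst kr \<epsilon>) (u \<epsilon>) F z \<and>
       average_deriv (\<kappa> \<epsilon>) (u \<epsilon>) F' (X i) z = average (fst kr \<epsilon>) (u \<epsilon>) F z + average (snd kr \<epsilon>) (u \<epsilon>) F z)"
    by (intro ballI commutator_kernel_family X)
  from bchoice[OF this] obtain kr :: "nat \<Rightarrow> (real \<Rightarrow> real^('n \<times> 'n) \<Rightarrow> real) \<times> (real \<Rightarrow> real^('n \<times> 'n) \<Rightarrow> real)"
    where kr: "\<And>i. i \<in> {1..k} \<Longrightarrow>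
    (\<forall>\<epsilon>. continuous_on UNIV (fst (kr i) \<epsilon>) \<and> continuous_on UNIV (snd (kr i) \<epsilon>)) \<and>
    (\<forall>\<epsilon> y. norm y > 1 \<longrightarrow> fst (kr i) \<epsilon> y = 0 \<and> snd (kr i) \<epsilon> y = 0) \<and>
    (\<exists>B. \<forall>\<^sub>F \<epsilon> in at_right 0. \<forall>y. \<bar>snd (kr i) \<epsilon> y\<bar> \<le> B) \<and>
    ((\<lambda>\<epsilon>. integral big_box (snd (kr i) \<epsilon>)) \<longlongrightarrow> 0) (at_right 0) \<and>
    (\<forall>\<epsilon> F F' z. 0 < \<epsilon> \<and> \<epsilon> < \<delta> \<and> C1_deriv F F' \<longrightarrow>
       average (\<kappa> \<epsilon>) (u \<epsilon>) (\<lambda>z. - F' z (X i *v z)) z = average (fst (kr i) \<epsilon>) (u \<epsilon>) F z \<and>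
       average_deriv (\<kappa> \<epsilon>) (u \<epsilon>) F' (X i) z =
         average (fst (kr i) \<epsilon>) (u \<epsilon>) F z + average (snd (kr i) \<epsilon>) (u \<epsilon>) F z)"
    by blast
  define K where "K i = fst (kr i)" for i
  define R where "R i = snd (kr i)" for i
  have K: "continuous_on UNIV (K i \<epsilon>)" "norm y > 1 \<Longrightarrow> K i \<epsilon> y = 0"
    and R: "continuous_on UNIV (R i \<epsilon>)" "norm y > 1 \<Longrightarrow> R i \<epsilon> y = 0"
    if "i \<in> {1..k}" for i \<epsilon> y
    using kr[OF that] by (simp_all add: K_def R_def)
  have R_bound: "\<exists>B. \<forall>\<^sub>F \<epsilon> in at_right 0. \<forall>y. \<bar>R i \<epsilon> y\<bar> \<le> B"
    and R_lim: "((\<lambda>\<epsilon>. integral big_box (R i \<epsilon>)) \<longlongrightarrow> 0) (at_right 0)"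
    if "i \<in> {1..k}" for i
    using kr[OF that] by (simp_all add: R_def)
  have id1: "average (\<kappa> \<epsilon>) (u \<epsilon>) (\<lambda>z. - F' z (X i *v z)) z = average (K i \<epsilon>) (u \<epsilon>) F z"
    and id2: "average_deriv (\<kappa> \<epsilon>) (u \<epsilon>) F' (X i) z = average (K i \<epsilon>) (u \<epsilon>) F z + average (R i \<epsilon>) (u \<epsilon>) F z"
    if "i \<in> {1..k}" "0 < \<epsilon>" "\<epsilon> < \<delta>" "C1_deriv F F'" for i \<epsilon> F F' z
    using kr[OF that(1)] that(2-4) by (simp_all add: K_def R_def)
  obtain B\<kappa>0 where B\<kappa>0: "\<forall>\<^sub>F \<epsilon> in at_right 0. \<forall>y. \<bar>\<kappa> \<epsilon> y\<bar> \<le> B\<kappa>0" by (rule \<kappa>_bound)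
  have ev1: "\<forall>\<^sub>F \<epsilon> in at_right 0. \<forall>m\<in>M. norm (average (\<kappa> \<epsilon>) (u \<epsilon>) f m - 1 *\<^sub>R f m) \<le> e5" if "c0 M f" for f
    by (rule average_limit[OF continuous_\<kappa> \<kappa>_eq_0 B\<kappa>0 \<kappa>_integral that e5])
  have ev2: "\<forall>\<^sub>F \<epsilon> in at_right 0. \<forall>i\<in>{1..k}. \<forall>m\<in>M. norm (average (\<kappa> \<epsilon>) (u \<epsilon>) (\<psi> i) m - 1 *\<^sub>R \<psi> i m) \<le> e5"
    by (rule eventually_ball_finite[OF finite_atLeastAtMost], rule ballI) (rule ev1[OF c0_\<psi>])
  have ev3: "\<forall>\<^sub>F \<epsilon> in at_right 0. \<forall>i\<in>{1..k}. \<forall>m\<in>M. norm (average (R i \<epsilon>) (u \<epsilon>) \<phi> m - 0 *\<^sub>R \<phi> m) \<le> e5"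
  proof (rule eventually_ball_finite[OF finite_atLeastAtMost], rule ballI)
    fix i assume i: "i \<in> {1..k}"
    obtain B where B: "\<forall>\<^sub>F \<epsilon> in at_right 0. \<forall>y. \<bar>R i \<epsilon> y\<bar> \<le> B" using R_bound[OF i] by blast
    show "\<forall>\<^sub>F \<epsilon> in at_right 0. \<forall>m\<in>M. norm (average (R i \<epsilon>) (u \<epsilon>) \<phi> m - 0 *\<^sub>R \<phi> m) \<le> e5"
      by (rule average_limit[OF R[OF i] B R_lim[OF i] c0_\<phi> e5])
  qed
  have ev4: "\<forall>\<^sub>F \<epsilon> in at_right 0. 0 < \<epsilon> \<and> \<epsilon> < \<delta>"
    unfolding eventually_at_right_field using \<delta>_pos by (intro exI[of _ \<delta>]) simp
  obtain \<epsilon> where \<epsilon>: "0 < \<epsilon>" "\<epsilon> < \<delta>"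
    and t1: "\<And>m. m \<in> M \<Longrightarrow> norm (average (\<kappa> \<epsilon>) (u \<epsilon>) \<phi> m - \<phi> m) \<le> e5"
    and t2: "\<And>i m. i \<in> {1..k} \<Longrightarrow> m \<in> M \<Longrightarrow> norm (average (\<kappa> \<epsilon>) (u \<epsilon>) (\<psi> i) m - \<psi> i m) \<le> e5"
    and t3: "\<And>i m. i \<in> {1..k} \<Longrightarrow> m \<in> M \<Longrightarrow> norm (average (R i \<epsilon>) (u \<epsilon>) \<phi> m) \<le> e5"
    and quad: "\<And>y w. norm y \<le> 1 \<Longrightarrow> \<bar>quad_defect (u \<epsilon> y) w\<bar> \<le> (w \<bullet> w) / 4"
    using eventually_happens'[OF trivial_limit_at_right_real
        eventually_conj[OF ev4 eventually_conj[OF ev1[OF c0_\<phi>] eventually_conj[OF ev2 eventually_conj[OF ev3 ev_quad_defect]]]]]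
    by (auto simp: scaleR_one)
  obtain B\<kappa> where B\<kappa>: "B\<kappa> \<ge> 0" "\<And>y. \<bar>\<kappa> \<epsilon> y\<bar> \<le> B\<kappa>" by (rule bounded_kernel[of "\<kappa> \<epsilon>", OF continuous_\<kappa> \<kappa>_eq_0]) blast+
  have "\<forall>i\<in>{1..k}. \<exists>B\<ge>0. \<forall>y. \<bar>K i \<epsilon> y\<bar> \<le> B \<and> \<bar>R i \<epsilon> y\<bar> \<le> B"
  proof
    fix i assume i: "i \<in> {1..k}"
    obtain B1 where B1: "B1 \<ge> 0" "\<And>y. \<bar>K i \<epsilon> y\<bar> \<le> B1" by (rule bounded_kernel[of "K i \<epsilon>", OF K[OF i]]) blast+
    obtain B2 where B2: "B2 \<ge> 0" "\<And>y. \<bar>R i \<epsilon> y\<bar> \<le> B2" by (rule bounded_kernel[of "R i \<epsilon>", OF R[OF i]]) blast+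
    show "\<exists>B\<ge>0. \<forall>y. \<bar>K i \<epsilon> y\<bar> \<le> B \<and> \<bar>R i \<epsilon> y\<bar> \<le> B"
      using B1 B2 by (intro exI[of _ "max B1 B2"]) (auto intro: max.coboundedI1 max.coboundedI2)
  qed
  from bchoice[OF this] obtain BB where BB: "\<And>i. i \<in> {1..k} \<Longrightarrow> BB i \<ge> 0"
    "\<And>i y. i \<in> {1..k} \<Longrightarrow> \<bar>K i \<epsilon> y\<bar> \<le> BB i" "\<And>i y. i \<in> {1..k} \<Longrightarrow> \<bar>R i \<epsilon> y\<bar> \<le> BB i"
    by blast
  define B where "B = B\<kappa> + (\<Sum>i\<in>{1..k}. BB i)"
  have B_ge: "B \<ge> 0" "B\<kappa> \<le> B" using B\<kappa>(1) sum_nonneg[of "{1..k}" BB, OF BB(1)] unfolding B_def by simp_all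
  have BB_le: "BB i \<le> B" if "i \<in> {1..k}" for i
    using member_le_sum[of i "{1..k}" BB] that BB(1) B\<kappa>(1) unfolding B_def by fastforce
  \<comment> \<open>Averages with kernel bounded by B have Lipschitz constant at most B times the
    volume of the box. The factor 2 pays for the two kernels K and R, the summand 1 keeps the
    denominator positive.\<close>
  define \<eta> where "\<eta> = e5 / (2 * B * ?v + 1)"
  have pos: "2 * B * ?v + 1 > 0" using B_ge by (intro add_nonneg_pos) auto
  have \<eta>: "\<eta> > 0" "2 * (B * ?v * \<eta>) \<le> e5"
  proof -
    show "\<eta> > 0" using e5 pos by (simp add: \<eta>_def)
    have "(2 * B * ?v + 1) * \<eta> = e5" using pos by (simp add: \<eta>_def)
    then have "2 * B * ?v * \<eta> + \<eta> = e5" by (simp only: distrib_right mult_1_left)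
    then show "2 * (B * ?v * \<eta>) \<le> e5" using \<open>\<eta> > 0\<close> unfolding mult.assoc by linarith
  qed
  obtain p where p: "polynomial_function p" "\<And>m. m \<in> M \<Longrightarrow> norm (\<phi> m - gauss 1 p m) < \<eta>"
    by (rule gauss_dense[OF closed_M c0_\<phi> \<eta>(1)]) blast
  let ?F = "gauss 1 p"
  obtain p' where "C1_deriv p p'" by (rule polynomial_function_derivative[OF p(1)])
  then obtain F' where F': "C1_deriv ?F F'" using C1_deriv_gauss by blast
  have c0_F: "c0 M ?F" by (rule c0_gauss[OF p(1)]) simp
  have diff: "norm (average k (u \<epsilon>) \<phi> m - average k (u \<epsilon>) ?F m) \<le> B * ?v * \<eta>"
    if "continuous_on UNIV k" "\<And>y. \<bar>k y\<bar> \<le> B" "m \<in> M" for k m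
    by (rule average_diff_le[where u="u \<epsilon>", OF that(1,2) continuous_u u_invariant[OF that(3)] c0_\<phi> c0_F])
      (rule less_imp_le[OF p(2)])
  obtain P P' where P: "polynomial_function P" "C1_deriv (gauss 1 P) P'"
    "\<And>z. norm (average (\<kappa> \<epsilon>) (u \<epsilon>) ?F z - gauss 1 P z) \<le> e5"
    "\<And>Y z. Y \<in> X ` {1..k} \<Longrightarrow> norm (average_deriv (\<kappa> \<epsilon>) (u \<epsilon>) F' Y z - - P' z (Y *v z)) \<le> e5"
    by (rule average_gauss_approx[where \<X>="X ` {1..k}" and \<kappa>="\<kappa> \<epsilon>" and u="u \<epsilon>", OF p(1) F' continuous_\<kappa> \<kappa>_eq_0 continuous_u quad finite_imageI[OF finite_atLeastAtMost] e5];
        (assumption | (rule that; (assumption | iprover))))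
  show ?thesis
  proof (intro exI[of _ P] exI[of _ "\<lambda>i. \<lambda>z\<in>M. - P' z (X i *v z)"] conjI ballI P(1))
    fix m assume m: "m \<in> M"
    let ?T = "\<lambda>f. average (\<kappa> \<epsilon>) (u \<epsilon>) f m"
    have d: "norm (?T \<phi> - ?T ?F) \<le> B * ?v * \<eta>"
      by (rule diff[OF continuous_\<kappa> order_trans[OF B\<kappa>(2) B_ge(2)] m])
    have "norm (\<phi> m - gauss 1 P m) \<le> norm (\<phi> m - ?T \<phi>) + norm (?T \<phi> - ?T ?F) + norm (?T ?F - gauss 1 P m)"
      using norm_triangle_ineq[of "\<phi> m - ?T \<phi> + (?T \<phi> - ?T ?F)" "?T ?F - gauss 1 P m"]
        norm_triangle_ineq[of "\<phi> m - ?T \<phi>" "?T \<phi> - ?T ?F"] by simp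
    also have "\<dots> \<le> e5 + B * ?v * \<eta> + e5"
      using t1[OF m] d P(3)[of m] by (intro add_mono) (simp_all add: norm_minus_commute)
    also have "\<dots> \<le> e" using \<eta>(2) e5 unfolding e5_def by linarith
    finally show "norm (\<phi> m - gauss 1 P m) \<le> e" .
  next
    fix i assume i: "i \<in> {1..k}"
    show "has_generator_value M (X i) (restrict (gauss 1 P) M) (\<lambda>z\<in>M. - P' z (X i *v z))"
      by (rule has_generator_value_gauss[OF closed_M _ P(1,2)]) (rule exp_invariant[OF X[OF i]])
    fix m assume m: "m \<in> M"
    let ?T = "average (\<kappa> \<epsilon>) (u \<epsilon>) (\<psi> i) m" and ?K = "\<lambda>f. average (K i \<epsilon>) (u \<epsilon>) f m"
      and ?R = "\<lambda>f. average (R i \<epsilon>) (u \<epsilon>) f m" and ?A = "average_deriv (\<kappa> \<epsilon>) (u \<epsilon>) F' (X i) m"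
    \<comment> \<open>The decisive exchange: the average of \<psi>_i becomes an average of \<phi>,
      so that closeness of the polynomial to \<phi> alone controls the generator value.\<close>
    have T: "?T = ?K \<phi>"
      by (rule average_generator[OF X[OF i] \<phi> gen[OF i] m], rule id1[OF i \<epsilon>], assumption)
        (rule K[OF i], assumption?)+
    have A: "?A = ?K ?F + ?R ?F" by (rule id2[OF i \<epsilon> F'])
    have dK: "norm (?K \<phi> - ?K ?F) \<le> B * ?v * \<eta>"
      by (rule diff[OF K(1)[OF i] order_trans[OF BB(2)[OF i] BB_le[OF i]] m])
    have dR: "norm (?R \<phi> - ?R ?F) \<le> B * ?v * \<eta>"
      by (rule diff[OF R(1)[OF i] order_trans[OF BB(3)[OF i] BB_le[OF i]] m])
    have dA: "norm (?A - - P' m (X i *v m)) \<le> e5" by (rule P(4)) (use i in blast)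
    have "norm (\<psi> i m - - P' m (X i *v m)) \<le>
        norm (\<psi> i m - ?K \<phi>) + norm (?K \<phi> - ?K ?F) + norm (?R \<phi> - ?R ?F) + norm (?R \<phi>) + norm (?A - - P' m (X i *v m))"
    proof -
      \<comment> \<open>Here c + s is the derivative of the average, split into K and R parts of the
        polynomial; the commutator is compared with r, its value on \<phi>, which is small, because
        a bound on the polynomial itself was never chosen.\<close>
      have tri: "norm (a - p) \<le> norm (a - b) + norm (b - c) + norm (r - s) + norm r + norm (c + s - p)"
        for a b c r s p :: complex
      proof -
        have "a - p = (a - b) + (b - c) + (r - s) - r + (c + s - p)" by simp
        also have "norm \<dots> \<le> norm (a - b) + norm (b - c) + norm (r - s) + norm r + norm (c + s - p)"
          by (rule norm_triangle_le[OF add_right_mono], rule order_trans[OF norm_triangle_ineq4 add_right_mono],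
              rule norm_triangle_le[OF add_right_mono], rule norm_triangle_ineq)
        finally show ?thesis .
      qed
      show ?thesis unfolding A by (rule tri)
    qed
    also have "\<dots> \<le> e5 + B * ?v * \<eta> + B * ?v * \<eta> + e5 + e5"
      using t2[OF i m] by (intro add_mono dK dR dA t3[OF i m]) (simp add: T norm_minus_commute)
    also have "\<dots> \<le> e" using \<eta>(2) e5 unfolding e5_def by linarith
    finally show "norm (\<psi> i m - (\<lambda>z\<in>M. - P' z (X i *v z)) m) \<le> e" using m by simp
  qed
qed

end

section \<open>The graph as the closure of its restriction\<close>

lemma closed_algebraic_set:
  assumes "algebraic_set V" shows "closed V"
proof -
  obtain P where P: "\<forall>p\<in>P. real_polynomial_function p" "V = {x. \<forall>p\<in>P. p x = 0}"
    using assms unfolding algebraic_set_def by blast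
  have "V = (\<Inter>p\<in>P. {x. p x = 0})" using P(2) by auto
  moreover have "closed {x. p x = 0}" if "p \<in> P" for p
    using P(1) that
    by (intro closed_Collect_eq continuous_on_const continuous_on_polymonial_function)
      (simp add: real_polynomial_function_eq[symmetric])
  ultimately show ?thesis by (simp add: closed_INT)
qed

text \<open>One inclusion is \<open>core_approximation\<close>. For the other, elements of the
  restricted graph are mean value pairs in each index; this property survives the limit and turns
  the limit into a generator value, one index at a time.\<close>

lemma generators_graph_eq_closure:
  fixes G :: "(real^'n^'n) set" and M :: "(real^'n) set"
  assumes G: "linear_algebraic_group G" and M: "closed M"
    and inv: "\<And>g m. g \<in> G \<Longrightarrow> m \<in> M \<Longrightarrow> g *v m \<in> M"
    and X: "\<And>i. i \<in> {1..k} \<Longrightarrow> X i \<in> lie_algebra G"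
  shows "generators_graph M k X =
    graph_space M k closure_of generators_graph_on (gaussian_polynomials M) M k X"
proof -
  let ?C = "c0_space M" and ?P = "gaussian_polynomials M"
  obtain U V :: "real^('n \<times> 'n) \<Rightarrow> real^'n^'n" and U' D and \<delta> :: real where chart:
    "\<And>x. U x \<in> G" "\<And>x. V x ** U x = mat 1" "U 0 = mat 1"
    "\<And>x X. X \<in> lie_algebra G \<Longrightarrow> V x ** X ** U x \<in> lie_algebra G"
    "C1_deriv U U'" "C1 V" "C1 D" "D 0 = 1" "\<delta> > 0"
    "\<And>Y. C1 Y \<Longrightarrow> (\<And>x. Y x \<in> span (lie_algebra G)) \<Longrightarrow>
       \<exists>c. C1 c \<and> (Y 0 = 0 \<longrightarrow> c 0 = 0) \<and> (\<forall>x. norm x < \<delta> \<longrightarrow> U' x (c x) = D x *\<^sub>R (U x ** Y x))"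
    by (rule group_chart[OF G]) blast
  interpret action_chart G M U V U' D \<delta>
    by unfold_locales (fact M inv chart)+
  have P_ex: "\<exists>p. f = restrict (gauss 1 p) M \<and> polynomial_function p" if "f \<in> ?P" for f
    using that unfolding gaussian_polynomials_eq by blast
  have P_in: "f \<in> mspace ?C" if "f \<in> ?P" for f
    using P_ex[OF that] by (auto simp: mspace_c0_space[OF M] c0_gauss)
  have P_gen: "\<exists>g. has_generator_value M (X i) f (restrict g M) \<and> c0 M g \<and> mean_value_pair M (X i) f (restrict g M)"
    if f: "f \<in> ?P" and i: "i \<in> {1..k}" for f i
  proof -
    obtain p where p: "f = restrict (gauss 1 p) M" "polynomial_function p" using P_ex[OF f] by blast
    obtain F' q where q: "C1_deriv (gauss 1 p) F'" "polynomial_function q" "\<And>z. - F' z (X i *v z) = gauss 1 q z"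
      by (rule gauss_vector_field[OF p(2), where a=1 and X="X i"]) blast
    have inv_i: "matrix_exp (t *\<^sub>R X i) *v m \<in> M" if "m \<in> M" for t m by (rule exp_invariant[OF X[OF i] that])
    have c0_q: "c0 M (gauss 1 q)" by (rule c0_gauss[OF q(2)]) simp
    have "has_generator_value M (X i) f (restrict (gauss 1 q) M)"
      using has_generator_value_gauss[OF M inv_i p(2) q(1)] unfolding p(1) q(3) by simp
    moreover have "mean_value_pair M (X i) f (restrict (gauss 1 q) M)"
      by (subst mean_value_pair_cong[where \<phi>'="gauss 1 p" and \<psi>'="gauss 1 q"])
        (simp_all add: inv_i p(1) mean_value_pair_C1[OF q(1,3)])
    ultimately show ?thesis using c0_q by blast
  qed
  have P_gen_in: "generator M (X i) f \<in> mspace ?C" if "f \<in> ?P" "i \<in> {1..k}" for f i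
    using P_gen[OF that] by (auto simp: generator_eqI mspace_c0_space[OF M])
  have closure: "(\<phi>, \<Psi>) \<in> graph_space M k closure_of generators_graph_on ?P M k X \<longleftrightarrow>
    \<phi> \<in> mspace ?C \<and> \<Psi> \<in> (\<Pi>\<^sub>E i\<in>{1..k}. mspace ?C) \<and>
    (\<forall>\<epsilon>>0. \<exists>f\<in>?P. mdist ?C \<phi> f < \<epsilon> \<and>
       (\<forall>i\<in>{1..k}. mdist ?C (\<Psi> i) (generator M (X i) f) < \<epsilon>))" for \<phi> \<Psi>
    by (rule closure_of_graph) (rule P_in P_gen_in; assumption)+
  show ?thesis
  proof (intro set_eqI iffI)
    fix x assume "x \<in> generators_graph M k X"
    then obtain \<phi> where x: "x = (\<phi>, \<lambda>i\<in>{1..k}. generator M (X i) \<phi>)" and \<phi>: "\<phi> \<in> mspace ?C"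
      and dom: "\<And>i. i \<in> {1..k} \<Longrightarrow> \<phi> \<in> generator_domain M (X i)"
      unfolding generators_graph_def generators_graph_on_def by blast
    have gen: "has_generator_value M (X i) \<phi> (generator M (X i) \<phi>)" if "i \<in> {1..k}" for i
      using dom[OF that] generator_eqI unfolding generator_domain_def by fastforce
    have gen_in: "generator M (X i) \<phi> \<in> mspace ?C" if i: "i \<in> {1..k}" for i
      by (rule conjunct1[OF iffD1[OF has_generator_value_iff gen[OF i]]])
        (rule M, erule exp_invariant[OF X[OF i]], rule \<phi>)
    show "x \<in> graph_space M k closure_of generators_graph_on ?P M k X"
      unfolding x closure
    proof (intro conjI \<phi> allI impI)
      show "(\<lambda>i\<in>{1..k}. generator M (X i) \<phi>) \<in> (\<Pi>\<^sub>E i\<in>{1..k}. mspace ?C)"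
        using gen_in by simp
      fix \<epsilon> :: real assume "\<epsilon> > 0"
      \<comment> \<open>Pointwise bounds give only a non-strict bound on the supremum, while the
        closure asks for a strict one.\<close>
      then have e2: "\<epsilon> / 2 > 0" by simp
      have approx: "\<exists>p \<theta>. polynomial_function p \<and> (\<forall>m\<in>M. norm (\<phi> m - gauss 1 p m) \<le> \<epsilon> / 2) \<and>
          (\<forall>i\<in>{1..k}. has_generator_value M (X i) (restrict (gauss 1 p) M) (\<theta> i) \<and>
            (\<forall>m\<in>M. norm (generator M (X i) \<phi> m - \<theta> i m) \<le> \<epsilon> / 2))"
        by (rule core_approximation[OF X \<phi> gen e2])
      obtain p \<theta> where p: "polynomial_function p" "\<And>m. m \<in> M \<Longrightarrow> norm (\<phi> m - gauss 1 p m) \<le> \<epsilon> / 2"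
        "\<And>i. i \<in> {1..k} \<Longrightarrow> has_generator_value M (X i) (restrict (gauss 1 p) M) (\<theta> i)"
        "\<And>i m. i \<in> {1..k} \<Longrightarrow> m \<in> M \<Longrightarrow> norm (generator M (X i) \<phi> m - \<theta> i m) \<le> \<epsilon> / 2"
        using approx by (elim exE conjE) (rule that; blast)
      let ?f = "restrict (gauss 1 p) M"
      have "?f \<in> ?P" using p(1) unfolding gaussian_polynomials_eq by blast
      moreover have "mdist ?C \<phi> ?f \<le> \<epsilon> / 2"
        using e2 p(2) by (intro mdist_c0_space_le) simp_all
      moreover have "mdist ?C (generator M (X i) \<phi>) (generator M (X i) ?f) \<le> \<epsilon> / 2" if "i \<in> {1..k}" for i
        unfolding generator_eqI[OF p(3)[OF that]] using e2 p(4)[OF that] by (intro mdist_c0_space_le) simp_all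
      ultimately show "\<exists>f\<in>?P. mdist ?C \<phi> f < \<epsilon> \<and>
          (\<forall>i\<in>{1..k}. mdist ?C ((\<lambda>i\<in>{1..k}. generator M (X i) \<phi>) i) (generator M (X i) f) < \<epsilon>)"
        using \<open>\<epsilon> > 0\<close> by (intro bexI[of _ ?f] conjI ballI) fastforce+
    qed
  next
    fix x assume x_in: "x \<in> graph_space M k closure_of generators_graph_on ?P M k X"
    obtain \<phi> \<Psi> where x: "x = (\<phi>, \<Psi>)" by (cases x)
    have \<phi>: "\<phi> \<in> mspace ?C" and \<Psi>: "\<Psi> \<in> (\<Pi>\<^sub>E i\<in>{1..k}. mspace ?C)"
      and approx: "\<And>\<epsilon>. \<epsilon> > 0 \<Longrightarrow> \<exists>f\<in>?P. mdist ?C \<phi> f < \<epsilon> \<and>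
        (\<forall>i\<in>{1..k}. mdist ?C (\<Psi> i) (generator M (X i) f) < \<epsilon>)"
      using x_in unfolding x closure by simp_all
    have gen: "has_generator_value M (X i) \<phi> (\<Psi> i)" if i: "i \<in> {1..k}" for i
    proof (rule mean_value_pair_generator[OF M _ \<phi>])
      show inv_i: "matrix_exp (t *\<^sub>R X i) *v m \<in> M" if "m \<in> M" for t m by (rule exp_invariant[OF X[OF i] that])
      show \<Psi>_i: "\<Psi> i \<in> mspace ?C" using \<Psi> i by (rule PiE_mem)
      show "mean_value_pair M (X i) \<phi> (\<Psi> i)"
      proof (rule mean_value_pair_limit[OF inv_i])
        fix \<epsilon> :: real assume "\<epsilon> > 0"
        then obtain f where f: "f \<in> ?P" "mdist ?C \<phi> f < \<epsilon>" "mdist ?C (\<Psi> i) (generator M (X i) f) < \<epsilon>"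
          using approx i by blast
        obtain g where g: "has_generator_value M (X i) f (restrict g M)" "mean_value_pair M (X i) f (restrict g M)"
          using P_gen[OF f(1) i] by blast
        have g_eq: "generator M (X i) f = restrict g M" by (rule generator_eqI[OF g(1)])
        show "\<exists>f g. mean_value_pair M (X i) f g \<and> (\<forall>m\<in>M. norm (\<phi> m - f m) \<le> \<epsilon> \<and> norm (\<Psi> i m - g m) \<le> \<epsilon>)"
        proof (rule exI[of _ f], rule exI[of _ "restrict g M"], intro conjI ballI g(2))
          fix m assume m: "m \<in> M"
          show "norm (\<phi> m - f m) \<le> \<epsilon>"
            by (rule mdist_c0_spaceD[OF \<phi> P_in[OF f(1)] less_imp_le[OF f(2)] m])
          show "norm (\<Psi> i m - restrict g M m) \<le> \<epsilon>"
            using mdist_c0_spaceD[OF \<Psi>_i P_gen_in[OF f(1) i] less_imp_le[OF f(3)] m] unfolding g_eq .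
        qed
      qed
    qed
    \<comment> \<open>Extensionality of \<Psi> matters here: the limits determine it only on the
      indices 1 to k.\<close>
    have "\<Psi> = (\<lambda>i\<in>{1..k}. generator M (X i) \<phi>)"
    proof (rule extensionalityI[of _ "{1..k}"])
      show "\<Psi> \<in> extensional {1..k}" using \<Psi> by (simp add: PiE_iff)
    qed (simp_all add: generator_eqI[OF gen])
    moreover have "\<phi> \<in> generator_domain M (X i)" if "i \<in> {1..k}" for i
      unfolding generator_domain_def using \<phi> gen[OF that] by blast
    ultimately show "x \<in> generators_graph M k X"
      unfolding generators_graph_def generators_graph_on_def x using \<phi> by blast
  qed
qed

theorem theorem1:
  fixes G :: "(real^'n^'n) set" and M :: "(real^'n) set"
  assumes "linear_algebraic_group G"
    and "smooth_affine_variety M"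
    and "\<And>g m. g \<in> G \<Longrightarrow> m \<in> M \<Longrightarrow> g *v m \<in> M"
  shows "(\<forall>k X. (\<forall>i\<in>{1..k}. X i \<in> lie_algebra G) \<longrightarrow>
            generators_graph M k X =
              graph_space M k closure_of generators_graph_on (gaussian_polynomials M) M k X) \<and>
         (\<forall>d a. inj_on a {1..d} \<and> independent (a ` {1..d}) \<and>
              span (a ` {1..d}) = lie_algebra G \<longrightarrow>
            generators_graph M d a =
              graph_space M d closure_of generators_graph_on (gaussian_polynomials M) M d a)"
proof -
  have closed: "closed M"
    using assms(2) unfolding smooth_affine_variety_def by (blast intro: closed_algebraic_set)
  have main: "generators_graph M k X =
      graph_space M k closure_of generators_graph_on (gaussian_polynomials M) M k X"
    if "\<forall>i\<in>{1..k}. X i \<in> lie_algebra G" for k X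
    by (rule generators_graph_eq_closure[OF assms(1) closed assms(3)]) (use that in auto)
  show ?thesis
  proof (intro conjI allI impI)
    fix d :: nat and a :: "nat \<Rightarrow> real^'n^'n"
    assume "inj_on a {1..d} \<and> independent (a ` {1..d}) \<and> span (a ` {1..d}) = lie_algebra G"
    then have "\<forall>i\<in>{1..d}. a i \<in> lie_algebra G" by (metis imageI span_base)
    then show "generators_graph M d a =
        graph_space M d closure_of generators_graph_on (gaussian_polynomials M) M d a"
      by (rule main)
  qed (rule main)
qed

end
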